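(* Let $X$ be a rational affine complexity-one $T$-variety with coordinate ring $R_X$, and let $\mathfrak{v}:R_X\setminus\{0\}\to\mathbb{Z}^r$ be a full rank valuation, $r=\dim X$. The following are equivalent: 1. The valuation $\mathfrak{v}$ is $M$-homogeneous. 2. There exists a semi-canonical embedding of $X$ such that the semi-canonical generating set is a Khovanskii basis for $\mathfrak{v}$. 3. The valuation $\mathfrak{v}$ equals $\mathfrak{v}_W$ for some $W\in\mathrm{Trop}^r(J(L))$ with $\mathrm{rank}(W)=r$, where $J(L)$ is the ideal of forms vanishing on a semi-canonical generating set of $R_X=A(L)$. In the case that these conditions hold (with $L$ and $W$ as in 3), $\mathfrak{v}|_{\mathbb{K}(L)}=\mathrm{ord}_Q\cdot\gamma$ for some $\gamma\in\mathbb{Z}^r$ and some $Q=Q_i\in L\setminus L^\circ$. The initial ideal $\mathrm{In}_W(J(L))$ coincides with the initial ideal of the facet $C_i\subset\mathrm{Trop}(J(L))$. Furthermore, the value semigroup $S(R_X,\mathfrak{v})$ is generated by the columns of $W$.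
   Context: $\mathbb{K}$ is an algebraically closed field. $T$ is an algebraic torus with character lattice $M$ and cocharacter lattice $N$. A $T$-variety is a normal irreducible variety with effective $T$-action; complexity one means $\dim T=\dim X-1$. $\mathbb{Z}^r$ and $\mathbb{Q}^r$ carry the lexicographic order. Valuations. For a finitely generated $\mathbb{K}$-domain $R$ a valuation $\mathfrak{v}:R\setminus\{0\}\to\Gamma$ ($\Gamma$ a totally ordered finitely generated free abelian group) satisfies $\mathfrak{v}(\mathbb{K}^* )=0$, $\mathfrak{v}(fg)=\mathfrak{v}(f)+\mathfrak{v}(g)$, $\mathfrak{v}(f+g)\ge\min\{\mathfrak{v}(f),\mathfrak{v}(g)\}$; it extends uniquely to the fraction field. Its image is the value semigroup $S(R,\mathfrak{v})$; its rank is the rank of the group this generates, and it is of full rank if this equals the Krull dimension of $R$. A Khovanskii basis for a full rank $\mathfrak{v}$ is a subset of $R$ whose image under $\mathfrak{v}$ generates $S(R,\mathfrak{v})$. If $R$ is $M$-graded, $\mathfrak{v}$ is $M$-homogeneous if $\mathfrak{v}(f)=\min_u\mathfrak{v}(f_u)$ over the nonzero graded pieces $f_u$ of $f$. Semi-canonical embeddings. $X$ is equivariantly isomorphic to $X(\mathcal{D})=\mathrm{Spec}\bigoplus_{u\in\sigma^\vee\cap M}H^0(\mathbb{P}^1,\mathcal{O}(\sum_i\lfloor\Delta_i(u)\rfloor P_i))\chi^u$ for a polyhedral divisor $\mathcal{D}=\sum_{i=0}^m\Delta_iP_i$: $P_i\in\mathbb{P}^1$ distinct, $m\geq 1$, $\sigma\subset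 N_\mathbb{Q}$ a pointed polyhedral cone, each $\Delta_i$ empty or a polyhedron in $N_\mathbb{Q}$ with tailcone $\{v:\Delta_i+v\subseteq\Delta_i\}=\sigma$ (trivial coefficients $\Delta_i=\sigma$ allowed), $\sum_i\Delta_i\subsetneq\sigma$, $\Delta_i(u)=\min_{v\in\Delta_i}\langle v,u\rangle$ ($=\infty$ if $\Delta_i=\emptyset$, meaning arbitrary poles allowed). Choose a linear embedding $\mathbb{P}^1\to\mathbb{P}^m=\mathrm{Proj}\,\mathbb{K}[y_0,\dots,y_m]$ pulling $V(y_i)$ back to $P_i$; let $L$ be its image, $Q_i\in L$ the image of $P_i$, $L^\circ=L\cap(\mathbb{K}^* )^m=L\setminus\{Q_0,\dots,Q_m\}$, and $A(L)=\bigoplus_{u\in\sigma^\vee\cap M}H^0(L,\mathcal{O}(\sum_i\lfloor\Delta_i(u)\rfloor Q_i))\chi^u\cong R_X$. Let $e_1,\dots,e_m$ be the standard basis of $\mathbb{Q}^m$, $e_0=-\sum_{i\ge1}e_i$, $C\subset N_\mathbb{Q}\times\mathbb{Q}^m$ the cone generated by $\sigma\times0$ and all $\Delta_i\times e_i$, and $z_i=y_i/y_0$. Then $\chi^{(u,v)}\mapsto z^v|_L\,\chi^u$ is a surjection $\mathbb{K}[C^\vee\cap(M\times\mathbb{Z}^m)]\to A(L)$. For a finite generating set $H$ of $C^\vee\cap(M\times\mathbb{Z}^m)$, $n=\#H$, the images in $A(L)$ of $\chi^h$, $h\in H$, form a semi-canonical generating set, the resulting embedding $X\hookrightarrow\mathbb{A}^n$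 is a semi-canonical embedding, and $J(L)$ is the kernel of $\mathbb{K}[x_h\mid h\in H]\to A(L)$. Tropical data. For $w\in\mathbb{R}^n$, $\mathrm{In}_w(f)$ is the sum of the terms of $f$ of minimal $w$-weight and $\mathrm{In}_w(I)=\langle\mathrm{In}_w(f)\mid f\in I\rangle$. $\mathrm{Trop}(J(L))=\mathrm{Trop}(X^\circ)\subset\mathbb{R}^n$ is the set of $w$ with $\mathrm{In}_w(J(L))$ containing no monomial. With the injective map $\phi:(N\oplus\mathbb{Z}^m)_\mathbb{R}\to\mathbb{R}^{n}$, $a\mapsto(\langle a,h\rangle)_{h\in H}$, its maximal cones are $C_i=\phi(N_\mathbb{R}\times\rho_i)$, $0\le i\le m$, $\rho_i=\mathbb{R}_{\ge0}e_i$; the initial ideal of $C_i$ is $\mathrm{In}_w(J(L))$ for $w$ in the relative interior of $C_i$. For $W\in\mathbb{Q}^{r\times n}$, $\mathrm{In}_W(f)$ for $f=\sum c_\alpha x^\alpha$ is the sum of the terms $c_\alpha x^\alpha$ ($c_\alpha\neq0$) with $W\alpha\in\mathbb{Q}^r$ lexicographically minimal, $\mathrm{In}_W(I)=\langle\mathrm{In}_W(f)\mid f\in I\rangle$, and $\mathrm{Trop}^r(I)=\{W\in\mathbb{Q}^{r\times n}\mid \mathrm{In}_W(I)\text{ contains no monomials}\}$. With $\pi:\mathbb{K}[x_h]\to R_X$ the presentation, for $f\in R_X\setminus\{0\}$, $$\mathfrak{v}_W(f)=\max\big\{\min\{W\alpha\mid p=\textstyle\sum c_\alpha x^\alpha,\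 c_\alpha\ne0\}\ \big|\ p\in\pi^{-1}(f)\big\}.$$ *)

theory Defs
  imports
    "HOL-Analysis.Analysis"
    "HOL-Computational_Algebra.Computational_Algebra"
    "HOL-Algebra.Ideal"
    "HOL-Analysis.Finite_Function_Topology"
begin

text \<open>
  Vectors are finitely supported functions. The order of the library on \<open>nat \<Rightarrow>\<^sub>0 int\<close> and
  \<open>nat \<Rightarrow>\<^sub>0 rat\<close> is the lexicographic one, the smallest index being the most significant.
  The character lattice is \<open>M = coords {..<d}\<close> over \<open>int\<close>, and the rational and real spaces of
  its dual \<open>N\<close> are \<open>coords {..<d}\<close> over \<open>rat\<close> and \<open>real\<close>; the second factor of
  \<open>M \<times> \<int>\<^sup>m\<close> is \<open>coords {1..m}\<close>.
\<close>

definition coords :: "'i set \<Rightarrow> ('i \<Rightarrow>\<^sub>0 'a::zero) set" where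
  "coords I = {a. Poly_Mapping.keys a \<subseteq> I}"

definition pm_scale :: "'a::mult_zero \<Rightarrow> ('i \<Rightarrow>\<^sub>0 'a) \<Rightarrow> ('i \<Rightarrow>\<^sub>0 'a)" where
  "pm_scale c a = Poly_Mapping.map ((*) c) a"

definition rat_vec :: "('i \<Rightarrow>\<^sub>0 int) \<Rightarrow> ('i \<Rightarrow>\<^sub>0 rat)" where
  "rat_vec a = Poly_Mapping.map of_int a"

definition pairing :: "('i \<Rightarrow>\<^sub>0 'a::ring_1) \<Rightarrow> ('i \<Rightarrow>\<^sub>0 int) \<Rightarrow> 'a" where
  "pairing a u = (\<Sum>i\<in>Poly_Mapping.keys a. Poly_Mapping.lookup a i * of_int (Poly_Mapping.lookup u i))"

lemma lookup_pm_scale: "Poly_Mapping.lookup (pm_scale c a) i = c * Poly_Mapping.lookup a i"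
  by (simp add: pm_scale_def Poly_Mapping.map.rep_eq when_def)

lemma lookup_rat_vec: "Poly_Mapping.lookup (rat_vec a) i = of_int (Poly_Mapping.lookup a i)"
  by (simp add: rat_vec_def Poly_Mapping.map.rep_eq when_def)

lemma vector_space_pm_scale: "vector_space (pm_scale :: rat \<Rightarrow> ('i \<Rightarrow>\<^sub>0 rat) \<Rightarrow> _)"
  by standard
    (auto intro!: poly_mapping_eqI simp: lookup_pm_scale lookup_add algebra_simps)

definition q_dim :: "('i \<Rightarrow>\<^sub>0 rat) set \<Rightarrow> nat" where
  "q_dim S = vector_space.dim pm_scale S"

inductive_set monoid_hull :: "'a::monoid_add set \<Rightarrow> 'a set" for S where
  zero: "0 \<in> monoid_hull S"
| add: "s \<in> S \<Longrightarrow> x \<in> monoid_hull S \<Longrightarrow> s + x \<in> monoid_hull S"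

definition group_hull :: "'a::ab_group_add set \<Rightarrow> 'a set" where
  "group_hull S = monoid_hull (S \<union> uminus ` S)"


text \<open>
  Polynomials over \<open>'k\<close> in variables indexed by \<open>'x\<close> have type \<open>('x \<Rightarrow>\<^sub>0 nat) \<Rightarrow>\<^sub>0 'k\<close>;
  \<open>poly_ring H\<close> is \<open>K[x\<^sub>h | h \<in> H]\<close>.
\<close>

definition poly_ring :: "'x set \<Rightarrow> (('x \<Rightarrow>\<^sub>0 nat) \<Rightarrow>\<^sub>0 'k::zero) set" where
  "poly_ring H = {p. \<forall>\<alpha>\<in>Poly_Mapping.keys p. \<alpha> \<in> coords H}"

definition mp_eval ::
  "('k \<Rightarrow> 'a) \<Rightarrow> ('x \<Rightarrow> 'a) \<Rightarrow> (('x \<Rightarrow>\<^sub>0 nat) \<Rightarrow>\<^sub>0 'k::zero) \<Rightarrow> 'a::comm_ring_1" where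
  "mp_eval \<kappa> x p = (\<Sum>\<alpha>\<in>Poly_Mapping.keys p. \<kappa> (Poly_Mapping.lookup p \<alpha>) *
      (\<Prod>h\<in>Poly_Mapping.keys \<alpha>. x h ^ Poly_Mapping.lookup \<alpha> h))"

definition ideal_gen ::
  "'x set \<Rightarrow> (('x \<Rightarrow>\<^sub>0 nat) \<Rightarrow>\<^sub>0 'k::comm_ring_1) set \<Rightarrow> (('x \<Rightarrow>\<^sub>0 nat) \<Rightarrow>\<^sub>0 'k) set" where
  "ideal_gen H S = {\<Sum>g\<in>F. c g * g | F c. finite F \<and> F \<subseteq> S \<and> c ` F \<subseteq> poly_ring H}"

text \<open>Weights of exponents take values in a linear order: real numbers, or \<open>\<rat>\<^sup>r\<close> with the
  lexicographic order.\<close>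

definition min_weight ::
  "(('x \<Rightarrow>\<^sub>0 nat) \<Rightarrow> 'w::linorder) \<Rightarrow> (('x \<Rightarrow>\<^sub>0 nat) \<Rightarrow>\<^sub>0 'k::zero) \<Rightarrow> 'w" where
  "min_weight \<omega> p = Min (\<omega> ` Poly_Mapping.keys p)"

definition initial_form ::
  "(('x \<Rightarrow>\<^sub>0 nat) \<Rightarrow> 'w::linorder) \<Rightarrow> (('x \<Rightarrow>\<^sub>0 nat) \<Rightarrow>\<^sub>0 'k::comm_ring_1) \<Rightarrow> (('x \<Rightarrow>\<^sub>0 nat) \<Rightarrow>\<^sub>0 'k)" where
  "initial_form \<omega> p = (\<Sum>\<alpha> | \<alpha> \<in> Poly_Mapping.keys p \<and> \<omega> \<alpha> = min_weight \<omega> p.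
      Poly_Mapping.single \<alpha> (Poly_Mapping.lookup p \<alpha>))"

definition initial_ideal ::
  "'x set \<Rightarrow> (('x \<Rightarrow>\<^sub>0 nat) \<Rightarrow> 'w::linorder) \<Rightarrow> (('x \<Rightarrow>\<^sub>0 nat) \<Rightarrow>\<^sub>0 'k::comm_ring_1) set
    \<Rightarrow> (('x \<Rightarrow>\<^sub>0 nat) \<Rightarrow>\<^sub>0 'k) set" where
  "initial_ideal H \<omega> I = ideal_gen H (initial_form \<omega> ` I)"

definition contains_monomial :: "'x set \<Rightarrow> (('x \<Rightarrow>\<^sub>0 nat) \<Rightarrow>\<^sub>0 'k::zero) set \<Rightarrow> bool" where
  "contains_monomial H I \<longleftrightarrow> (\<exists>\<alpha>\<in>coords H. \<exists>c. c \<noteq> 0 \<and> Poly_Mapping.single \<alpha> c \<in> I)"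

text \<open>A matrix \<open>W\<close> with \<open>r\<close> rows and columns indexed by \<open>H\<close> is given by its columns
  \<open>W h\<close>, \<open>h \<in> H\<close>.\<close>

definition mat_weight :: "('x \<Rightarrow> (nat \<Rightarrow>\<^sub>0 rat)) \<Rightarrow> ('x \<Rightarrow>\<^sub>0 nat) \<Rightarrow> (nat \<Rightarrow>\<^sub>0 rat)" where
  "mat_weight W \<alpha> = (\<Sum>h\<in>Poly_Mapping.keys \<alpha>. pm_scale (of_nat (Poly_Mapping.lookup \<alpha> h)) (W h))"

definition vec_weight :: "('x \<Rightarrow>\<^sub>0 real) \<Rightarrow> ('x \<Rightarrow>\<^sub>0 nat) \<Rightarrow> real" where
  "vec_weight w \<alpha> = (\<Sum>h\<in>Poly_Mapping.keys \<alpha>. of_nat (Poly_Mapping.lookup \<alpha> h) * Poly_Mapping.lookup w h)"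

definition mat_rank :: "'x set \<Rightarrow> ('x \<Rightarrow> (nat \<Rightarrow>\<^sub>0 rat)) \<Rightarrow> nat" where
  "mat_rank H W = q_dim (W ` H)"

definition trop_r ::
  "nat \<Rightarrow> 'x set \<Rightarrow> (('x \<Rightarrow>\<^sub>0 nat) \<Rightarrow>\<^sub>0 'k::comm_ring_1) set \<Rightarrow> ('x \<Rightarrow> (nat \<Rightarrow>\<^sub>0 rat)) set" where
  "trop_r r H I = {W. W ` H \<subseteq> coords {..<r} \<and>
      \<not> contains_monomial H (initial_ideal H (mat_weight W) I)}"


text \<open>
  An affine variety is given by its coordinate ring, the domain \<open>'r\<close>, with structure map \<open>\<kappa>\<close>
  from the ground field. An action of the torus with character lattice \<open>\<int>\<^sup>d\<close> is a grading
  \<open>G\<close> of the coordinate ring by \<open>\<int>\<^sup>d\<close>; it is effective if the weights generate \<open>\<int>\<^sup>d\<close>.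
\<close>

definition is_algebra_map :: "('k::comm_ring_1 \<Rightarrow> 'r::comm_ring_1) \<Rightarrow> bool" where
  "is_algebra_map \<kappa> \<longleftrightarrow> \<kappa> 1 = 1 \<and> (\<forall>a b. \<kappa> (a + b) = \<kappa> a + \<kappa> b) \<and> (\<forall>a b. \<kappa> (a * b) = \<kappa> a * \<kappa> b)"

definition finitely_generated_algebra :: "('k::comm_ring_1 \<Rightarrow> 'r::comm_ring_1) \<Rightarrow> bool" where
  "finitely_generated_algebra \<kappa> \<longleftrightarrow> (\<exists>A. finite A \<and> mp_eval \<kappa> id ` poly_ring A = UNIV)"

definition integrally_closed :: "'r::idom itself \<Rightarrow> bool" where
  "integrally_closed _ \<longleftrightarrow> (\<forall>q :: 'r fract.
      (\<exists>p :: 'r poly. lead_coeff p = 1 \<and> poly (map_poly to_fract p) q = 0) \<longrightarrow> q \<in> range to_fract)"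

definition krull_dim :: "'r::comm_ring_1 itself \<Rightarrow> enat" where
  "krull_dim _ = Sup {enat n | n. \<exists>P :: nat \<Rightarrow> 'r set.
      (\<forall>i\<le>n. primeideal (P i) \<lparr>carrier = UNIV, mult = (*), one = 1, zero = 0, add = (+)\<rparr>) \<and> (\<forall>i<n. P i \<subset> P (Suc i))}"

definition is_rational :: "('k::comm_ring_1 \<Rightarrow> 'r::idom) \<Rightarrow> bool" where
  "is_rational \<kappa> \<longleftrightarrow> (\<exists>n. \<exists>x :: nat \<Rightarrow> 'r fract.
      (\<forall>p\<in>poly_ring {..<n}. mp_eval (to_fract \<circ> \<kappa>) x p = 0 \<longrightarrow> p = 0) \<and>
      (\<forall>q. \<exists>p1\<in>poly_ring {..<n}. \<exists>p2\<in>poly_ring {..<n}.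
        p2 \<noteq> 0 \<and> q = mp_eval (to_fract \<circ> \<kappa>) x p1 / mp_eval (to_fract \<circ> \<kappa>) x p2))"

definition is_decomp ::
  "nat \<Rightarrow> ((nat \<Rightarrow>\<^sub>0 int) \<Rightarrow> 'r set) \<Rightarrow> 'r::comm_ring_1 \<Rightarrow> ((nat \<Rightarrow>\<^sub>0 int) \<Rightarrow>\<^sub>0 'r) \<Rightarrow> bool" where
  "is_decomp d G f c \<longleftrightarrow> Poly_Mapping.keys c \<subseteq> coords {..<d} \<and>
      (\<forall>u\<in>Poly_Mapping.keys c. Poly_Mapping.lookup c u \<in> G u) \<and>
      f = (\<Sum>u\<in>Poly_Mapping.keys c. Poly_Mapping.lookup c u)"

definition is_grading ::
  "nat \<Rightarrow> ('k::comm_ring_1 \<Rightarrow> 'r::comm_ring_1) \<Rightarrow> ((nat \<Rightarrow>\<^sub>0 int) \<Rightarrow> 'r set) \<Rightarrow> bool" where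
  "is_grading d \<kappa> G \<longleftrightarrow>
      (\<forall>u\<in>coords {..<d}. 0 \<in> G u \<and> (\<forall>f\<in>G u. \<forall>g\<in>G u. f + g \<in> G u) \<and> (\<forall>c. \<forall>f\<in>G u. \<kappa> c * f \<in> G u)) \<and>
      (\<forall>u\<in>coords {..<d}. \<forall>u'\<in>coords {..<d}. \<forall>f\<in>G u. \<forall>g\<in>G u'. f * g \<in> G (u + u')) \<and>
      (\<forall>f. \<exists>!c. is_decomp d G f c)"

definition is_effective :: "nat \<Rightarrow> ((nat \<Rightarrow>\<^sub>0 int) \<Rightarrow> 'r::comm_ring_1 set) \<Rightarrow> bool" where
  "is_effective d G \<longleftrightarrow> group_hull {u \<in> coords {..<d}. G u \<noteq> {0}} = coords {..<d}"

definition rational_complexity_one ::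
  "nat \<Rightarrow> ('k::comm_ring_1 \<Rightarrow> 'r::idom) \<Rightarrow> ((nat \<Rightarrow>\<^sub>0 int) \<Rightarrow> 'r set) \<Rightarrow> bool" where
  "rational_complexity_one d \<kappa> G \<longleftrightarrow>
      is_algebra_map \<kappa> \<and> finitely_generated_algebra \<kappa> \<and> integrally_closed TYPE('r) \<and>
      is_rational \<kappa> \<and> is_grading d \<kappa> G \<and> is_effective d G \<and> krull_dim TYPE('r) = enat (Suc d)"


definition is_valuation ::
  "nat \<Rightarrow> ('k::comm_ring_1 \<Rightarrow> 'r::comm_ring_1) \<Rightarrow> ('r \<Rightarrow> (nat \<Rightarrow>\<^sub>0 int)) \<Rightarrow> bool" where
  "is_valuation r \<kappa> v \<longleftrightarrow>
      (\<forall>f. f \<noteq> 0 \<longrightarrow> v f \<in> coords {..<r}) \<and>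
      (\<forall>c. c \<noteq> 0 \<longrightarrow> v (\<kappa> c) = 0) \<and>
      (\<forall>f g. f \<noteq> 0 \<longrightarrow> g \<noteq> 0 \<longrightarrow> v (f * g) = v f + v g) \<and>
      (\<forall>f g. f \<noteq> 0 \<longrightarrow> g \<noteq> 0 \<longrightarrow> f + g \<noteq> 0 \<longrightarrow> min (v f) (v g) \<le> v (f + g))"

definition value_semigroup :: "('r::zero \<Rightarrow> (nat \<Rightarrow>\<^sub>0 int)) \<Rightarrow> (nat \<Rightarrow>\<^sub>0 int) set" where
  "value_semigroup v = v ` (UNIV - {0})"

text \<open>The rank of a subgroup of \<open>\<int>\<^sup>r\<close> is the dimension of its rational span.\<close>

definition full_rank :: "('r::comm_ring_1 \<Rightarrow> (nat \<Rightarrow>\<^sub>0 int)) \<Rightarrow> bool" where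
  "full_rank v \<longleftrightarrow> enat (q_dim (rat_vec ` group_hull (value_semigroup v))) = krull_dim TYPE('r)"

definition is_khovanskii_basis :: "('r::zero \<Rightarrow> (nat \<Rightarrow>\<^sub>0 int)) \<Rightarrow> 'r set \<Rightarrow> bool" where
  "is_khovanskii_basis v B \<longleftrightarrow> monoid_hull (v ` (B - {0})) = value_semigroup v"

definition is_homogeneous_valuation ::
  "nat \<Rightarrow> ((nat \<Rightarrow>\<^sub>0 int) \<Rightarrow> 'r::comm_ring_1 set) \<Rightarrow> ('r \<Rightarrow> (nat \<Rightarrow>\<^sub>0 int)) \<Rightarrow> bool" where
  "is_homogeneous_valuation d G v \<longleftrightarrow> (\<forall>f c. f \<noteq> 0 \<longrightarrow> is_decomp d G f c \<longrightarrow>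
      v f = Min ((\<lambda>u. v (Poly_Mapping.lookup c u)) ` Poly_Mapping.keys c))"

definition extend_valuation :: "('r::idom \<Rightarrow> (nat \<Rightarrow>\<^sub>0 int)) \<Rightarrow> 'r fract \<Rightarrow> (nat \<Rightarrow>\<^sub>0 int)" where
  "extend_valuation v q = (THE a. \<exists>f g. f \<noteq> 0 \<and> g \<noteq> 0 \<and> q = Fract f g \<and> a = v f - v g)"


definition is_polyhedral_cone :: "nat \<Rightarrow> (nat \<Rightarrow>\<^sub>0 rat) set \<Rightarrow> bool" where
  "is_polyhedral_cone d \<sigma> \<longleftrightarrow> (\<exists>F. finite F \<and> F \<subseteq> coords {..<d} \<and>
      \<sigma> = {a \<in> coords {..<d}. \<forall>u\<in>F. 0 \<le> pairing a u})"

definition is_polyhedron :: "nat \<Rightarrow> (nat \<Rightarrow>\<^sub>0 rat) set \<Rightarrow> bool" where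
  "is_polyhedron d \<Delta> \<longleftrightarrow> (\<exists>F. finite F \<and> fst ` F \<subseteq> coords {..<d} \<and>
      \<Delta> = {a \<in> coords {..<d}. \<forall>(u, b)\<in>F. b \<le> pairing a u})"

definition tailcone :: "nat \<Rightarrow> (nat \<Rightarrow>\<^sub>0 rat) set \<Rightarrow> (nat \<Rightarrow>\<^sub>0 rat) set" where
  "tailcone d \<Delta> = {a \<in> coords {..<d}. (\<lambda>b. b + a) ` \<Delta> \<subseteq> \<Delta>}"

text \<open>Points of the projective line over \<open>'k\<close> have type \<open>'k option\<close>, where \<open>None\<close> is the point at
  infinity. The divisor is the sum of \<open>pd_coeff D i\<close> times \<open>pd_point D i\<close> for \<open>i \<le> pd_m D\<close>.\<close>

record 'k pdivisor =
  pd_m :: nat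
  pd_tail :: "(nat \<Rightarrow>\<^sub>0 rat) set"
  pd_coeff :: "nat \<Rightarrow> (nat \<Rightarrow>\<^sub>0 rat) set"
  pd_point :: "nat \<Rightarrow> 'k option"

definition is_pdivisor :: "nat \<Rightarrow> 'k pdivisor \<Rightarrow> bool" where
  "is_pdivisor d D \<longleftrightarrow>
      1 \<le> pd_m D \<and> inj_on (pd_point D) {..pd_m D} \<and>
      is_polyhedral_cone d (pd_tail D) \<and> pd_tail D \<inter> uminus ` pd_tail D = {0} \<and>
      (\<forall>i\<le>pd_m D. pd_coeff D i = {} \<or>
        is_polyhedron d (pd_coeff D i) \<and> tailcone d (pd_coeff D i) = pd_tail D) \<and>
      {\<Sum>i\<le>pd_m D. a i | a. \<forall>i\<le>pd_m D. a i \<in> pd_coeff D i} \<subset> pd_tail D"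

text \<open>\<open>'k poly fract\<close> is the function field of the projective line. At infinity the order of a
  polynomial is minus its degree.\<close>

definition ord_poly :: "'k::field option \<Rightarrow> 'k poly \<Rightarrow> int" where
  "ord_poly Q a = (case Q of Some c \<Rightarrow> int (Polynomial.order c a) | None \<Rightarrow> - int (degree a))"

definition ord_at :: "'k::field option \<Rightarrow> 'k poly fract \<Rightarrow> int" where
  "ord_at Q f = (THE n. \<exists>a b. a \<noteq> 0 \<and> b \<noteq> 0 \<and> f = Fract a b \<and> n = ord_poly Q a - ord_poly Q b)"

definition min_pairing :: "(nat \<Rightarrow>\<^sub>0 rat) set \<Rightarrow> (nat \<Rightarrow>\<^sub>0 int) \<Rightarrow> rat" where
  "min_pairing \<Delta> u = (LEAST q. q \<in> (\<lambda>a. pairing a u) ` \<Delta>)"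

definition dual_weights :: "nat \<Rightarrow> (nat \<Rightarrow>\<^sub>0 rat) set \<Rightarrow> (nat \<Rightarrow>\<^sub>0 int) set" where
  "dual_weights d \<sigma> = {u \<in> coords {..<d}. \<forall>a\<in>\<sigma>. 0 \<le> pairing a u}"

text \<open>Global sections of the sheaf of the divisor \<open>\<Sum>i. \<lfloor>\<Delta>\<^sub>i(u)\<rfloor> P\<^sub>i\<close>; an empty
  coefficient imposes no condition at its point.\<close>

definition sections :: "'k::field pdivisor \<Rightarrow> (nat \<Rightarrow>\<^sub>0 int) \<Rightarrow> 'k poly fract set" where
  "sections D u = {f. f = 0 \<or>
      (\<forall>i\<le>pd_m D. pd_coeff D i \<noteq> {} \<longrightarrow> 0 \<le> ord_at (pd_point D i) f + \<lfloor>min_pairing (pd_coeff D i) u\<rfloor>) \<and>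
      (\<forall>Q. Q \<notin> pd_point D ` {..pd_m D} \<longrightarrow> 0 \<le> ord_at Q f)}"

text \<open>The group algebra of the weight lattice over \<open>'k poly fract\<close>; \<open>single u f\<close> is \<open>f \<chi>\<^sup>u\<close>.\<close>

type_synonym 'k chi_alg = "(nat \<Rightarrow>\<^sub>0 int) \<Rightarrow>\<^sub>0 'k poly fract"

definition section_algebra :: "nat \<Rightarrow> 'k::field pdivisor \<Rightarrow> 'k chi_alg set" where
  "section_algebra d D = {F. \<forall>u\<in>Poly_Mapping.keys F.
      u \<in> dual_weights d (pd_tail D) \<and> Poly_Mapping.lookup F u \<in> sections D u}"

definition const_chi :: "'k::field \<Rightarrow> 'k chi_alg" where
  "const_chi c = Poly_Mapping.single 0 (to_fract [:c:])"

definition is_graded_iso ::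
  "nat \<Rightarrow> ('k::field \<Rightarrow> 'r::idom) \<Rightarrow> ((nat \<Rightarrow>\<^sub>0 int) \<Rightarrow> 'r set) \<Rightarrow> 'k pdivisor \<Rightarrow> ('r \<Rightarrow> 'k chi_alg) \<Rightarrow> bool" where
  "is_graded_iso d \<kappa> G D \<psi> \<longleftrightarrow>
      bij_betw \<psi> UNIV (section_algebra d D) \<and> is_algebra_map \<psi> \<and> (\<forall>c. \<psi> (\<kappa> c) = const_chi c) \<and>
      (\<forall>u\<in>coords {..<d}. \<forall>f. f \<in> G u \<longleftrightarrow> Poly_Mapping.keys (\<psi> f) \<subseteq> {u})"


text \<open>
  A linear embedding of the projective line as a line \<open>L\<close> in projective \<open>m\<close>-space is given by the
  pullbacks \<open>lf i\<close> of the homogeneous coordinates \<open>y\<^sub>i\<close>. A nonzero linear form \<open>a s + b t\<close>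
  on the projective line is dehomogenized to the polynomial \<open>[:a, b:]\<close>; it vanishes at infinity iff
  this polynomial is constant. The line \<open>L\<close>, its points \<open>Q\<^sub>i\<close> and its function field are
  identified with the projective line, the points \<open>pd_point D i\<close> and \<open>'k poly fract\<close>.
\<close>

definition is_linear_embedding :: "'k::field pdivisor \<Rightarrow> (nat \<Rightarrow> 'k poly) \<Rightarrow> bool" where
  "is_linear_embedding D lf \<longleftrightarrow> (\<forall>i\<le>pd_m D. lf i \<noteq> 0 \<and> degree (lf i) \<le> 1 \<and>
      (case pd_point D i of Some c \<Rightarrow> poly (lf i) c = 0 | None \<Rightarrow> degree (lf i) = 0))"

definition zmon :: "nat \<Rightarrow> (nat \<Rightarrow> 'k::field poly) \<Rightarrow> (nat \<Rightarrow>\<^sub>0 int) \<Rightarrow> 'k poly fract" where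
  "zmon m lf b = (\<Prod>j=1..m. Fract (lf j) (lf 0) powi Poly_Mapping.lookup b j)"

type_synonym lat = "(nat \<Rightarrow>\<^sub>0 int) \<times> (nat \<Rightarrow>\<^sub>0 int)"

definition chi_image :: "nat \<Rightarrow> (nat \<Rightarrow> 'k::field poly) \<Rightarrow> lat \<Rightarrow> 'k chi_alg" where
  "chi_image m lf h = Poly_Mapping.single (fst h) (zmon m lf (snd h))"

definition e_vec :: "nat \<Rightarrow> nat \<Rightarrow> (nat \<Rightarrow>\<^sub>0 'a::ring_1)" where
  "e_vec m i = (if i = 0 then - (\<Sum>j=1..m. Poly_Mapping.single j 1) else Poly_Mapping.single i 1)"

inductive_set q_cone ::
  "((nat \<Rightarrow>\<^sub>0 rat) \<times> (nat \<Rightarrow>\<^sub>0 rat)) set \<Rightarrow> ((nat \<Rightarrow>\<^sub>0 rat) \<times> (nat \<Rightarrow>\<^sub>0 rat)) set" for S where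
  zero: "(0, 0) \<in> q_cone S"
| add: "(a, b) \<in> S \<Longrightarrow> (x, y) \<in> q_cone S \<Longrightarrow> 0 \<le> c \<Longrightarrow> (pm_scale c a + x, pm_scale c b + y) \<in> q_cone S"

definition big_cone :: "'k pdivisor \<Rightarrow> ((nat \<Rightarrow>\<^sub>0 rat) \<times> (nat \<Rightarrow>\<^sub>0 rat)) set" where
  "big_cone D = q_cone (pd_tail D \<times> {0} \<union> (\<Union>i\<le>pd_m D. pd_coeff D i \<times> {e_vec (pd_m D) i}))"

definition pairing2 :: "('i \<Rightarrow>\<^sub>0 'a::ring_1) \<times> ('j \<Rightarrow>\<^sub>0 'a) \<Rightarrow> ('i \<Rightarrow>\<^sub>0 int) \<times> ('j \<Rightarrow>\<^sub>0 int) \<Rightarrow> 'a" where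
  "pairing2 a h = pairing (fst a) (fst h) + pairing (snd a) (snd h)"

definition dual_monoid :: "nat \<Rightarrow> 'k pdivisor \<Rightarrow> lat set" where
  "dual_monoid d D = {h \<in> coords {..<d} \<times> coords {1..pd_m D}. \<forall>a\<in>big_cone D. 0 \<le> pairing2 a h}"

definition is_semi_canonical ::
  "nat \<Rightarrow> ('k::field \<Rightarrow> 'r::idom) \<Rightarrow> ((nat \<Rightarrow>\<^sub>0 int) \<Rightarrow> 'r set) \<Rightarrow>
    'k pdivisor \<Rightarrow> ('r \<Rightarrow> 'k chi_alg) \<Rightarrow> (nat \<Rightarrow> 'k poly) \<Rightarrow> lat set \<Rightarrow> bool" where
  "is_semi_canonical d \<kappa> G D \<psi> lf H \<longleftrightarrow>
      is_pdivisor d D \<and> is_graded_iso d \<kappa> G D \<psi> \<and> is_linear_embedding D lf \<and>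
      finite H \<and> monoid_hull H = dual_monoid d D"

definition generating_set ::
  "'k::field pdivisor \<Rightarrow> ('r \<Rightarrow> 'k chi_alg) \<Rightarrow> (nat \<Rightarrow> 'k poly) \<Rightarrow> lat set \<Rightarrow> 'r set" where
  "generating_set D \<psi> lf H = {f. \<psi> f \<in> chi_image (pd_m D) lf ` H}"

definition presentation ::
  "'k::field pdivisor \<Rightarrow> (nat \<Rightarrow> 'k poly) \<Rightarrow> ((lat \<Rightarrow>\<^sub>0 nat) \<Rightarrow>\<^sub>0 'k) \<Rightarrow> 'k chi_alg" where
  "presentation D lf = mp_eval const_chi (chi_image (pd_m D) lf)"

definition J_ideal ::
  "'k::field pdivisor \<Rightarrow> (nat \<Rightarrow> 'k poly) \<Rightarrow> lat set \<Rightarrow> ((lat \<Rightarrow>\<^sub>0 nat) \<Rightarrow>\<^sub>0 'k) set" where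
  "J_ideal D lf H = {p \<in> poly_ring H. presentation D lf p = 0}"

text \<open>\<open>v\<close> is the weight quasivaluation of \<open>W\<close>, whose value at \<open>f\<close> is the maximum, over all
  preimages \<open>p\<close> of \<open>f\<close>, of the minimal \<open>W\<close>-weight of the terms of \<open>p\<close>. The set \<open>S\<close> of these
  minimal weights may be infinite; the existence of its maximum is part of the condition.\<close>

definition is_weight_valuation ::
  "'k::field pdivisor \<Rightarrow> ('r::idom \<Rightarrow> 'k chi_alg) \<Rightarrow> (nat \<Rightarrow> 'k poly) \<Rightarrow> lat set \<Rightarrow>
    (lat \<Rightarrow> (nat \<Rightarrow>\<^sub>0 rat)) \<Rightarrow> ('r \<Rightarrow> (nat \<Rightarrow>\<^sub>0 int)) \<Rightarrow> bool" where
  "is_weight_valuation D \<psi> lf H W v \<longleftrightarrow> (\<forall>f. f \<noteq> 0 \<longrightarrow>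
      (let S = min_weight (mat_weight W) ` {p \<in> poly_ring H. presentation D lf p = \<psi> f}
       in rat_vec (v f) \<in> S \<and> (\<forall>a\<in>S. a \<le> rat_vec (v f))))"

definition trop_map ::
  "lat set \<Rightarrow> (nat \<Rightarrow>\<^sub>0 real) \<times> (nat \<Rightarrow>\<^sub>0 real) \<Rightarrow> (lat \<Rightarrow>\<^sub>0 real)" where
  "trop_map H a = (\<Sum>h\<in>H. Poly_Mapping.single h (pairing2 a h))"

definition trop_facet :: "nat \<Rightarrow> nat \<Rightarrow> lat set \<Rightarrow> nat \<Rightarrow> (lat \<Rightarrow>\<^sub>0 real) set" where
  "trop_facet d m H i = trop_map H ` (coords {..<d} \<times> {pm_scale t (e_vec m i) | t. 0 \<le> t})"

text \<open>A rational function \<open>g\<close> on \<open>L\<close>, as an element of the fraction field of \<open>'r\<close>, is a quotient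
  of two elements whose images under \<open>\<psi>\<close> differ by the factor \<open>g\<close>.\<close>

definition line_field_embed :: "('r::idom \<Rightarrow> 'k::field chi_alg) \<Rightarrow> 'k poly fract \<Rightarrow> 'r fract" where
  "line_field_embed \<psi> g =
      (THE q. \<exists>f1 f2. f2 \<noteq> 0 \<and> q = Fract f1 f2 \<and> \<psi> f1 = Poly_Mapping.single 0 g * \<psi> f2)"

end

theory Submission
  imports Defs
begin

text \<open>
  The idea is to describe \<open>v\<close> on homogeneous elements \<open>g \<chi>\<^sup>u\<close>, where \<open>g\<close> is a rational
  function on the line and \<open>u\<close> a weight. Each \<open>g \<chi>\<^sup>u\<close> is a quotient of two homogeneous elements
  of the coordinate ring (\<open>is_quotient_exists\<close>): the weights occurring generate the lattice because the
  action is effective, and there are enough sections because divisors of arbitrarily large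
  degree occur (\<open>divisor_of_large_degree\<close>), which is Farkas' lemma applied to the
  coefficients of the polyhedral divisor. So \<open>v\<close> has a value \<open>hval u g\<close> there, additive in both
  arguments. As the ground field is algebraically closed, on the functions of the line it is
  \<open>ord\<^sub>Q \<cdot> \<gamma>\<close> with \<open>\<gamma> \<ge> 0\<close> (\<open>hval_function_field\<close>). Hence
  \<open>hval u g = ord\<^sub>Q(g) \<gamma> + L(u)\<close> with \<open>L\<close> linear, and every value of a homogeneous
  element lies in the span of the \<open>d + 1\<close> vectors \<open>\<gamma>\<close>, \<open>L(e\<^sub>i)\<close>.

  Let \<open>v\<close> be homogeneous. After adding \<open>Q\<close> with trivial coefficient, \<open>Q\<close> is one of the points
  \<open>P\<^sub>i\<close>. A section expands into monomials in the \<open>y\<^sub>j / y\<^sub>0\<close> whose orders at \<open>P\<^sub>i\<close>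
  increase from that of the section (\<open>section_expansion\<close>). So each homogeneous element has the value
  of one monomial and is a combination of monomials of no smaller value. Consequently the values of
  the generators generate the value semigroup, and taking them as the columns of \<open>W\<close> gives
  \<open>v = v\<^sub>W\<close>. A monomial in the initial ideal would be the initial form of one relation
  (\<open>monomial_in_initial_ideal\<close>), where it could not be cancelled by the terms of larger value. Finite
  generation of the lattice points of the dual cone is Gordan's lemma.

  Conversely, let the generators form a Khovanskii basis. Since they are homogeneous, the value group
  lies in the span of \<open>\<gamma>\<close> and the \<open>L(e\<^sub>i)\<close>, which full rank makes linearly independent. So the
  homogeneous components of an element have distinct values, and the least of these is the value
  (\<open>khovanskii_homogeneous\<close>). If instead \<open>v = v\<^sub>W\<close> with \<open>W\<close> tropical, the columns of
  \<open>W\<close> are the values of the generators (\<open>tropical_weights_are_values\<close>), and since the presentation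
  is graded, a polynomial attaining the value of \<open>f\<close> splits into polynomials for the components of
  \<open>f\<close> (\<open>weight_valuation_homogeneous\<close>).

  In that last situation the rank of \<open>W\<close> excludes \<open>\<gamma> = 0\<close> and points \<open>Q\<close> outside the \<open>P\<^sub>i\<close>,
  for which the columns would lie in the span of the \<open>L(e\<^sub>i)\<close>. The ideal \<open>J\<close> is homogeneous for
  the weight lattice, and among exponents of a common weight \<open>u\<close> both \<open>W\<close> and an interior point of
  the facet \<open>C\<^sub>i\<close> are increasing functions of the order at \<open>P\<^sub>i\<close>. So they define the same
  initial ideal (\<open>initial_ideal_eq\<close>).
\<close>

abbreviation (input) "lookup \<equiv> Poly_Mapping.lookup"
abbreviation (input) "keys \<equiv> Poly_Mapping.keys"
abbreviation (input) "single \<equiv> Poly_Mapping.single"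

section \<open>Vectors and pairings\<close>

lemma coords_iff: "a \<in> coords I \<longleftrightarrow> (\<forall>i. i \<notin> I \<longrightarrow> lookup a i = 0)"
  by (auto simp: coords_def in_keys_iff)

lemma coords_0 [simp]: "0 \<in> coords I"
  by (simp add: coords_iff)

lemma coords_add: "a \<in> coords I \<Longrightarrow> b \<in> coords I \<Longrightarrow> a + b \<in> coords I"
  for a b :: "'i \<Rightarrow>\<^sub>0 'a::monoid_add"
  by (simp add: coords_iff lookup_add)

lemma coords_uminus: "a \<in> coords I \<Longrightarrow> - a \<in> coords I"
  for a :: "'i \<Rightarrow>\<^sub>0 'a::ab_group_add"
  by (simp add: coords_iff)

lemma coords_diff: "a \<in> coords I \<Longrightarrow> b \<in> coords I \<Longrightarrow> a - b \<in> coords I"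
  for a :: "'i \<Rightarrow>\<^sub>0 'a::ab_group_add"
  by (simp add: coords_iff lookup_minus)

lemma coords_sum: "(\<And>x. x \<in> A \<Longrightarrow> f x \<in> coords I) \<Longrightarrow> sum f A \<in> coords I"
  for f :: "'x \<Rightarrow> 'i \<Rightarrow>\<^sub>0 'a::comm_monoid_add"
  by (induction A rule: infinite_finite_induct) (auto intro: coords_add)

lemma coords_single: "i \<in> I \<Longrightarrow> single i c \<in> coords I"
  by (auto simp: coords_iff lookup_single when_def)

lemma coords_pm_scale: "a \<in> coords I \<Longrightarrow> pm_scale c a \<in> coords I"
  by (simp add: coords_iff lookup_pm_scale)

lemma coords_rat_vec [simp]: "rat_vec a \<in> coords I \<longleftrightarrow> a \<in> coords I"
  by (simp add: coords_iff lookup_rat_vec)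

lemma rat_vec_0 [simp]: "rat_vec 0 = 0"
  and rat_vec_add: "rat_vec (a + b) = rat_vec a + rat_vec b"
  and rat_vec_diff: "rat_vec (a - b) = rat_vec a - rat_vec b"
  and rat_vec_uminus: "rat_vec (- a) = - rat_vec a"
  and rat_vec_pm_scale: "rat_vec (pm_scale n a) = pm_scale (of_int n) (rat_vec a)"
  by (auto intro!: poly_mapping_eqI simp: lookup_rat_vec lookup_add lookup_minus lookup_pm_scale)

lemma rat_vec_sum: "rat_vec (sum f A) = (\<Sum>x\<in>A. rat_vec (f x))"
  by (induction A rule: infinite_finite_induct) (auto simp: rat_vec_add)

lemma rat_vec_inject [simp]: "rat_vec a = rat_vec b \<longleftrightarrow> a = b"
proof
  assume h: "rat_vec a = rat_vec b"
  show "a = b"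
  proof (rule poly_mapping_eqI)
    fix i
    show "lookup a i = lookup b i"
      using arg_cong[OF h, of "\<lambda>x. lookup x i"] by (simp add: lookup_rat_vec)
  qed
qed simp

lemma rat_vec_less [simp]: "rat_vec a < rat_vec b \<longleftrightarrow> a < b"
  for a b :: "'i::linorder \<Rightarrow>\<^sub>0 int"
  by (simp add: less_poly_mapping.rep_eq less_fun_def lookup_rat_vec)

lemma rat_vec_le [simp]: "rat_vec a \<le> rat_vec b \<longleftrightarrow> a \<le> b"
  for a b :: "'i::linorder \<Rightarrow>\<^sub>0 int"
  by (simp add: le_less)

lemma pm_scale_simps [simp]:
  fixes a b :: "'i \<Rightarrow>\<^sub>0 'a::ring_1"
  shows "pm_scale 0 a = 0" "pm_scale 1 a = a" "pm_scale c 0 = 0" "pm_scale (-1) a = - a"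
  by (auto intro!: poly_mapping_eqI simp: lookup_pm_scale)

lemma pm_scale_add_right: "pm_scale c (a + b) = pm_scale c a + pm_scale c b"
  and pm_scale_add_left: "pm_scale (c + e) a = pm_scale c a + pm_scale e a"
  and pm_scale_pm_scale: "pm_scale c (pm_scale e a) = pm_scale (c * e) a"
  and pm_scale_diff_left: "pm_scale (c - e) a = pm_scale c a - pm_scale e a"
  and pm_scale_uminus_left: "pm_scale (- c) a = - pm_scale c a"
  for a b :: "'i \<Rightarrow>\<^sub>0 'a::ring_1"
  by (auto intro!: poly_mapping_eqI simp: lookup_pm_scale lookup_add lookup_minus algebra_simps)

lemma pm_scale_sum: "pm_scale c (sum f A) = (\<Sum>x\<in>A. pm_scale c (f x))"
  for f :: "'x \<Rightarrow> 'i \<Rightarrow>\<^sub>0 'a::ring_1"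
  by (induction A rule: infinite_finite_induct) (auto simp: pm_scale_add_right)

lemma pairing_eq_sum:
  assumes "finite I" "a \<in> coords I"
  shows "pairing a u = (\<Sum>i\<in>I. lookup a i * of_int (lookup u i))"
  unfolding pairing_def
  by (rule sum.mono_neutral_left) (use assms in \<open>auto simp: coords_def in_keys_iff\<close>)

lemma pairing_add_left: "pairing (a + b) u = pairing a u + pairing b u"
proof -
  let ?I = "keys a \<union> keys b"
  have "a \<in> coords ?I" "b \<in> coords ?I" "a + b \<in> coords ?I"
    by (auto simp: coords_def intro!: keys_add)
  then show ?thesis
    by (simp add: pairing_eq_sum[of ?I] lookup_add algebra_simps sum.distrib)
qed

lemma pairing_0_left [simp]: "pairing 0 u = 0"
  and pairing_0_right [simp]: "pairing a 0 = 0"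
  by (simp_all add: pairing_def)

lemma pairing_pm_scale_left: "pairing (pm_scale c a) u = c * pairing a u"
proof -
  have "pm_scale c a \<in> coords (keys a)"
    by (rule coords_pm_scale) (simp add: coords_def)
  then have "pairing (pm_scale c a) u = (\<Sum>i\<in>keys a.
      lookup (pm_scale c a) i * of_int (lookup u i))"
    by (simp add: pairing_eq_sum)
  then show ?thesis
    by (simp add: pairing_def lookup_pm_scale sum_distrib_left mult.assoc)
qed

lemma pairing_uminus_left: "pairing (- a) u = - pairing a u"
  using pairing_pm_scale_left[of "-1" a u] by simp

lemma pairing_add_right: "pairing a (u + v) = pairing a u + pairing a v"
  by (simp add: pairing_def lookup_add algebra_simps sum.distrib)

lemma pairing_pm_scale_right: "pairing a (pm_scale n u) = of_int n * pairing a u"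
proof -
  have "a * of_int (n * b) = of_int n * (a * of_int b)" for a :: 'a and b
    by (metis mult.assoc mult_of_int_commute of_int_mult)
  then show ?thesis
    by (simp only: pairing_def lookup_pm_scale sum_distrib_left)
qed

lemma pairing_sum_left: "pairing (sum f A) u = (\<Sum>x\<in>A. pairing (f x) u)"
  by (induction A rule: infinite_finite_induct) (auto simp: pairing_add_left)

lemma pairing_single: "pairing (single i c) u = c * of_int (lookup u i)"
  by (simp add: pairing_def)

lemma pairing2_add_right: "pairing2 a (h + k) = pairing2 a h + pairing2 a k"
  by (simp add: pairing2_def pairing_add_right)

lemma pairing2_0_right [simp]: "pairing2 a 0 = 0"
  by (simp add: pairing2_def)

text \<open>Separation produces rational functionals, which the pairing with the character lattice does
  not contain.\<close>

definition dot :: "('i \<Rightarrow>\<^sub>0 rat) \<Rightarrow> ('i \<Rightarrow>\<^sub>0 rat) \<Rightarrow> rat" where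
  "dot a b = (\<Sum>i\<in>keys a. lookup a i * lookup b i)"

lemma dot_eq_sum:
  assumes "finite I" "keys a \<subseteq> I"
  shows "dot a b = (\<Sum>i\<in>I. lookup a i * lookup b i)"
  unfolding dot_def
  by (rule sum.mono_neutral_left) (use assms in \<open>auto simp: in_keys_iff\<close>)

lemma dot_commute: "dot a b = dot b a"
  using dot_eq_sum[of "keys a \<union> keys b" a b]
    dot_eq_sum[of "keys a \<union> keys b" b a]
  by (simp add: mult.commute)

lemma dot_add_right: "dot a (b + c) = dot a b + dot a c"
  by (simp add: dot_def lookup_add algebra_simps sum.distrib)

lemma dot_pm_scale_right: "dot a (pm_scale c b) = c * dot a b"
  by (simp add: dot_def lookup_pm_scale sum_distrib_left mult.left_commute)

lemma dot_add_left: "dot (b + c) a = dot b a + dot c a"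
  by (metis dot_add_right dot_commute)

lemma dot_pm_scale_left: "dot (pm_scale c b) a = c * dot b a"
  by (metis dot_pm_scale_right dot_commute)

lemma dot_0 [simp]: "dot 0 a = 0" "dot a 0 = 0"
  by (simp_all add: dot_def)

lemma dot_single: "dot (single i c) b = c * lookup b i"
  by (simp add: dot_def)

lemma dot_rat_vec: "dot a (rat_vec u) = pairing a u"
  by (simp add: dot_def pairing_def lookup_rat_vec)

lemma dot_self_nonneg: "0 \<le> dot a a"
  by (simp add: dot_def sum_nonneg)

lemma dot_self_pos: "a \<noteq> 0 \<Longrightarrow> 0 < dot a a"
  unfolding dot_def
  by (rule sum_pos) (auto simp: in_keys_iff zero_less_mult_iff)

lemma integral_multiple:
  fixes a :: "'i \<Rightarrow>\<^sub>0 rat"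
  obtains n :: int and u where "n > 0" "rat_vec u = pm_scale (of_int n) a"
    "keys u \<subseteq> keys a"
proof -
  let ?q = "\<lambda>i. snd (quotient_of (lookup a i))"
  define n where "n = (\<Prod>i\<in>keys a. ?q i)"
  have pos: "?q i > 0" for i
    by (rule quotient_of_denom_pos')
  have n: "n > 0"
    unfolding n_def by (rule prod_pos) (simp add: pos)
  have int: "of_int \<lfloor>of_int n * lookup a i\<rfloor> = of_int n * lookup a i" for i
  proof (cases "i \<in> keys a")
    case True
    then have "n = ?q i * (\<Prod>j\<in>keys a - {i}. ?q j)"
      unfolding n_def by (simp add: prod.remove)
    moreover have "lookup a i = of_int (fst (quotient_of (lookup a i))) / of_int (?q i)"
      by (metis prod.collapse quotient_of_div)
    ultimately have "of_int n * lookup a i =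
        of_int ((\<Prod>j\<in>keys a - {i}. ?q j) * fst (quotient_of (lookup a i)))"
      using pos[of i] by (simp add: field_simps)
    then show ?thesis
      by (metis floor_of_int)
  next
    case False
    then show ?thesis
      by (simp add: in_keys_iff)
  qed
  define u where "u = Poly_Mapping.map (\<lambda>x. \<lfloor>of_int n * x\<rfloor>) a"
  have lu: "lookup u i = \<lfloor>of_int n * lookup a i\<rfloor>" for i
    by (simp add: u_def Poly_Mapping.map.rep_eq when_def)
  have "rat_vec u = pm_scale (of_int n) a"
    by (rule poly_mapping_eqI) (simp add: lookup_rat_vec lookup_pm_scale lu int)
  moreover have "keys u \<subseteq> keys a"
    by (auto simp: in_keys_iff lu)
  ultimately show ?thesis
    using that n by blast
qed

section \<open>Rational polyhedral cones\<close>

type_synonym qvec2 = "(nat \<Rightarrow>\<^sub>0 rat) \<times> (nat \<Rightarrow>\<^sub>0 rat)"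

definition scale2 :: "rat \<Rightarrow> qvec2 \<Rightarrow> qvec2" where
  "scale2 c x = (pm_scale c (fst x), pm_scale c (snd x))"

definition dot2 :: "qvec2 \<Rightarrow> qvec2 \<Rightarrow> rat" where
  "dot2 x y = dot (fst x) (fst y) + dot (snd x) (snd y)"

lemma scale2_add_right: "scale2 c (x + y) = scale2 c x + scale2 c y"
  and scale2_add_left: "scale2 (c + e) x = scale2 c x + scale2 e x"
  and scale2_scale2: "scale2 c (scale2 e x) = scale2 (c * e) x"
  and scale2_0 [simp]: "scale2 0 x = 0" "scale2 c 0 = 0"
  and scale2_1 [simp]: "scale2 1 x = x"
  by (simp_all add: scale2_def pm_scale_add_right pm_scale_add_left pm_scale_pm_scale zero_prod_def)

lemma dot2_add_left: "dot2 (x + y) z = dot2 x z + dot2 y z"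
  and dot2_add_right: "dot2 z (x + y) = dot2 z x + dot2 z y"
  and dot2_scale_left: "dot2 (scale2 c x) z = c * dot2 x z"
  and dot2_scale_right: "dot2 z (scale2 c x) = c * dot2 z x"
  and dot2_0 [simp]: "dot2 0 z = 0" "dot2 z 0 = 0"
  by (simp_all add: dot2_def scale2_def dot_add_left dot_add_right dot_pm_scale_left
      dot_pm_scale_right algebra_simps)

lemma dot2_commute: "dot2 x y = dot2 y x"
  by (simp add: dot2_def dot_commute)

lemma dot2_self_pos: "x \<noteq> 0 \<Longrightarrow> 0 < dot2 x x"
  unfolding dot2_def
  by (cases "fst x = 0") (auto simp: prod_eq_iff intro: add_nonneg_pos add_pos_nonneg dot_self_pos dot_self_nonneg)

lemma q_cone_zero: "0 \<in> q_cone S"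
  by (simp add: zero_prod_def q_cone.zero)

lemma q_cone_add_scaled: "s \<in> S \<Longrightarrow> x \<in> q_cone S \<Longrightarrow> 0 \<le> c \<Longrightarrow> scale2 c s + x \<in> q_cone S"
  using q_cone.add[of "fst s" "snd s" S "fst x" "snd x" c] by (simp add: scale2_def plus_prod_def)

lemma q_cone_induct_vec [consumes 1, case_names zero add]:
  assumes "x \<in> q_cone S" "P 0"
    and "\<And>s x c. s \<in> S \<Longrightarrow> x \<in> q_cone S \<Longrightarrow> 0 \<le> c \<Longrightarrow> P x \<Longrightarrow> P (scale2 c s + x)"
  shows "P x"
proof -
  have "P (a, b)" if "(a, b) \<in> q_cone S" for a b
    using that
  proof (induction rule: q_cone.induct)
    case zero
    then show ?case using assms(2) by (simp add: zero_prod_def)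
  next
    case (add a b x y c)
    then show ?case using assms(3)[of "(a, b)" "(x, y)" c] by (simp add: scale2_def plus_prod_def)
  qed
  from this[of "fst x" "snd x"] assms(1) show ?thesis by simp
qed

lemma q_cone_add: "x \<in> q_cone S \<Longrightarrow> y \<in> q_cone S \<Longrightarrow> x + y \<in> q_cone S"
  by (induction rule: q_cone_induct_vec) (auto simp: add.assoc intro: q_cone_add_scaled)

lemma q_cone_scale: "x \<in> q_cone S \<Longrightarrow> 0 \<le> c \<Longrightarrow> scale2 c x \<in> q_cone S"
  by (induction rule: q_cone_induct_vec)
    (auto simp: scale2_add_right scale2_scale2 q_cone_zero intro: q_cone_add_scaled)

lemma q_cone_incl: "s \<in> S \<Longrightarrow> s \<in> q_cone S"
  using q_cone_add_scaled[of s S 0 1] by (simp add: q_cone_zero)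

lemma q_cone_subset: "S \<subseteq> q_cone T \<Longrightarrow> x \<in> q_cone S \<Longrightarrow> x \<in> q_cone T"
  by (rotate_tac, induction rule: q_cone_induct_vec) (auto simp: q_cone_zero intro!: q_cone_add q_cone_scale)

lemma q_cone_dot2_nonneg: "x \<in> q_cone S \<Longrightarrow> (\<And>s. s \<in> S \<Longrightarrow> 0 \<le> dot2 s y) \<Longrightarrow> 0 \<le> dot2 x y"
  by (induction rule: q_cone_induct_vec) (auto simp: dot2_add_left dot2_scale_left)

lemma q_cone_finite_sum:
  assumes "finite R" "x \<in> q_cone R"
  obtains l where "\<And>r. 0 \<le> l r" "x = (\<Sum>r\<in>R. scale2 (l r) r)"
proof -
  have "\<exists>l. (\<forall>r. 0 \<le> l r) \<and> x = (\<Sum>r\<in>R. scale2 (l r) r)"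
    using assms(2)
  proof (induction rule: q_cone_induct_vec)
    case zero
    show ?case by (rule exI[of _ "\<lambda>_. 0"]) simp
  next
    case (add s x c)
    then obtain l where l: "\<forall>r. 0 \<le> l r" "x = (\<Sum>r\<in>R. scale2 (l r) r)" by blast
    have "(\<Sum>r\<in>R. scale2 ((l(s := l s + c)) r) r) = (\<Sum>r\<in>R. scale2 (l r) r + (if r = s then scale2 c s else 0))"
      by (rule sum.cong) (auto simp: scale2_add_left)
    also have "\<dots> = x + scale2 c s"
      using add.hyps assms(1) l(2) by (simp add: sum.distrib)
    finally show ?case
      using add.hyps l(1) by (intro exI[of _ "l(s := l s + c)"]) (auto simp: add.commute)
  qed
  then show ?thesis using that by blast
qed

text \<open>Farkas' lemma, by Bartl's induction on the number of generators. If the last generator \<open>a\<close> is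
  needed, there is a vector on which the other generators are nonnegative and \<open>x\<close> is negative, and
  \<open>a\<close> must be negative there. This vector serves to project the problem onto the kernel of \<open>a\<close>,
  where one generator less is left.\<close>

lemma cone_separation_aux:
  assumes "finite G" "card G \<le> n" "\<And>y. (\<And>g. g \<in> G \<Longrightarrow> 0 \<le> dot2 g y) \<Longrightarrow> 0 \<le> dot2 x y"
  shows "x \<in> q_cone G"
  using assms
proof (induction n arbitrary: G x)
  case 0
  then have "G = {}" by simp
  have "x = 0"
  proof (rule ccontr)
    assume "x \<noteq> 0"
    moreover have "0 \<le> dot2 x (scale2 (-1) x)"
      by (rule 0) (simp add: \<open>G = {}\<close>)
    ultimately show False
      using dot2_self_pos[of x] by (simp add: dot2_scale_right)
  qed
  then show ?case by (simp add: q_cone_zero)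
next
  case (Suc n)
  show ?case
  proof (cases "G = {}")
    case True
    then show ?thesis using Suc by (intro Suc.IH) auto
  next
    case False
    then obtain a G' where G: "G = insert a G'" "a \<notin> G'"
      by (metis ex_in_conv mk_disjoint_insert)
    have fin: "finite G'" and card: "card G' \<le> n"
      using Suc.prems G by auto
    show ?thesis
    proof (cases "\<forall>y. (\<forall>g\<in>G'. 0 \<le> dot2 g y) \<longrightarrow> 0 \<le> dot2 x y")
      case True
      then have "x \<in> q_cone G'"
        using Suc.IH[OF fin card] by blast
      then show ?thesis
        by (rule q_cone_subset[rotated]) (auto simp: G intro: q_cone_incl)
    next
      case False
      then obtain y0 where y0: "\<And>g. g \<in> G' \<Longrightarrow> 0 \<le> dot2 g y0" "dot2 x y0 < 0"
        by force
      have "dot2 a y0 < 0"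
      proof (rule ccontr)
        assume "\<not> dot2 a y0 < 0"
        with y0 have "0 \<le> dot2 x y0"
          by (intro Suc.prems(3)) (auto simp: G)
        with y0 show False by simp
      qed
      \<comment> \<open>Normalized so that \<open>a\<close> takes the value \<open>-1\<close> at \<open>z\<close>; adding a multiple of \<open>z\<close> then
        projects onto the kernel of \<open>a\<close>.\<close>
      define z where "z = scale2 (- 1 / dot2 a y0) y0"
      have az: "dot2 a z = -1"
        using \<open>dot2 a y0 < 0\<close> by (simp add: z_def dot2_scale_right)
      have gz: "0 \<le> dot2 g z" if "g \<in> G'" for g
        using y0(1)[OF that] \<open>dot2 a y0 < 0\<close>
        by (simp add: z_def dot2_scale_right divide_nonneg_neg)
      have xz: "dot2 x z < 0"
        using y0(2) \<open>dot2 a y0 < 0\<close>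
        by (simp add: z_def dot2_scale_right divide_less_0_iff zero_less_divide_iff)
      define \<beta> where "\<beta> = (\<lambda>g. g + scale2 (dot2 g z) a)"
      have dot_\<beta>: "dot2 (\<beta> g) y = dot2 g (y + scale2 (dot2 a y) z)" for g y
        by (simp add: \<beta>_def dot2_add_left dot2_add_right dot2_scale_left dot2_scale_right)
      have "\<beta> x \<in> q_cone (\<beta> ` G')"
      proof (rule Suc.IH)
        show "finite (\<beta> ` G')" "card (\<beta> ` G') \<le> n"
          using fin card card_image_le[OF fin, of \<beta>] by auto
        fix y assume y: "\<And>g. g \<in> \<beta> ` G' \<Longrightarrow> 0 \<le> dot2 g y"
        show "0 \<le> dot2 (\<beta> x) y"
          unfolding dot_\<beta>
        proof (rule Suc.prems(3))
          fix g assume "g \<in> G"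
          then consider "g = a" | "g \<in> G'" by (auto simp: G)
          then show "0 \<le> dot2 g (y + scale2 (dot2 a y) z)"
          proof cases
            case 1
            then show ?thesis by (simp add: dot2_add_right dot2_scale_right az)
          next
            case 2
            then show ?thesis using y[of "\<beta> g"] by (simp add: dot_\<beta>)
          qed
        qed
      qed
      moreover have "\<exists>w\<in>q_cone G'. y = \<beta> w" if "y \<in> q_cone (\<beta> ` G')" for y
        using that
      proof (induction rule: q_cone_induct_vec)
        case zero
        show ?case by (rule bexI[of _ 0]) (simp_all add: \<beta>_def q_cone_zero)
      next
        case (add s y c)
        then obtain w g where w: "w \<in> q_cone G'" "y = \<beta> w" "g \<in> G'" "s = \<beta> g" by blast
        then show ?case using add.hyps
          by (intro bexI[of _ "scale2 c g + w"] q_cone_add_scaled)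
            (auto simp: \<beta>_def scale2_add_left scale2_add_right scale2_scale2 dot2_add_left dot2_scale_left algebra_simps)
      qed
      ultimately obtain w where w: "w \<in> q_cone G'" "\<beta> x = \<beta> w" by blast
      have "0 \<le> dot2 w z"
        using w(1) gz by (rule q_cone_dot2_nonneg)
      have "x = \<beta> w - scale2 (dot2 x z) a"
        using w(2) by (metis \<beta>_def add_diff_cancel)
      also have "\<dots> = scale2 (dot2 w z - dot2 x z) a + w"
        using scale2_add_left[of "dot2 w z - dot2 x z" "dot2 x z" a] by (simp add: \<beta>_def algebra_simps)
      also have "\<dots> \<in> q_cone G"
        using \<open>0 \<le> dot2 w z\<close> xz w(1)
        by (intro q_cone_add_scaled q_cone_subset[of G' G]) (auto simp: G intro: q_cone_incl)
      finally show ?thesis .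
    qed
  qed
qed

lemma cone_separation:
  assumes "finite G" "x \<notin> q_cone G"
  obtains y where "\<And>g. g \<in> G \<Longrightarrow> 0 \<le> dot2 g y" "dot2 x y < 0"
  using cone_separation_aux[OF assms(1) order.refl, of x] assms(2) by (meson not_le)

text \<open>One step of the double description method. In a combination that lies in the half space, the
  excess of the generators on the right side suffices to move every generator on the wrong side to
  the boundary hyperplane.\<close>

lemma finite_cone_Int_halfspace:
  assumes "finite R"
  obtains R' where "finite R'" "q_cone R' = {x \<in> q_cone R. 0 \<le> dot2 g x}"
proof -
  define R' where "R' = {r \<in> R. 0 \<le> dot2 g r} \<union>
    (\<lambda>(r, s). scale2 (- dot2 g s) r + scale2 (dot2 g r) s) ` ({r \<in> R. 0 \<le> dot2 g r} \<times> {s \<in> R. dot2 g s < 0})"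
  have fin: "finite R'"
    using assms by (auto simp: R'_def)
  have R'_in: "r \<in> q_cone R \<and> 0 \<le> dot2 g r" if "r \<in> R'" for r
    using that
    by (auto simp: R'_def dot2_add_right dot2_scale_right intro!: q_cone_add q_cone_scale intro: q_cone_incl)
  have sub: "x \<in> q_cone R \<and> 0 \<le> dot2 g x" if "x \<in> q_cone R'" for x
    using that
    by (induction rule: q_cone_induct_vec)
      (use R'_in in \<open>auto simp: q_cone_zero dot2_add_right dot2_scale_right intro!: q_cone_add q_cone_scale\<close>)
  \<comment> \<open>A multiple of \<open>s\<close> on the wrong side is shared out among the generators of \<open>p\<close> in proportion to
    their heights over the hyperplane.\<close>
  have step: "p + scale2 (t * dot2 g p) s \<in> q_cone R'"
    if p: "p \<in> q_cone R'" and s: "s \<in> R" "dot2 g s < 0" and t: "0 \<le> t" "0 \<le> 1 + t * dot2 g s" for p s t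
    using p
  proof (induction rule: q_cone_induct_vec)
    case zero
    then show ?case by (simp add: q_cone_zero)
  next
    case (add r p c)
    have "r + scale2 (t * dot2 g r) s \<in> q_cone R'"
    proof (cases "dot2 g r = 0")
      case True
      then show ?thesis using add.hyps by (simp add: q_cone_incl)
    next
      case False
      then have r: "r \<in> R" "0 \<le> dot2 g r"
        using add.hyps by (auto simp: R'_def dot2_add_right dot2_scale_right)
      have mem: "scale2 (- dot2 g s) r + scale2 (dot2 g r) s \<in> R'"
        using r s by (auto simp: R'_def)
      have "scale2 (1 + t * dot2 g s) r + scale2 t (scale2 (- dot2 g s) r + scale2 (dot2 g r) s) =
          scale2 (1 + t * dot2 g s + t * - dot2 g s) r + scale2 (t * dot2 g r) s"
        by (simp only: scale2_add_left scale2_add_right scale2_scale2 add.assoc)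
      also have "\<dots> = r + scale2 (t * dot2 g r) s"
        by simp
      finally have "r + scale2 (t * dot2 g r) s =
          scale2 (1 + t * dot2 g s) r + scale2 t (scale2 (- dot2 g s) r + scale2 (dot2 g r) s)" ..
      also have "\<dots> \<in> q_cone R'"
        using add.hyps t by (intro q_cone_add q_cone_scale q_cone_incl[OF mem]) (auto intro: q_cone_incl)
      finally show ?thesis .
    qed
    then have "scale2 c (r + scale2 (t * dot2 g r) s) + (p + scale2 (t * dot2 g p) s) \<in> q_cone R'"
      using add by (blast intro: q_cone_add q_cone_scale)
    then show ?case
      by (simp add: dot2_add_right dot2_scale_right scale2_add_left scale2_add_right scale2_scale2 algebra_simps)
  qed
  have add_neg: "p + scale2 c s \<in> q_cone R'"
    if p: "p \<in> q_cone R'" and s: "s \<in> R" "dot2 g s < 0" and c: "0 \<le> c" "0 \<le> dot2 g (p + scale2 c s)" for p s c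
  proof (cases "c = 0")
    case True
    then show ?thesis using p by simp
  next
    case False
    have ge: "- (c * dot2 g s) \<le> dot2 g p"
      using c by (simp add: dot2_add_right dot2_scale_right)
    moreover have "c * dot2 g s < 0"
      using False c s by (simp add: mult_pos_neg)
    ultimately have pos: "0 < dot2 g p" by simp
    then have "1 + c / dot2 g p * dot2 g s \<ge> 0"
      using ge by (simp add: field_simps)
    then have "p + scale2 (c / dot2 g p * dot2 g p) s \<in> q_cone R'"
      using p s c pos by (intro step) auto
    then show ?thesis using pos by simp
  qed
  have neg: "p + n \<in> q_cone R'"
    if "n \<in> q_cone {s \<in> R. dot2 g s < 0}" "p \<in> q_cone R'" "0 \<le> dot2 g (p + n)" for p n
    using that
  proof (induction arbitrary: p rule: q_cone_induct_vec)
    case zero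
    then show ?case by simp
  next
    case (add s n c)
    have "0 \<le> dot2 n (scale2 (-1) g)"
      using add.hyps(2) by (rule q_cone_dot2_nonneg) (auto simp: dot2_scale_right dot2_commute)
    then have "dot2 n g \<le> 0"
      by (simp add: dot2_scale_right)
    then have "dot2 g n \<le> 0"
      by (simp only: dot2_commute)
    with add.prems(2) have "0 \<le> dot2 g (p + scale2 c s)"
      by (simp add: dot2_add_right)
    then have "p + scale2 c s \<in> q_cone R'"
      using add by (intro add_neg) auto
    then have "(p + scale2 c s) + n \<in> q_cone R'"
      using add.prems by (intro add.IH) (auto simp: add.assoc)
    then show ?case by (simp add: add.assoc)
  qed
  have split: "\<exists>p\<in>q_cone R'. \<exists>n\<in>q_cone {s \<in> R. dot2 g s < 0}. x = p + n" if "x \<in> q_cone R" for x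
    using that
  proof (induction rule: q_cone_induct_vec)
    case zero
    show ?case by (rule bexI[of _ 0], rule bexI[of _ 0]) (simp_all add: q_cone_zero)
  next
    case (add s x c)
    then obtain p n where pn: "p \<in> q_cone R'" "n \<in> q_cone {s \<in> R. dot2 g s < 0}" "x = p + n" by blast
    show ?case
    proof (cases "0 \<le> dot2 g s")
      case True
      then have "s \<in> R'" using add by (auto simp: R'_def)
      then show ?thesis
        using pn add by (intro bexI[of _ "scale2 c s + p"] bexI[of _ n] q_cone_add_scaled) (auto simp: add.assoc)
    next
      case False
      then show ?thesis
        using pn add by (intro bexI[of _ p] bexI[of _ "scale2 c s + n"] q_cone_add_scaled) (auto simp: algebra_simps)
    qed
  qed
  have "q_cone R' = {x \<in> q_cone R. 0 \<le> dot2 g x}"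
  proof (intro equalityI subsetI)
    fix x assume x: "x \<in> {x \<in> q_cone R. 0 \<le> dot2 g x}"
    then obtain p n where "p \<in> q_cone R'" "n \<in> q_cone {s \<in> R. dot2 g s < 0}" "x = p + n"
      using split by blast
    then show "x \<in> q_cone R'" using neg x by blast
  qed (use sub in auto)
  then show ?thesis using fin that by blast
qed

lemma finite_cone_Int_halfspaces:
  assumes "finite G" "finite R"
  obtains R' where "finite R'" "q_cone R' = {x \<in> q_cone R. \<forall>g\<in>G. 0 \<le> dot2 g x}"
proof -
  have "\<exists>R'. finite R' \<and> q_cone R' = {x \<in> q_cone R. \<forall>g\<in>G. 0 \<le> dot2 g x}"
    using assms(1)
  proof (induction rule: finite_induct)
    case empty
    then show ?case using assms(2) by auto
  next
    case (insert g G)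
    then obtain R' where R': "finite R'" "q_cone R' = {x \<in> q_cone R. \<forall>g\<in>G. 0 \<le> dot2 g x}" by blast
    obtain R'' where "finite R''" "q_cone R'' = {x \<in> q_cone R'. 0 \<le> dot2 g x}"
      using finite_cone_Int_halfspace[OF R'(1)] by blast
    then show ?case using R'(2) by (intro exI[of _ R'']) auto
  qed
  then show ?thesis using that by blast
qed

lemma q_cone_coords:
  assumes "finite I" "finite J"
  obtains R where "finite R" "q_cone R = coords I \<times> coords J"
proof -
  define R :: "qvec2 set" where "R =
    (\<lambda>(i, c). (single i c, 0)) ` (I \<times> {1, -1}) \<union>
    (\<lambda>(i, c). (0, single i c)) ` (J \<times> {1, -1})"
  have "finite R" using assms by (simp add: R_def)
  have R_sub: "R \<subseteq> coords I \<times> coords J"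
    by (auto simp: R_def intro: coords_single)
  have sub: "x \<in> coords I \<times> coords J" if "x \<in> q_cone R" for x
    using that
  proof (induction rule: q_cone_induct_vec)
    case (add s x c)
    then have "s \<in> coords I \<times> coords J" using R_sub by blast
    with add show ?case by (auto simp: scale2_def mem_Times_iff intro: coords_add coords_pm_scale)
  qed (simp add: zero_prod_def)
  have single_scale: "single i c = pm_scale \<bar>c\<bar> (single i (if c \<ge> 0 then 1 else -1))"
    for i and c :: rat
    by (rule poly_mapping_eqI) (auto simp: lookup_pm_scale lookup_single when_def)
  have left: "(single i c, 0) \<in> q_cone R" if "i \<in> I" for i c
  proof -
    have "(single i (if c \<ge> 0 then 1 else -1), 0) \<in> R"
      using that by (force simp: R_def)
    from q_cone_scale[OF q_cone_incl[OF this], of "\<bar>c\<bar>"] show ?thesis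
      by (simp add: scale2_def single_scale[of i c])
  qed
  have right: "(0, single i c) \<in> q_cone R" if "i \<in> J" for i c
  proof -
    have "(0, single i (if c \<ge> 0 then 1 else -1)) \<in> R"
      using that by (force simp: R_def)
    from q_cone_scale[OF q_cone_incl[OF this], of "\<bar>c\<bar>"] show ?thesis
      by (simp add: scale2_def single_scale[of i c])
  qed
  have sumL: "(\<Sum>i\<in>F. single i (f i), 0) \<in> q_cone R" if "finite F" "F \<subseteq> I" for F f
    using that
  proof (induction rule: finite_induct)
    case (insert i F)
    then have "(single i (f i), 0) + (\<Sum>i\<in>F. single i (f i), 0) \<in> q_cone R"
      by (intro q_cone_add left) auto
    then show ?case using insert by simp
  qed (simp add: q_cone.zero)
  have sumR: "(0, \<Sum>i\<in>F. single i (f i)) \<in> q_cone R" if "finite F" "F \<subseteq> J" for F f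
    using that
  proof (induction rule: finite_induct)
    case (insert i F)
    then have "(0, single i (f i)) + (0, \<Sum>i\<in>F. single i (f i)) \<in> q_cone R"
      by (intro q_cone_add right) auto
    then show ?case using insert by simp
  qed (simp add: q_cone.zero)
  have expand: "a = (\<Sum>i\<in>K. single i (lookup a i))"
    if "finite K" "a \<in> coords K" for K and a :: "nat \<Rightarrow>\<^sub>0 rat"
    by (rule poly_mapping_eqI)
      (use that in \<open>auto simp: lookup_sum lookup_single when_def coords_iff\<close>)
  have "(a, b) \<in> q_cone R" if "a \<in> coords I" "b \<in> coords J" for a b
    using q_cone_add[OF sumL[OF assms(1) order.refl, of "lookup a"]
        sumR[OF assms(2) order.refl, of "lookup b"]]
      expand[OF assms(1) that(1)] expand[OF assms(2) that(2)] by simp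
  then have "q_cone R = coords I \<times> coords J"
    using sub by auto
  then show ?thesis using \<open>finite R\<close> that by blast
qed

section \<open>Polyhedra, lattice points and polyhedral divisors\<close>

lemma monoid_hull_incl: "s \<in> S \<Longrightarrow> s \<in> monoid_hull S"
  using monoid_hull.add[of s S 0] by (simp add: monoid_hull.zero)

lemma monoid_hull_add: "x \<in> monoid_hull S \<Longrightarrow> y \<in> monoid_hull S \<Longrightarrow> x + y \<in> monoid_hull S"
  by (induction rule: monoid_hull.induct) (auto simp: add.assoc intro: monoid_hull.add)

lemma monoid_hull_least:
  assumes "x \<in> monoid_hull S" "0 \<in> T" "\<And>s x. s \<in> S \<Longrightarrow> x \<in> T \<Longrightarrow> s + x \<in> T"
  shows "x \<in> T"
  using assms(1) by (induction rule: monoid_hull.induct) (auto intro: assms)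

lemma finite_bounded_coords:
  fixes b :: "'i \<Rightarrow> int"
  assumes "finite I"
  shows "finite {a \<in> coords I. \<forall>i\<in>I. \<bar>lookup a i\<bar> \<le> b i}" (is "finite ?A")
proof (rule finite_imageD)
  show "finite ((\<lambda>a. restrict (lookup a) I) ` ?A)"
  proof (rule finite_subset)
    show "(\<lambda>a. restrict (lookup a) I) ` ?A \<subseteq> PiE I (\<lambda>i. {- b i..b i})"
      by (auto simp: abs_le_iff)
  qed (use assms in \<open>auto intro: finite_PiE\<close>)
  show "inj_on (\<lambda>a. restrict (lookup a) I) ?A"
  proof (rule inj_onI)
    fix a c assume ac: "a \<in> ?A" "c \<in> ?A" "restrict (lookup a) I = restrict (lookup c) I"
    show "a = c"
    proof (rule poly_mapping_eqI)
      fix i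
      show "lookup a i = lookup c i"
      proof (cases "i \<in> I")
        case True
        then show ?thesis using fun_cong[OF ac(3), of i] by simp
      next
        case False
        then show ?thesis using ac(1,2) by (simp add: coords_iff)
      qed
    qed
  qed
qed

definition rat2 :: "lat \<Rightarrow> qvec2" where
  "rat2 h = (rat_vec (fst h), rat_vec (snd h))"

lemma rat2_add: "rat2 (h + k) = rat2 h + rat2 k"
  and rat2_diff: "rat2 (h - k) = rat2 h - rat2 k"
  and rat2_0 [simp]: "rat2 0 = 0"
  and rat2_inject [simp]: "rat2 h = rat2 k \<longleftrightarrow> h = k"
  by (auto simp: rat2_def rat_vec_add rat_vec_diff zero_prod_def prod_eq_iff)

lemma rat2_sum: "rat2 (sum f A) = (\<Sum>x\<in>A. rat2 (f x))"
  by (induction A rule: infinite_finite_induct) (auto simp: rat2_add)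

lemma dot2_rat2: "dot2 t (rat2 h) = pairing2 t h"
  by (simp add: dot2_def rat2_def dot_rat_vec pairing2_def)

lemma dot2_sum_right: "dot2 t (sum f A) = (\<Sum>x\<in>A. dot2 t (f x))"
  by (induction A rule: infinite_finite_induct) (auto simp: dot2_add_right)

lemma dot_sum_right: "dot t (sum f A) = (\<Sum>x\<in>A. dot t (f x))"
  by (induction A rule: infinite_finite_induct) (auto simp: dot_add_right)

definition iscale2 :: "int \<Rightarrow> lat \<Rightarrow> lat" where
  "iscale2 n h = (pm_scale n (fst h), pm_scale n (snd h))"

lemma rat2_iscale2: "rat2 (iscale2 n h) = scale2 (of_int n) (rat2 h)"
  by (simp add: rat2_def iscale2_def scale2_def rat_vec_pm_scale)

lemma iscale2_mem_monoid_hull: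
  assumes "0 \<le> n" "h \<in> monoid_hull S"
  shows "iscale2 n h \<in> monoid_hull S"
  using assms(1)
proof (induction n rule: int_ge_induct)
  case base
  then show ?case by (simp add: iscale2_def monoid_hull.zero flip: zero_prod_def)
next
  case (step n)
  have "iscale2 (n + 1) h = iscale2 n h + h"
    by (simp add: iscale2_def pm_scale_add_left prod_eq_iff)
  then show ?case using step assms(2) by (simp add: monoid_hull_add)
qed

lemma integral_multiple2:
  obtains n :: int and h where "n > 0" "rat2 h = scale2 (of_int n) x"
    "fst x \<in> coords I \<longrightarrow> fst h \<in> coords I" "snd x \<in> coords J \<longrightarrow> snd h \<in> coords J"
proof -
  obtain n1 u1 where 1: "n1 > 0" "rat_vec u1 = pm_scale (of_int n1) (fst x)"
    "keys u1 \<subseteq> keys (fst x)"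
    by (rule integral_multiple)
  obtain n2 u2 where 2: "n2 > 0" "rat_vec u2 = pm_scale (of_int n2) (snd x)"
    "keys u2 \<subseteq> keys (snd x)"
    by (rule integral_multiple)
  define h where "h = (pm_scale n2 u1, pm_scale n1 u2)"
  have "rat2 h = scale2 (of_int (n1 * n2)) x"
    by (simp add: h_def rat2_def scale2_def rat_vec_pm_scale 1 2 pm_scale_pm_scale mult.commute)
  moreover have "fst x \<in> coords I \<Longrightarrow> fst h \<in> coords I" "snd x \<in> coords J \<Longrightarrow> snd h \<in> coords J"
    using 1 2 by (auto simp: h_def coords_def[of I] coords_def[of J] in_keys_iff lookup_pm_scale)
  ultimately show ?thesis using that[of "n1 * n2" h] 1 2 by simp
qed

text \<open>Gordan's lemma. Integral generators of the rational cone, together with the finitely many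
  lattice points of the cone in a bounded box, generate: rounding down the coefficients of a
  lattice point in the generators leaves a remainder in the box.\<close>

lemma lattice_points_finitely_generated:
  fixes I J :: "nat set" and T :: "qvec2 set"
  assumes "finite I" "finite J" "finite T"
  obtains H where "finite H"
    "monoid_hull H = {h \<in> coords I \<times> coords J. \<forall>t\<in>T. 0 \<le> pairing2 t h}"
proof -
  let ?M = "{h \<in> coords I \<times> coords J. \<forall>t\<in>T. 0 \<le> pairing2 t h}"
  obtain R0 where R0: "finite R0" "q_cone R0 = coords I \<times> coords J"
    using q_cone_coords[OF assms(1,2)] by blast
  obtain R where R: "finite R" "q_cone R = {x \<in> q_cone R0. \<forall>g\<in>T. 0 \<le> dot2 g x}"
    using finite_cone_Int_halfspaces[OF assms(3) R0(1)] by blast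
  have "\<forall>r. \<exists>n h. n > 0 \<and> rat2 h = scale2 (of_int n) r \<and>
      (r \<in> coords I \<times> coords J \<longrightarrow> h \<in> coords I \<times> coords J)"
  proof
    fix r
    obtain n h where "n > 0" "rat2 h = scale2 (of_int n) r"
      "fst r \<in> coords I \<longrightarrow> fst h \<in> coords I" "snd r \<in> coords J \<longrightarrow> snd h \<in> coords J"
      by (rule integral_multiple2)
    then show "\<exists>n h. n > 0 \<and> rat2 h = scale2 (of_int n) r \<and>
        (r \<in> coords I \<times> coords J \<longrightarrow> h \<in> coords I \<times> coords J)"
      unfolding mem_Times_iff by blast
  qed
  then obtain n h where nh: "\<And>r. n r > 0" "\<And>r. rat2 (h r) = scale2 (of_int (n r)) r"
    "\<And>r. r \<in> coords I \<times> coords J \<Longrightarrow> h r \<in> coords I \<times> coords J"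
    by metis
  have R_mem: "r \<in> coords I \<times> coords J" "\<And>t. t \<in> T \<Longrightarrow> 0 \<le> dot2 t r" if "r \<in> R" for r
    using q_cone_incl[OF that] R R0 by auto
  have h_mem: "h r \<in> ?M" if "r \<in> R" for r
    using R_mem[OF that] nh(3) nh(1)[of r] dot2_scale_right[of _ "of_int (n r)" r]
    by (auto simp: dot2_rat2 nh(2) simp flip: dot2_rat2)
  \<comment> \<open>Bounds for the coordinates of combinations of the generators with coefficients in \<open>[0, 1]\<close>.\<close>
  define bd :: "(lat \<Rightarrow> (nat \<Rightarrow>\<^sub>0 int)) \<Rightarrow> nat \<Rightarrow> int"
    where "bd = (\<lambda>p i. \<Sum>r\<in>R. \<bar>lookup (p (h r)) i\<bar>)"
  define B where "B = {k \<in> ?M. (\<forall>i\<in>I. \<bar>lookup (fst k) i\<bar> \<le> bd fst i) \<and>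
      (\<forall>i\<in>J. \<bar>lookup (snd k) i\<bar> \<le> bd snd i)}"
  have "finite B"
  proof (rule finite_subset)
    show "B \<subseteq> {a \<in> coords I. \<forall>i\<in>I. \<bar>lookup a i\<bar> \<le> bd fst i} \<times>
        {a \<in> coords J. \<forall>i\<in>J. \<bar>lookup a i\<bar> \<le> bd snd i}"
      by (auto simp: B_def)
  qed (intro finite_cartesian_product finite_bounded_coords assms)
  define H where "H = h ` R \<union> B"
  have "finite H" using \<open>finite B\<close> R(1) by (simp add: H_def)
  have H_sub: "H \<subseteq> ?M" unfolding H_def B_def by (intro Un_least image_subsetI h_mem) blast+
  have "monoid_hull H \<subseteq> ?M"
  proof
    fix x assume "x \<in> monoid_hull H"
    then show "x \<in> ?M"
    proof (rule monoid_hull_least)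
      show "0 \<in> ?M" by (simp add: mem_Times_iff)
      fix s x assume "s \<in> H" "x \<in> ?M"
      then show "s + x \<in> ?M" using H_sub
        by (auto simp: pairing2_add_right mem_Times_iff intro!: coords_add)
    qed
  qed
  moreover have "?M \<subseteq> monoid_hull H"
  proof
    fix x assume x: "x \<in> ?M"
    then have "rat2 x \<in> q_cone R"
      by (auto simp: R R0 dot2_rat2) (auto simp: rat2_def)
    then obtain l where l: "\<And>r. 0 \<le> l r" "rat2 x = (\<Sum>r\<in>R. scale2 (l r) r)"
      using q_cone_finite_sum[OF R(1)] by blast
    define \<mu> where "\<mu> r = l r / of_int (n r)" for r
    have \<mu>: "scale2 (\<mu> r) (rat2 (h r)) = scale2 (l r) r" for r
      using nh(1)[of r] by (simp add: nh(2) scale2_scale2 \<mu>_def)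
    have \<mu>0: "0 \<le> \<mu> r" for r
      using l(1)[of r] nh(1)[of r] by (simp add: \<mu>_def)
    define y where "y = (\<Sum>r\<in>R. iscale2 \<lfloor>\<mu> r\<rfloor> (h r))"
    have "(\<Sum>r\<in>F. iscale2 \<lfloor>\<mu> r\<rfloor> (h r)) \<in> monoid_hull H" if "F \<subseteq> R" for F
      using finite_subset[OF that R(1)] that
    proof (induction rule: finite_induct)
      case (insert r F)
      have "iscale2 \<lfloor>\<mu> r\<rfloor> (h r) \<in> monoid_hull H"
        using insert.prems \<mu>0[of r] by (intro iscale2_mem_monoid_hull monoid_hull_incl) (auto simp: H_def)
      with insert show ?case
        by (simp add: monoid_hull_add)
    qed (simp add: monoid_hull.zero)
    then have y: "y \<in> monoid_hull H"
      by (simp add: y_def)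
    then have yM: "y \<in> ?M"
      using \<open>monoid_hull H \<subseteq> ?M\<close> by blast
    define z where "z = x - y"
    have "rat2 z = (\<Sum>r\<in>R. scale2 (frac (\<mu> r)) (rat2 (h r)))"
    proof -
      have "rat2 z = (\<Sum>r\<in>R. scale2 (\<mu> r) (rat2 (h r))) - (\<Sum>r\<in>R. scale2 (of_int \<lfloor>\<mu> r\<rfloor>) (rat2 (h r)))"
        by (simp add: z_def rat2_diff l(2) \<mu> y_def rat2_sum rat2_iscale2)
      also have "\<dots> = (\<Sum>r\<in>R. scale2 (frac (\<mu> r) + of_int \<lfloor>\<mu> r\<rfloor>) (rat2 (h r)) - scale2 (of_int \<lfloor>\<mu> r\<rfloor>) (rat2 (h r)))"
        by (simp add: sum_subtractf frac_def)
      finally show ?thesis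
        by (simp add: scale2_add_left)
    qed
    note z_eq = this
    have fr: "0 \<le> frac (\<mu> r)" "frac (\<mu> r) \<le> 1" for r
      using frac_lt_1[of "\<mu> r"] by auto
    have "z \<in> ?M"
    proof -
      have "z \<in> coords I \<times> coords J"
        using x yM by (auto simp: z_def mem_Times_iff intro: coords_diff)
      moreover have "0 \<le> pairing2 t z" if "t \<in> T" for t
      proof -
        have "pairing2 t z = (\<Sum>r\<in>R. frac (\<mu> r) * pairing2 t (h r))"
          by (simp add: z_eq dot2_sum_right dot2_scale_right flip: dot2_rat2)
        then show ?thesis
          using h_mem that fr by (auto intro!: sum_nonneg mult_nonneg_nonneg)
      qed
      ultimately show ?thesis by blast
    qed
    moreover have "\<bar>lookup (fst z) i\<bar> \<le> bd fst i" "\<bar>lookup (snd z) i\<bar> \<le> bd snd i" for i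
    proof -
      have abs_le: "\<bar>\<Sum>r\<in>R. frac (\<mu> r) * of_int (k r)\<bar> \<le> of_int (\<Sum>r\<in>R. \<bar>k r\<bar>)" for k
      proof -
        have "\<bar>\<Sum>r\<in>R. frac (\<mu> r) * of_int (k r)\<bar> \<le> (\<Sum>r\<in>R. \<bar>frac (\<mu> r) * of_int (k r)\<bar>)"
          by (rule sum_abs)
        also have "\<dots> \<le> (\<Sum>r\<in>R. \<bar>of_int (k r)\<bar>)"
          using fr by (intro sum_mono) (simp add: abs_mult mult_left_le_one_le)
        finally show ?thesis by simp
      qed
      have "of_int (lookup (fst z) i) = (\<Sum>r\<in>R. frac (\<mu> r) * of_int (lookup (fst (h r)) i))"
        using arg_cong[OF z_eq, of "\<lambda>x. lookup (fst x) i"]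
        by (simp add: rat2_def scale2_def fst_sum lookup_sum lookup_pm_scale lookup_rat_vec)
      then have "of_int \<bar>lookup (fst z) i\<bar> \<le> (of_int (bd fst i) :: rat)"
        using abs_le[of "\<lambda>r. lookup (fst (h r)) i"] unfolding bd_def by simp
      then show "\<bar>lookup (fst z) i\<bar> \<le> bd fst i"
        by (simp only: of_int_le_iff)
      have "of_int (lookup (snd z) i) = (\<Sum>r\<in>R. frac (\<mu> r) * of_int (lookup (snd (h r)) i))"
        using arg_cong[OF z_eq, of "\<lambda>x. lookup (snd x) i"]
        by (simp add: rat2_def scale2_def snd_sum lookup_sum lookup_pm_scale lookup_rat_vec)
      then have "of_int \<bar>lookup (snd z) i\<bar> \<le> (of_int (bd snd i) :: rat)"
        using abs_le[of "\<lambda>r. lookup (snd (h r)) i"] unfolding bd_def by simp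
      then show "\<bar>lookup (snd z) i\<bar> \<le> bd snd i"
        by (simp only: of_int_le_iff)
    qed
    ultimately have "z \<in> B"
      by (simp add: B_def)
    then have "z + y \<in> monoid_hull H"
      using y by (simp add: monoid_hull.add H_def)
    then show "x \<in> monoid_hull H"
      by (simp add: z_def)
  qed
  ultimately have "monoid_hull H = ?M" by (rule equalityI)
  with \<open>finite H\<close> show ?thesis by (rule that)
qed

lemma dot_one: "dot 1 b = lookup b 0"
  by (metis dot_single mult_1 single_one)

lemma coords_empty: "coords {} = {0}"
  by (auto simp: coords_def)

text \<open>Generators turn the infinitely many conditions for a weight to be nonnegative on the cone into
  finitely many.\<close>

lemma polyhedral_cone_generators:
  assumes "is_polyhedral_cone d \<sigma>"
  obtains R where "finite R" "R \<subseteq> \<sigma>"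
    "\<forall>u. (\<forall>r\<in>R. 0 \<le> pairing r u) \<longrightarrow> (\<forall>a\<in>\<sigma>. 0 \<le> pairing a u)"
proof -
  obtain F where F: "finite F" "\<sigma> = {a \<in> coords {..<d}. \<forall>u\<in>F. 0 \<le> pairing a u}"
    using assms by (auto simp: is_polyhedral_cone_def)
  obtain R0 :: "qvec2 set" where R0: "finite R0" "q_cone R0 = coords {..<d} \<times> coords {}"
    using q_cone_coords[of "{..<d}" "{}"] by auto
  obtain R where R: "finite R" "q_cone R = {x \<in> q_cone R0. \<forall>g\<in>(\<lambda>u. (rat_vec u, 0)) ` F. 0 \<le> dot2 g x}"
    by (rule finite_cone_Int_halfspaces[OF finite_imageI[OF F(1)] R0(1)])
  have cone: "q_cone R = \<sigma> \<times> {0}"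
    unfolding R(2) R0(2) F(2) coords_empty by (auto simp: dot2_def dot_commute[of "rat_vec _"] dot_rat_vec)
  show ?thesis
  proof (rule that)
    show "finite (fst ` R)" using R(1) by simp
    have "R \<subseteq> \<sigma> \<times> {0}" unfolding cone[symmetric] by (auto intro: q_cone_incl)
    then show "fst ` R \<subseteq> \<sigma>" by auto
    show "\<forall>u. (\<forall>r\<in>fst ` R. 0 \<le> pairing r u) \<longrightarrow> (\<forall>a\<in>\<sigma>. 0 \<le> pairing a u)"
    proof (intro allI impI ballI)
      fix u a assume u: "\<forall>r\<in>fst ` R. 0 \<le> pairing r u" and "a \<in> \<sigma>"
      then have "(a, 0) \<in> q_cone R" by (simp add: cone)
      then have "0 \<le> dot2 (a, 0) (rat_vec u, 0)"
        by (rule q_cone_dot2_nonneg) (use u in \<open>auto simp: dot2_def dot_rat_vec\<close>)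
      then show "0 \<le> pairing a u"
        by (simp add: dot2_def dot_rat_vec)
    qed
  qed
qed

text \<open>A polyhedron is homogenized to a cone, whose generators at height \<open>0\<close> lie in the tail cone and
  whose generators at positive height give points of the polyhedron. A weight that is nonnegative
  on the tail cone is minimal at one of these points.\<close>

lemma polyhedron_min_at_vertices:
  assumes "is_polyhedron d \<Delta>" "\<Delta> \<noteq> {}"
  obtains V where "finite V" "V \<subseteq> \<Delta>"
    "\<forall>u\<in>dual_weights d (tailcone d \<Delta>). \<forall>x\<in>\<Delta>. \<exists>y\<in>V. pairing y u \<le> pairing x u"
proof -
  obtain F where F: "finite F" "fst ` F \<subseteq> coords {..<d}"
      "\<Delta> = {a \<in> coords {..<d}. \<forall>(u, b)\<in>F. b \<le> pairing a u}"
    using assms by (auto simp: is_polyhedron_def)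
  define ht :: "qvec2 \<Rightarrow> rat" where "ht x = lookup (snd x) 0" for x
  define G where "G = insert (0, single (0::nat) 1) ((\<lambda>(u, b). (rat_vec u, single 0 (- b))) ` F)"
  have ht_add: "ht (x + y) = ht x + ht y" and ht_scale: "ht (scale2 c x) = c * ht x" for x y c
    by (simp_all add: ht_def lookup_add scale2_def lookup_pm_scale)
  obtain R0 :: "qvec2 set" where R0: "finite R0" "q_cone R0 = coords {..<d} \<times> coords {0}"
    using q_cone_coords[of "{..<d}" "{0}"] by auto
  have "finite G" using F(1) by (simp add: G_def)
  then obtain R where R: "finite R" "q_cone R = {x \<in> q_cone R0. \<forall>g\<in>G. 0 \<le> dot2 g x}"
    using finite_cone_Int_halfspaces[OF _ R0(1)] by blast
  have "(\<forall>g\<in>G. 0 \<le> dot2 g x) \<longleftrightarrow> 0 \<le> ht x \<and> (\<forall>(u, b)\<in>F. b * ht x \<le> pairing (fst x) u)" for x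
    by (auto simp: G_def dot2_def ht_def dot_commute[of "rat_vec _"] dot_rat_vec dot_single dot_one split_beta)
  then have cone: "x \<in> q_cone R \<longleftrightarrow> x \<in> coords {..<d} \<times> coords {0} \<and> 0 \<le> ht x \<and>
      (\<forall>(u, b)\<in>F. b * ht x \<le> pairing (fst x) u)" for x
    by (simp add: R(2) R0(2))
  define V where "V = (\<lambda>x. pm_scale (1 / ht x) (fst x)) ` {x \<in> R. 0 < ht x}"
  have "V \<subseteq> \<Delta>"
  proof
    fix y assume "y \<in> V"
    then obtain x where x: "x \<in> R" "0 < ht x" "y = pm_scale (1 / ht x) (fst x)"
      by (auto simp: V_def)
    from cone[of x] q_cone_incl[OF x(1)] x(2) show "y \<in> \<Delta>"
      by (auto simp: F(3) x(3) pairing_pm_scale_left field_simps intro!: coords_pm_scale)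
  qed
  have tail: "fst x \<in> tailcone d \<Delta>" if "x \<in> R" "ht x = 0" for x
    using cone[of x] q_cone_incl[OF that(1)] that(2)
    by (force simp: tailcone_def F(3) pairing_add_left intro!: coords_add)
  show ?thesis
  proof (rule that, safe)
    show "finite V" using R(1) by (simp add: V_def)
    then have "finite V" .
    show "y \<in> \<Delta>" if "y \<in> V" for y using that \<open>V \<subseteq> \<Delta>\<close> by blast
    fix u x assume u: "u \<in> dual_weights d (tailcone d \<Delta>)" and x: "x \<in> \<Delta>"
    have x1: "(x, single 0 1) \<in> q_cone R"
      using x by (auto simp: cone F(3) ht_def coords_single simp del: single_one)
    have "V \<noteq> {}"
    proof
      assume "V = {}"
      then have ht0: "ht r = 0" if "r \<in> R" for r
        using that cone[of r] q_cone_incl[OF that] by (force simp: V_def)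
      have "ht z = 0" if "z \<in> q_cone R" for z
        using that by (induction rule: q_cone_induct_vec) (auto simp: ht_add ht_scale ht0, simp add: ht_def)
      from this[OF x1] show False by (simp add: ht_def)
    qed
    define \<mu> where "\<mu> = Min ((\<lambda>y. pairing y u) ` V)"
    have "\<mu> * ht r \<le> pairing (fst r) u" if "r \<in> R" for r
    proof (cases "ht r = 0")
      case True
      with tail[OF that] u show ?thesis by (simp add: dual_weights_def)
    next
      case False
      then have "0 < ht r" using cone[of r] q_cone_incl[OF that] by auto
      then have "\<mu> \<le> pairing (pm_scale (1 / ht r) (fst r)) u"
        unfolding \<mu>_def using that \<open>finite V\<close> by (intro Min_le) (auto simp: V_def)
      then show ?thesis
        using \<open>0 < ht r\<close> by (simp add: pairing_pm_scale_left field_simps)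
    qed
    note gen = this
    have "\<mu> * ht z \<le> pairing (fst z) u" if "z \<in> q_cone R" for z
      using that
    proof (induction rule: q_cone_induct_vec)
      case (add s x c)
      have "c * (\<mu> * ht s) \<le> c * pairing (fst s) u"
        using gen[OF add.hyps(1)] add.hyps(3) by (rule mult_left_mono)
      moreover have "pairing (fst (scale2 c s + x)) u = c * pairing (fst s) u + pairing (fst x) u"
        by (simp add: pairing_add_left scale2_def pairing_pm_scale_left)
      ultimately show ?case
        using add.IH by (simp add: ht_add ht_scale algebra_simps)
    qed (simp add: ht_def)
    from this[OF x1] have "\<mu> \<le> pairing x u" by (simp add: ht_def)
    moreover have "\<mu> \<in> (\<lambda>y. pairing y u) ` V"
      unfolding \<mu>_def using \<open>finite V\<close> \<open>V \<noteq> {}\<close> by (intro Min_in) auto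
    ultimately show "\<exists>y\<in>V. pairing y u \<le> pairing x u" by auto
  qed
qed

lemma pdivisor_coeff:
  assumes "is_pdivisor d D" "i \<le> pd_m D" "pd_coeff D i \<noteq> {}"
  shows "is_polyhedron d (pd_coeff D i)" "tailcone d (pd_coeff D i) = pd_tail D"
  using assms by (auto simp: is_pdivisor_def)

lemma pdivisor_coeff_add_tail:
  assumes "is_pdivisor d D" "i \<le> pd_m D" "x \<in> pd_coeff D i" "a \<in> pd_tail D"
  shows "x + a \<in> pd_coeff D i"
  using pdivisor_coeff(2)[OF assms(1,2)] assms(3,4) by (auto simp: tailcone_def)

lemma pdivisor_tail_0: "is_pdivisor d D \<Longrightarrow> 0 \<in> pd_tail D"
  by (auto simp: is_pdivisor_def)

text \<open>The minima are taken at the finitely many vertices, so the least element in the definition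
  of \<open>min_pairing\<close> exists.\<close>

lemma min_pairing_attained:
  assumes "is_pdivisor d D" "i \<le> pd_m D" "pd_coeff D i \<noteq> {}" "u \<in> dual_weights d (pd_tail D)"
  obtains x where "x \<in> pd_coeff D i" "min_pairing (pd_coeff D i) u = pairing x u"
    "\<And>y. y \<in> pd_coeff D i \<Longrightarrow> min_pairing (pd_coeff D i) u \<le> pairing y u"
proof -
  let ?\<Delta> = "pd_coeff D i"
  obtain V where V: "finite V" "V \<subseteq> ?\<Delta>"
    "\<forall>u\<in>dual_weights d (pd_tail D). \<forall>x\<in>?\<Delta>. \<exists>y\<in>V. pairing y u \<le> pairing x u"
    by (rule polyhedron_min_at_vertices[OF pdivisor_coeff(1)[OF assms(1-3)] assms(3),
          unfolded pdivisor_coeff(2)[OF assms(1-3)]])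
  define \<mu> where "\<mu> = Min ((\<lambda>y. pairing y u) ` V)"
  have "V \<noteq> {}" using V(3) assms(3,4) by blast
  then have "\<mu> \<in> (\<lambda>y. pairing y u) ` V"
    unfolding \<mu>_def using V(1) by (intro Min_in) auto
  then obtain x where x: "x \<in> V" "\<mu> = pairing x u" by blast
  have le: "\<mu> \<le> pairing y u" if "y \<in> ?\<Delta>" for y
  proof -
    obtain z where z: "z \<in> V" "pairing z u \<le> pairing y u" using V(3) assms(4) \<open>y \<in> ?\<Delta>\<close> by blast
    then have "\<mu> \<le> pairing z u" unfolding \<mu>_def using V(1) by (intro Min_le) auto
    with z show ?thesis by simp
  qed
  have "min_pairing ?\<Delta> u = \<mu>"
    unfolding min_pairing_def using x V(2) le by (intro Least_equality) auto
  then show ?thesis using that[of x] x V(2) le by auto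
qed

text \<open>The pairing of \<open>b\<close> with \<open>e\<^sub>i\<close> as an integer, which serves the rational as well as the real
  version of \<open>e_vec\<close>.\<close>

definition e_coeff :: "nat \<Rightarrow> nat \<Rightarrow> (nat \<Rightarrow>\<^sub>0 int) \<Rightarrow> int" where
  "e_coeff m i b = (if i = 0 then - (\<Sum>j=1..m. lookup b j) else lookup b i)"

lemma pairing_e_vec: "pairing (e_vec m i) b = of_int (e_coeff m i b)"
  by (simp add: e_vec_def e_coeff_def pairing_single pairing_uminus_left pairing_sum_left)

lemma e_coeff_add: "e_coeff m i (b + c) = e_coeff m i b + e_coeff m i c"
  by (simp add: e_coeff_def lookup_add sum.distrib)

lemma dual_monoid_iff:
  assumes "is_pdivisor d D"
  shows "h \<in> dual_monoid d D \<longleftrightarrow> fst h \<in> dual_weights d (pd_tail D) \<and> snd h \<in> coords {1..pd_m D} \<and>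
    (\<forall>i\<le>pd_m D. \<forall>x\<in>pd_coeff D i. 0 \<le> pairing x (fst h) + of_int (e_coeff (pd_m D) i (snd h)))"
    (is "?L \<longleftrightarrow> ?R")
proof
  assume L: ?L
  then have c: "h \<in> coords {..<d} \<times> coords {1..pd_m D}" "\<And>a. a \<in> big_cone D \<Longrightarrow> 0 \<le> pairing2 a h"
    by (auto simp: dual_monoid_def)
  have "0 \<le> pairing a (fst h)" if "a \<in> pd_tail D" for a
  proof -
    have "(a, 0) \<in> big_cone D"
      unfolding big_cone_def using that by (intro q_cone_incl) blast
    from c(2)[OF this] show ?thesis by (simp add: pairing2_def)
  qed
  moreover have "0 \<le> pairing x (fst h) + of_int (e_coeff (pd_m D) i (snd h))"
    if "i \<le> pd_m D" "x \<in> pd_coeff D i" for i x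
  proof -
    have "(x, e_vec (pd_m D) i) \<in> big_cone D"
      unfolding big_cone_def using that by (intro q_cone_incl) blast
    from c(2)[OF this] show ?thesis by (simp add: pairing2_def pairing_e_vec)
  qed
  ultimately show ?R using c(1) by (auto simp: dual_weights_def)
next
  assume R: ?R
  have "0 \<le> pairing2 a h" if "a \<in> big_cone D" for a
    unfolding dot2_rat2[symmetric]
  proof (rule q_cone_dot2_nonneg[OF that[unfolded big_cone_def]])
    fix s :: qvec2 assume "s \<in> pd_tail D \<times> {0} \<union> (\<Union>i\<le>pd_m D. pd_coeff D i \<times> {e_vec (pd_m D) i})"
    then show "0 \<le> dot2 s (rat2 h)"
      using R by (auto simp: dot2_rat2 pairing2_def pairing_e_vec dual_weights_def)
  qed
  then show ?L using R by (auto simp: dual_monoid_def dual_weights_def mem_Times_iff)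
qed

text \<open>The dual cone is cut out by finitely many inequalities, those of the generators of the tail
  cone and of the vertices of the coefficients, so Gordan's lemma applies.\<close>

lemma dual_monoid_finitely_generated:
  assumes "is_pdivisor d D"
  obtains H where "finite H" "monoid_hull H = dual_monoid d D"
proof -
  have "is_polyhedral_cone d (pd_tail D)"
    using assms by (simp add: is_pdivisor_def)
  then obtain R where R: "finite R" "R \<subseteq> pd_tail D"
    "\<forall>u. (\<forall>r\<in>R. 0 \<le> pairing r u) \<longrightarrow> (\<forall>a\<in>pd_tail D. 0 \<le> pairing a u)"
    by (rule polyhedral_cone_generators)
  have "\<exists>V. finite V \<and> V \<subseteq> pd_coeff D i \<and>
      (\<forall>u\<in>dual_weights d (pd_tail D). \<forall>x\<in>pd_coeff D i. \<exists>y\<in>V. pairing y u \<le> pairing x u)"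
    if i: "i \<le> pd_m D" for i
  proof (cases "pd_coeff D i = {}")
    case False
    obtain V where "finite V" "V \<subseteq> pd_coeff D i"
      "\<forall>u\<in>dual_weights d (pd_tail D). \<forall>x\<in>pd_coeff D i. \<exists>y\<in>V. pairing y u \<le> pairing x u"
      by (rule polyhedron_min_at_vertices[OF pdivisor_coeff(1)[OF assms i False] False,
            unfolded pdivisor_coeff(2)[OF assms i False]])
    then show ?thesis by blast
  qed auto
  then obtain V where V: "\<And>i. i \<le> pd_m D \<Longrightarrow> finite (V i)" "\<And>i. i \<le> pd_m D \<Longrightarrow> V i \<subseteq> pd_coeff D i"
    "\<And>i u x. i \<le> pd_m D \<Longrightarrow> u \<in> dual_weights d (pd_tail D) \<Longrightarrow> x \<in> pd_coeff D i \<Longrightarrow>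
      \<exists>y\<in>V i. pairing y u \<le> pairing x u"
    by metis
  define T :: "qvec2 set" where "T = R \<times> {0} \<union> (\<Union>i\<le>pd_m D. V i \<times> {e_vec (pd_m D) i})"
  have "finite T" using R(1) V(1) by (auto simp: T_def)
  have "dual_monoid d D = {h \<in> coords {..<d} \<times> coords {1..pd_m D}. \<forall>t\<in>T. 0 \<le> pairing2 t h}" (is "_ = ?M")
  proof (intro equalityI subsetI)
    fix h assume "h \<in> dual_monoid d D"
    then have h: "fst h \<in> dual_weights d (pd_tail D)" "snd h \<in> coords {1..pd_m D}"
      "\<And>i x. i \<le> pd_m D \<Longrightarrow> x \<in> pd_coeff D i \<Longrightarrow> 0 \<le> pairing x (fst h) + of_int (e_coeff (pd_m D) i (snd h))"
      by (simp_all add: dual_monoid_iff[OF assms])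
    have "0 \<le> pairing2 t h" if "t \<in> T" for t
      using that unfolding T_def
    proof (elim UnE UN_E SigmaE)
      fix r z assume "r \<in> R" "z \<in> {0}" "t = (r, z)"
      then show ?thesis using h(1) R(2) by (auto simp: pairing2_def dual_weights_def)
    next
      fix i x z assume "i \<in> {..pd_m D}" "x \<in> V i" "z \<in> {e_vec (pd_m D) i}" "t = (x, z)"
      then show ?thesis using h(3)[of i x] V(2)[of i] by (auto simp: pairing2_def pairing_e_vec)
    qed
    then show "h \<in> ?M"
      using h(1,2) by (simp add: mem_Times_iff dual_weights_def)
  next
    fix h assume h: "h \<in> ?M"
    have "0 \<le> pairing r (fst h)" if "r \<in> R" for r
      using h that by (force simp: T_def pairing2_def)
    then have u: "fst h \<in> dual_weights d (pd_tail D)"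
      using R(3) h by (auto simp: dual_weights_def)
    have "0 \<le> pairing x (fst h) + of_int (e_coeff (pd_m D) i (snd h))"
      if i: "i \<le> pd_m D" "x \<in> pd_coeff D i" for i x
    proof -
      obtain y where y: "y \<in> V i" "pairing y (fst h) \<le> pairing x (fst h)" using V(3)[OF i(1) u i(2)] by blast
      then have "0 \<le> pairing2 (y, e_vec (pd_m D) i) h"
        using h i by (auto simp: T_def)
      with y(2) show ?thesis by (simp add: pairing2_def pairing_e_vec)
    qed
    then show "h \<in> dual_monoid d D"
      using u h by (auto simp: dual_monoid_iff[OF assms])
  qed
  then show ?thesis
    using lattice_points_finitely_generated[of "{..<d}" "{1..pd_m D}" T] \<open>finite T\<close> that by auto
qed

text \<open>Place \<open>\<Delta>\<^sub>i\<close> at height \<open>1\<close> over the \<open>i\<close>-th of \<open>m + 1\<close> independent unit vectors. If no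
  weight were positive on the sum of the coefficients, then by Farkas' lemma the sum of the unit
  vectors would lie in the resulting cone, that is, \<open>0\<close> would lie in the sum of the coefficients.
  The latter would then contain the whole tail cone.\<close>

lemma pdivisor_positive_weight:
  assumes D: "is_pdivisor d D" and ne: "\<And>i. i \<le> pd_m D \<Longrightarrow> pd_coeff D i \<noteq> {}"
  obtains u s where "u \<in> dual_weights d (pd_tail D)"
    "\<forall>i\<le>pd_m D. \<forall>x\<in>pd_coeff D i. s i \<le> pairing x u" "0 < (\<Sum>i\<le>pd_m D. s i)"
proof -
  let ?m = "pd_m D"
  have pc: "is_polyhedral_cone d (pd_tail D)"
    using D by (simp add: is_pdivisor_def)
  then obtain R where R: "finite R" "R \<subseteq> pd_tail D"
    "\<forall>u. (\<forall>r\<in>R. 0 \<le> pairing r u) \<longrightarrow> (\<forall>a\<in>pd_tail D. 0 \<le> pairing a u)"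
    by (rule polyhedral_cone_generators)
  obtain F0 where F0: "pd_tail D = {a \<in> coords {..<d}. \<forall>u\<in>F0. 0 \<le> pairing a u}"
    using pc by (auto simp: is_polyhedral_cone_def)
  have "\<exists>V. finite V \<and> V \<subseteq> pd_coeff D i \<and>
      (\<forall>u\<in>dual_weights d (pd_tail D). \<forall>x\<in>pd_coeff D i. \<exists>y\<in>V. pairing y u \<le> pairing x u)"
    if i: "i \<le> ?m" for i
  proof -
    obtain V where "finite V" "V \<subseteq> pd_coeff D i"
      "\<forall>u\<in>dual_weights d (pd_tail D). \<forall>x\<in>pd_coeff D i. \<exists>y\<in>V. pairing y u \<le> pairing x u"
      by (rule polyhedron_min_at_vertices[OF pdivisor_coeff(1)[OF D i ne[OF i]] ne[OF i],
            unfolded pdivisor_coeff(2)[OF D i ne[OF i]]])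
    then show ?thesis by blast
  qed
  then obtain V where V: "\<And>i. i \<le> ?m \<Longrightarrow> finite (V i)" "\<And>i. i \<le> ?m \<Longrightarrow> V i \<subseteq> pd_coeff D i"
    "\<And>i u x. i \<le> ?m \<Longrightarrow> u \<in> dual_weights d (pd_tail D) \<Longrightarrow> x \<in> pd_coeff D i \<Longrightarrow>
      \<exists>y\<in>V i. pairing y u \<le> pairing x u"
    by metis
  define P where "P = (\<lambda>i F. pd_coeff D i = {a \<in> coords {..<d}. \<forall>(u, b)\<in>F. b \<le> pairing a u})"
  define F where "F i = (SOME F. P i F)" for i
  have "\<exists>F. P i F" if "i \<le> ?m" for i
    using pdivisor_coeff(1)[OF D that ne[OF that]] unfolding is_polyhedron_def P_def by blast
  then have F: "pd_coeff D i = {a \<in> coords {..<d}. \<forall>(u, b)\<in>F i. b \<le> pairing a u}" if "i \<le> ?m" for i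
    using that someI_ex[of "P i"] by (simp add: F_def P_def)
  define G :: "qvec2 set" where "G = R \<times> {0} \<union> (\<Union>i\<le>?m. V i \<times> {single i 1})"
  have "finite G" using R(1) V(1) by (auto simp: G_def)
  define x0 :: qvec2 where "x0 = (0, \<Sum>i\<le>?m. single i 1)"
  have x0: "lookup (snd x0) i = 1" if "i \<le> ?m" for i
    using that by (simp add: x0_def lookup_sum lookup_single when_def)
  have "x0 \<notin> q_cone G"
  proof
    assume in_cone: "x0 \<in> q_cone G"
    have "\<exists>y a. y \<in> pd_tail D \<and> fst z = y + (\<Sum>i\<le>?m. a i) \<and>
        (\<forall>i\<le>?m. a i \<in> coords {..<d}) \<and>
        (\<forall>i\<le>?m. \<forall>(u, b)\<in>F i. b * lookup (snd z) i \<le> pairing (a i) u)"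
      if "z \<in> q_cone G" for z
      using that
    proof (induction rule: q_cone_induct_vec)
      case zero
      show ?case by (rule exI[of _ 0], rule exI[of _ "\<lambda>_. 0"]) (simp add: pdivisor_tail_0[OF D])
    next
      case (add s z c)
      then obtain y a where ya: "y \<in> pd_tail D" "fst z = y + (\<Sum>i\<le>?m. a i)"
        "\<And>i. i \<le> ?m \<Longrightarrow> a i \<in> coords {..<d}"
        "\<And>i u b. i \<le> ?m \<Longrightarrow> (u, b) \<in> F i \<Longrightarrow> b * lookup (snd z) i \<le> pairing (a i) u"
        by fast
      from \<open>s \<in> G\<close> consider "fst s \<in> pd_tail D" "snd s = 0"
        | j where "j \<le> ?m" "fst s \<in> pd_coeff D j" "snd s = single j 1"
        unfolding G_def using R(2) V(2) by (auto simp del: single_one) blast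
      then show ?case
      proof cases
        case 1
        have "pm_scale c (fst s) + y \<in> pd_tail D"
          using 1 ya(1) \<open>0 \<le> c\<close> unfolding F0
          by (auto simp: pairing_add_left pairing_pm_scale_left intro!: coords_add coords_pm_scale)
        then show ?thesis
          using 1 ya by (intro exI[of _ "pm_scale c (fst s) + y"] exI[of _ a])
            (auto simp: scale2_def add.assoc)
      next
        case 2
        define a' where "a' = (\<lambda>i. a i + (if i = j then pm_scale c (fst s) else 0))"
        have s: "fst s \<in> coords {..<d}" "\<And>u b. (u, b) \<in> F j \<Longrightarrow> b \<le> pairing (fst s) u"
          using 2(2) F[OF 2(1)] by auto
        have "(\<Sum>i\<le>?m. a' i) = (\<Sum>i\<le>?m. a i) + pm_scale c (fst s)"
          using 2(1) by (simp add: a'_def sum.distrib)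
        then have "fst (scale2 c s + z) = y + (\<Sum>i\<le>?m. a' i)"
          by (simp add: scale2_def ya(2) algebra_simps)
        moreover have "a' i \<in> coords {..<d}" if "i \<le> ?m" for i
          using ya(3)[OF that] s(1) by (auto simp: a'_def intro!: coords_add coords_pm_scale)
        moreover have "b * lookup (snd (scale2 c s + z)) i \<le> pairing (a' i) u"
          if i: "i \<le> ?m" "(u, b) \<in> F i" for i u b
        proof -
          have "b * (if i = j then c else 0) \<le> pairing (if i = j then pm_scale c (fst s) else 0) u"
            using s(2)[of u b] i \<open>0 \<le> c\<close> by (auto simp: pairing_pm_scale_left mult.commute[of b] intro: mult_left_mono)
          moreover have "lookup (snd (scale2 c s + z)) i = (if i = j then c else 0) + lookup (snd z) i"
            using 2(3) by (simp add: scale2_def lookup_add lookup_pm_scale lookup_single when_def)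
          ultimately show ?thesis
            using ya(4)[OF i] unfolding a'_def pairing_add_left by (simp only: distrib_left)
        qed
        ultimately show ?thesis using ya(1) by blast
      qed
    qed
    from this[OF in_cone] obtain y a where ya: "y \<in> pd_tail D" "fst x0 = y + (\<Sum>i\<le>?m. a i)"
      "\<And>i. i \<le> ?m \<Longrightarrow> a i \<in> coords {..<d}"
      "\<And>i. i \<le> ?m \<Longrightarrow> \<forall>(u, b)\<in>F i. b * lookup (snd x0) i \<le> pairing (a i) u"
      by blast
    have a: "a i \<in> pd_coeff D i" if "i \<le> ?m" for i
      using F[OF that] ya(3,4)[OF that] by (simp add: x0[OF that])
    let ?S = "{\<Sum>i\<le>?m. a i | a. \<forall>i\<le>?m. a i \<in> pd_coeff D i}"
    have "pd_tail D \<subseteq> ?S"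
    proof
      fix t assume t: "t \<in> pd_tail D"
      define b where "b = (\<lambda>i. a i + (if i = 0 then y + t else 0))"
      have "(\<Sum>i\<le>?m. b i) = (\<Sum>i\<le>?m. a i) + (y + t)"
        by (simp add: b_def sum.distrib)
      also have "\<dots> = t" using ya(2) by (simp add: x0_def algebra_simps)
      finally have "t = (\<Sum>i\<le>?m. b i)" ..
      moreover have "b i \<in> pd_coeff D i" if "i \<le> ?m" for i
        using pdivisor_coeff_add_tail[OF D that pdivisor_coeff_add_tail[OF D that a[OF that] ya(1)] t] a[OF that]
        by (auto simp: b_def add.assoc)
      ultimately show "t \<in> ?S" by blast
    qed
    moreover have "?S \<subset> pd_tail D" using D by (simp add: is_pdivisor_def)
    ultimately show False by blast
  qed
  then obtain y where y: "\<And>g. g \<in> G \<Longrightarrow> 0 \<le> dot2 g y" "dot2 x0 y < 0"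
    using cone_separation[OF \<open>finite G\<close>] by blast
  \<comment> \<open>Only the coordinates below \<open>d\<close> are characters; the others do not affect the pairing.\<close>
  define w where "w = (\<Sum>i<d. single i (lookup (fst y) i))"
  have w: "w \<in> coords {..<d}"
    unfolding w_def by (intro coords_sum coords_single) auto
  have dot_w: "dot x w = dot x (fst y)" if "x \<in> coords {..<d}" for x
    unfolding dot_def
    by (rule sum.cong) (use that in \<open>auto simp: w_def lookup_sum lookup_single when_def coords_def\<close>)
  obtain n u where nu: "n > 0" "rat_vec u = pm_scale (of_int n) w" "keys u \<subseteq> keys w"
    by (rule integral_multiple)
  have pu: "pairing x u = of_int n * dot x (fst y)" if "x \<in> coords {..<d}" for x
    using that by (simp add: nu(2) dot_pm_scale_right dot_w flip: dot_rat_vec)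
  have u: "u \<in> coords {..<d}"
    using nu(3) w by (auto simp: coords_def)
  have "0 \<le> pairing r u" if "r \<in> R" for r
  proof -
    have "r \<in> coords {..<d}" using that R(2) F0 by auto
    moreover have "0 \<le> dot r (fst y)" using y(1)[of "(r, 0)"] that by (simp add: G_def dot2_def)
    ultimately show ?thesis using nu(1) by (simp add: pu)
  qed
  then have u_dual: "u \<in> dual_weights d (pd_tail D)"
    using u R(3) by (auto simp: dual_weights_def)
  define s where "s i = - of_int n * lookup (snd y) i" for i
  show ?thesis
  proof (rule that[OF u_dual, of s], safe)
    fix i x assume i: "i \<le> ?m" and x: "x \<in> pd_coeff D i"
    obtain v where v: "v \<in> V i" "pairing v u \<le> pairing x u" using V(3)[OF i u_dual x] by blast
    have "0 \<le> dot2 (v, single i 1) y"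
      using v(1) i by (intro y(1)) (auto simp: G_def)
    then have "- lookup (snd y) i \<le> dot v (fst y)"
      by (simp add: dot2_def dot_single)
    then have "of_int n * - lookup (snd y) i \<le> of_int n * dot v (fst y)"
      using nu(1) by (intro mult_left_mono) auto
    moreover have "v \<in> coords {..<d}" using V(2)[OF i] v(1) F[OF i] by auto
    ultimately show "s i \<le> pairing x u"
      using v(2) by (simp add: s_def pu)
  next
    have "dot2 x0 y = (\<Sum>i\<le>?m. lookup (snd y) i)"
    proof -
      have "dot (\<Sum>i\<le>?m. single i 1) (snd y) = (\<Sum>i\<le>?m. dot (single i 1) (snd y))"
        by (simp only: dot_commute[where b = "snd y"] dot_sum_right)
      then show ?thesis by (simp add: dot2_def x0_def dot_single del: single_one)
    qed
    then show "0 < (\<Sum>i\<le>?m. s i)"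
      using y(2) nu(1) by (simp add: s_def sum_negf mult_pos_neg flip: sum_distrib_left)
  qed
qed

section \<open>Rational functions on the projective line\<close>

lemma ord_poly_mult: "a \<noteq> 0 \<Longrightarrow> b \<noteq> 0 \<Longrightarrow> ord_poly Q (a * b) = ord_poly Q a + ord_poly Q b"
  by (auto simp: ord_poly_def order_mult degree_mult_eq split: option.splits)

lemma ord_at_Fract:
  assumes "a \<noteq> 0" "b \<noteq> 0"
  shows "ord_at Q (Fract a b) = ord_poly Q a - ord_poly Q b"
  unfolding ord_at_def
proof (rule the_equality)
  fix n assume "\<exists>a' b'. a' \<noteq> 0 \<and> b' \<noteq> 0 \<and> Fract a b = Fract a' b' \<and> n = ord_poly Q a' - ord_poly Q b'"
  then obtain a' b' where n: "a' \<noteq> 0" "b' \<noteq> 0" "Fract a b = Fract a' b'" "n = ord_poly Q a' - ord_poly Q b'"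
    by blast
  then have "ord_poly Q (a * b') = ord_poly Q (a' * b)"
    using assms by (simp add: eq_fract)
  then show "n = ord_poly Q a - ord_poly Q b"
    using n assms by (simp add: ord_poly_mult)
qed (use assms in blast)

lemma fract_nonzero_cases:
  fixes f :: "'a::idom fract"
  assumes "f \<noteq> 0"
  obtains a b where "a \<noteq> 0" "b \<noteq> 0" "f = Fract a b"
  using assms by (cases f rule: Fract_cases_nonzero) auto

lemma ord_at_mult: "f \<noteq> 0 \<Longrightarrow> g \<noteq> 0 \<Longrightarrow> ord_at Q (f * g) = ord_at Q f + ord_at Q g"
  by (elim fract_nonzero_cases) (simp add: ord_at_Fract ord_poly_mult)

lemma ord_at_to_fract: "a \<noteq> 0 \<Longrightarrow> ord_at Q (to_fract a) = ord_poly Q a"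
  unfolding to_fract_def by (simp add: ord_at_Fract) (simp add: ord_poly_def order_0I split: option.splits)

lemma ord_at_1 [simp]: "ord_at Q 1 = 0"
  using ord_at_mult[of 1 1 Q] by simp

lemma ord_at_inverse: "f \<noteq> 0 \<Longrightarrow> ord_at Q (inverse f) = - ord_at Q f"
  using ord_at_mult[of f "inverse f" Q] by simp

lemma ord_at_power: "f \<noteq> 0 \<Longrightarrow> ord_at Q (f ^ n) = int n * ord_at Q f"
  by (induction n) (auto simp: ord_at_mult algebra_simps)

lemma ord_at_powi: "f \<noteq> 0 \<Longrightarrow> ord_at Q (f powi k) = k * ord_at Q f"
  by (simp add: power_int_def ord_at_power ord_at_inverse)

lemma ord_at_prod:
  "(\<And>i. i \<in> I \<Longrightarrow> f i \<noteq> 0) \<Longrightarrow> ord_at Q (\<Prod>i\<in>I. f i) = (\<Sum>i\<in>I. ord_at Q (f i))"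
  by (induction I rule: infinite_finite_induct) (auto simp: ord_at_mult)

lemma ord_poly_ge: "a \<noteq> 0 \<Longrightarrow> degree a \<le> N \<Longrightarrow> - (if Q = None then int N else 0) \<le> ord_poly Q a"
  by (auto simp: ord_poly_def split: option.splits)

text \<open>Every root of the denominator is also one of the numerator and can be cancelled.\<close>

lemma regular_on_affine_line:
  fixes f :: "'k::alg_closed_field poly fract"
  assumes "f \<noteq> 0" "\<And>c. 0 \<le> ord_at (Some c) f"
  obtains p where "p \<noteq> 0" "f = to_fract p"
proof -
  have "\<exists>p. p \<noteq> 0 \<and> Fract a b = to_fract p"
    if "a \<noteq> 0" "b \<noteq> 0" "\<forall>c. Polynomial.order c b \<le> Polynomial.order c a" for a b :: "'k poly"
    using that
  proof (induction "degree b" arbitrary: a b rule: less_induct)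
    case less
    show ?case
    proof (cases "degree b = 0")
      case True
      then obtain c where c: "b = [:c:]" "c \<noteq> 0"
        using less.prems by (auto elim: degree_eq_zeroE)
      then have "Fract a b = to_fract (smult (1 / c) a)"
        unfolding to_fract_def by (simp add: eq_fract)
      then show ?thesis using less.prems c by (intro exI[of _ "smult (1 / c) a"]) simp
    next
      case False
      then obtain c where "poly b c = 0"
        using alg_closed_imp_poly_has_root by blast
      then have "Polynomial.order c b > 0" using less.prems by (simp add: order_gt_0_iff)
      then have "poly a c = 0"
        using less.prems by (metis gr0I not_le order_gt_0_iff)
      then obtain a' b' where ab: "a = [:- c, 1:] * a'" "b = [:- c, 1:] * b'"
        using \<open>poly b c = 0\<close> by (auto simp: poly_eq_0_iff_dvd elim!: dvdE)
      then have nz: "a' \<noteq> 0" "b' \<noteq> 0" using less.prems by auto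
      have "degree b' < degree b"
        using nz by (simp add: ab degree_mult_eq del: mult_pCons_left)
      moreover have "Polynomial.order x b' \<le> Polynomial.order x a'" for x
        using less.prems(3)[rule_format, of x] less.prems(1,2) unfolding ab
        by (simp add: order_mult del: mult_pCons_left)
      ultimately obtain p where "p \<noteq> 0" "Fract a' b' = to_fract p"
        using less.hyps nz by blast
      moreover have "Fract a b = Fract a' b'"
        unfolding ab by (rule mult_fract_cancel) simp
      ultimately show ?thesis by auto
    qed
  qed
  moreover obtain a b where ab: "a \<noteq> 0" "b \<noteq> 0" "f = Fract a b"
    using assms(1) by (rule fract_nonzero_cases)
  moreover have "Polynomial.order c b \<le> Polynomial.order c a" for c
    using assms(2)[of c] ab by (simp add: ord_at_Fract ord_poly_def)
  ultimately show ?thesis using that by blast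
qed

text \<open>The order of a dehomogenized linear form is that of the form corrected by a simple pole at
  infinity.\<close>

lemma ord_poly_linear_form:
  assumes "is_linear_embedding D lf" "i \<le> pd_m D"
  shows "ord_poly Q (lf i) = (if pd_point D i = Q then 1 else 0) - (if Q = None then 1 else 0)"
proof -
  have lf: "lf i \<noteq> 0" "degree (lf i) \<le> 1"
    "case pd_point D i of Some c \<Rightarrow> poly (lf i) c = 0 | None \<Rightarrow> degree (lf i) = 0"
    using assms unfolding is_linear_embedding_def by blast+
  show ?thesis
  proof (cases "pd_point D i")
    case None
    then have "degree (lf i) = 0" using lf by simp
    then obtain c where "lf i = [:c:]" "c \<noteq> 0" using lf(1) by (auto elim: degree_eq_zeroE)
    then show ?thesis using None by (auto simp: ord_poly_def order_0I split: option.splits)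
  next
    case (Some c)
    then have "[:- c, 1:] dvd lf i" using lf(3) by (simp add: poly_eq_0_iff_dvd)
    then obtain q where q: "lf i = [:- c, 1:] * q" by (elim dvdE)
    then have "q \<noteq> 0" using lf(1) by auto
    then have "degree q = 0" using lf(2) by (simp add: q degree_mult_eq del: mult_pCons_left)
    then obtain e where e: "q = [:e:]" "e \<noteq> 0" using \<open>q \<noteq> 0\<close> by (auto elim: degree_eq_zeroE)
    then have lfe: "lf i = smult e [:- c, 1:]" by (simp add: q)
    have "Polynomial.order x [:- c, 1:] = (if x = c then 1 else 0)" for x
      using order_power_n_n[of c 1] by (auto intro: order_0I)
    then have "Polynomial.order x (lf i) = (if x = c then 1 else 0)" for x
      unfolding lfe using order_smult[OF e(2)] by metis
    moreover have "degree (lf i) = 1" using e(2) by (simp add: lfe)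
    ultimately show ?thesis using Some by (auto simp: ord_poly_def split: option.splits)
  qed
qed

lemma linear_embedding_nonzero: "is_linear_embedding D lf \<Longrightarrow> i \<le> pd_m D \<Longrightarrow> lf i \<noteq> 0"
  by (simp add: is_linear_embedding_def)

lemma linear_embedding_exists: "\<exists>lf. is_linear_embedding D lf"
  by (rule exI[of _ "\<lambda>i. case pd_point D i of Some c \<Rightarrow> [:- c, 1:] | None \<Rightarrow> 1"])
    (auto simp: is_linear_embedding_def split: option.splits)

text \<open>Products of powers of the linear forms. If the exponents sum to zero, this is a function on
  the line, namely a monomial in the \<open>y\<^sub>i / y\<^sub>0\<close>.\<close>

definition form_monomial :: "nat \<Rightarrow> (nat \<Rightarrow> 'k::field poly) \<Rightarrow> (nat \<Rightarrow> int) \<Rightarrow> 'k poly fract" where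
  "form_monomial m lf k = (\<Prod>i\<le>m. to_fract (lf i) powi k i)"

lemma form_monomial_nonzero:
  "is_linear_embedding D lf \<Longrightarrow> form_monomial (pd_m D) lf k \<noteq> 0"
  by (auto simp: form_monomial_def linear_embedding_nonzero)

lemma form_monomial_add:
  assumes "is_linear_embedding D lf"
  shows "form_monomial (pd_m D) lf (\<lambda>i. k i + l i) = form_monomial (pd_m D) lf k * form_monomial (pd_m D) lf l"
  unfolding form_monomial_def prod.distrib[symmetric]
  by (rule prod.cong) (use assms in \<open>auto simp: power_int_add linear_embedding_nonzero\<close>)

lemma ord_at_form_monomial:
  assumes "is_linear_embedding D lf"
  shows "ord_at Q (form_monomial (pd_m D) lf k) =
    (\<Sum>i | i \<le> pd_m D \<and> pd_point D i = Q. k i) - (if Q = None then \<Sum>i\<le>pd_m D. k i else 0)"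
proof -
  have "ord_at Q (form_monomial (pd_m D) lf k) =
      (\<Sum>i\<le>pd_m D. k i * ((if pd_point D i = Q then 1 else 0) - (if Q = None then 1 else 0)))"
    unfolding form_monomial_def
    by (subst ord_at_prod)
      (use assms in \<open>auto simp: linear_embedding_nonzero ord_at_powi ord_at_to_fract ord_poly_linear_form[OF assms]\<close>)
  also have "\<dots> = (\<Sum>i\<le>pd_m D. if pd_point D i = Q then k i else 0) - (\<Sum>i\<le>pd_m D. if Q = None then k i else 0)"
    unfolding sum_subtractf[symmetric] by (rule sum.cong) auto
  also have "(\<Sum>i\<le>pd_m D. if pd_point D i = Q then k i else 0) = (\<Sum>i | i \<le> pd_m D \<and> pd_point D i = Q. k i)"
    by (subst sum.inter_filter[symmetric]) auto
  finally show ?thesis by auto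
qed

lemma point_fibre:
  assumes "is_pdivisor d D" "i \<le> pd_m D"
  shows "{j. j \<le> pd_m D \<and> pd_point D j = pd_point D i} = {i}"
  using assms by (auto simp: is_pdivisor_def dest: inj_onD)

lemma ord_at_form_monomial_point:
  assumes "is_linear_embedding D lf" "is_pdivisor d D" "i \<le> pd_m D"
  shows "ord_at (pd_point D i) (form_monomial (pd_m D) lf k) =
    k i - (if pd_point D i = None then \<Sum>i\<le>pd_m D. k i else 0)"
  unfolding ord_at_form_monomial[OF assms(1)] point_fibre[OF assms(2,3)] by simp

lemma ord_at_form_monomial_other:
  assumes "is_linear_embedding D lf" "Q \<notin> pd_point D ` {..pd_m D}"
  shows "ord_at Q (form_monomial (pd_m D) lf k) = - (if Q = None then \<Sum>i\<le>pd_m D. k i else 0)"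
proof -
  have "{j. j \<le> pd_m D \<and> pd_point D j = Q} = {}" using assms(2) by auto
  then show ?thesis unfolding ord_at_form_monomial[OF assms(1)] by (simp only:) simp
qed

lemma sum_e_coeff: "(\<Sum>i\<le>m. e_coeff m i b) = 0"
proof -
  have "(\<Sum>i\<le>m. e_coeff m i b) = e_coeff m 0 b + (\<Sum>i\<in>{..m} - {0}. e_coeff m i b)"
    by (rule sum.remove) auto
  also have "{..m} - {0} = {1..m}" by auto
  also have "(\<Sum>i\<in>{1..m}. e_coeff m i b) = (\<Sum>i\<in>{1..m}. lookup b i)"
    by (rule sum.cong) (auto simp: e_coeff_def)
  finally show ?thesis by (simp add: e_coeff_def)
qed

lemma prod_power_int_exponent: "(x::'a::field) \<noteq> 0 \<Longrightarrow> (\<Prod>j\<in>I. x powi k j) = x powi (\<Sum>j\<in>I. k j)"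
  by (induction I rule: infinite_finite_induct) (auto simp: power_int_add)

lemma zmon_eq_form_monomial:
  assumes "is_linear_embedding D lf"
  shows "zmon (pd_m D) lf b = form_monomial (pd_m D) lf (\<lambda>i. e_coeff (pd_m D) i b)"
proof -
  let ?m = "pd_m D" let ?l = "\<lambda>i. to_fract (lf i)"
  have nz: "?l i \<noteq> 0" if "i \<le> ?m" for i using linear_embedding_nonzero[OF assms that] by simp
  have "zmon ?m lf b = (\<Prod>j=1..?m. ?l j powi lookup b j * ?l 0 powi (- lookup b j))"
    unfolding zmon_def Fract_conv_to_fract
    by (rule prod.cong) (auto simp: power_int_mult_distrib power_int_inverse power_int_minus divide_inverse)
  also have "\<dots> = (\<Prod>j=1..?m. ?l j powi lookup b j) * ?l 0 powi (- (\<Sum>j=1..?m. lookup b j))"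
    by (simp only: prod.distrib prod_power_int_exponent[OF nz[of 0, OF le0]] sum_negf)
  also have "(\<Prod>j=1..?m. ?l j powi lookup b j) = (\<Prod>j=1..?m. ?l j powi e_coeff ?m j b)"
    by (rule prod.cong) (auto simp: e_coeff_def)
  also have "\<dots> * ?l 0 powi (- (\<Sum>j=1..?m. lookup b j)) = (\<Prod>j\<in>{..?m}. ?l j powi e_coeff ?m j b)"
  proof -
    have "{..?m} - {0} = {1..?m}" by auto
    then show ?thesis
      using prod.remove[of "{..?m}" 0 "\<lambda>j. ?l j powi e_coeff ?m j b"] by (simp add: e_coeff_def mult.commute)
  qed
  finally show ?thesis by (simp add: form_monomial_def)
qed

lemma zmon_nonzero: "is_linear_embedding D lf \<Longrightarrow> zmon (pd_m D) lf b \<noteq> 0"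
  by (simp add: zmon_eq_form_monomial form_monomial_nonzero)

lemma zmon_add:
  "is_linear_embedding D lf \<Longrightarrow> zmon (pd_m D) lf (b + c) = zmon (pd_m D) lf b * zmon (pd_m D) lf c"
  by (simp add: zmon_eq_form_monomial e_coeff_add form_monomial_add)

lemma zmon_0 [simp]: "zmon m lf 0 = 1"
  by (simp add: zmon_def)

lemma ord_at_zmon_point:
  assumes "is_linear_embedding D lf" "is_pdivisor d D" "i \<le> pd_m D"
  shows "ord_at (pd_point D i) (zmon (pd_m D) lf b) = e_coeff (pd_m D) i b"
  by (simp add: zmon_eq_form_monomial[OF assms(1)] ord_at_form_monomial_point[OF assms] sum_e_coeff)

lemma ord_at_zmon_other:
  assumes "is_linear_embedding D lf" "Q \<notin> pd_point D ` {..pd_m D}"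
  shows "ord_at Q (zmon (pd_m D) lf b) = 0"
  by (simp add: zmon_eq_form_monomial[OF assms(1)] ord_at_form_monomial_other[OF assms] sum_e_coeff)

text \<open>The coefficient at \<open>0\<close> is determined by the others, as \<open>e\<^sub>0 = - \<Sum> e\<^sub>j\<close>.\<close>

lemma exponent_vector:
  assumes "(\<Sum>i\<le>m. k i) = 0"
  obtains b where "b \<in> coords {1..m}" "\<And>i. i \<le> m \<Longrightarrow> e_coeff m i b = k i"
proof
  define b where "b = (\<Sum>j=1..m. single j (k j))"
  show "b \<in> coords {1..m}" unfolding b_def by (intro coords_sum coords_single)
  have lb: "lookup b j = (if 1 \<le> j \<and> j \<le> m then k j else 0)" for j
    by (auto simp: b_def lookup_sum lookup_single when_def)
  have eq: "e_coeff m i b = k i" if "1 \<le> i" "i \<le> m" for i using that by (simp add: e_coeff_def lb)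
  have "(\<Sum>i\<le>m. k i) = k 0 + (\<Sum>j=1..m. k j)"
  proof -
    have "{..m} - {0} = {1..m}" by auto
    then show ?thesis using sum.remove[of "{..m}" 0 k] by simp
  qed
  moreover have "e_coeff m 0 b = - (\<Sum>j=1..m. k j)" by (simp add: e_coeff_def lb)
  ultimately have "e_coeff m 0 b = k 0" using assms by simp
  with eq show "e_coeff m i b = k i" if "i \<le> m" for i using that by (cases "i = 0") auto
qed

text \<open>Subtracting a multiple of a power of the second linear form makes a form vanish at the zero of
  the first one, by which it can then be divided. So the monomials in the two forms span.\<close>

lemma binary_form_expansion:
  assumes lf: "is_linear_embedding D lf" and D: "is_pdivisor d D"
    and ij: "i \<le> pd_m D" "j \<le> pd_m D" "i \<noteq> j" and q: "degree q \<le> N"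
  obtains c where "q = (\<Sum>a\<le>N. smult (c a) (lf i ^ a * lf j ^ (N - a)))"
proof -
  have P: "pd_point D i \<noteq> pd_point D j"
    using D ij by (auto simp: is_pdivisor_def dest: inj_onD)
  have lfi: "lf i \<noteq> 0" "degree (lf i) \<le> 1"
      "case pd_point D i of Some c \<Rightarrow> poly (lf i) c = 0 | None \<Rightarrow> degree (lf i) = 0"
    and lfj: "lf j \<noteq> 0" "degree (lf j) \<le> 1"
    using lf ij unfolding is_linear_embedding_def by blast+
  have "\<exists>c. q = (\<Sum>a\<le>N. smult (c a) (lf i ^ a * lf j ^ (N - a)))"
    using q
  proof (induction N arbitrary: q)
    case 0
    then obtain e where "q = [:e:]" by (auto elim: degree_eq_zeroE)
    then show ?case by (intro exI[of _ "\<lambda>_. e"]) simp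
  next
    case (Suc N)
    have "\<exists>e q'. q - smult e (lf j ^ Suc N) = lf i * q' \<and> degree q' \<le> N"
    proof (cases "pd_point D i")
      case (Some c)
      have "ord_poly (Some c) (lf j) = 0"
        using P Some by (auto simp: ord_poly_linear_form[OF lf ij(2)])
      then have pj: "poly (lf j) c \<noteq> 0"
        using lfj(1) by (simp add: ord_poly_def order_eq_0_iff)
      \<comment> \<open>Chosen to make the difference below vanish at the zero of \<open>lf i\<close>.\<close>
      define e where "e = poly q c / poly (lf j) c ^ Suc N"
      let ?p = "q - smult e (lf j ^ Suc N)"
      have "poly ?p c = 0" using pj by (simp add: e_def)
      then obtain p' where p': "?p = [:- c, 1:] * p'" by (metis poly_eq_0_iff_dvd dvdE)
      have "poly (lf i) c = 0" using lfi(3) Some by simp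
      then obtain l' where l': "lf i = [:- c, 1:] * l'" by (metis poly_eq_0_iff_dvd dvdE)
      have "l' \<noteq> 0" using lfi(1) l' by auto
      then have "degree l' = 0" using lfi(2) by (simp add: l' degree_mult_eq del: mult_pCons_left)
      then obtain x where x: "l' = [:x:]" "x \<noteq> 0" using \<open>l' \<noteq> 0\<close> by (auto elim: degree_eq_zeroE)
      have "?p = lf i * smult (1 / x) p'"
      proof -
        have "lf i = smult x [:- c, 1:]" using l' x(1) by simp
        then show ?thesis
          using x(2) unfolding p' by (simp only: mult_smult_left mult_smult_right smult_smult) simp
      qed
      moreover have "degree (smult (1 / x) p') \<le> N"
      proof (cases "p' = 0")
        case False
        have "degree (lf j ^ Suc N) \<le> Suc N * 1"
          using lfj(2) degree_power_le[of "lf j" "Suc N"] by (metis mult.commute mult_le_mono2 order_trans)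
        then have "degree (smult e (lf j ^ Suc N)) \<le> Suc N"
          using degree_smult_le order_trans by (metis mult.right_neutral)
        then have "degree ?p \<le> Suc N"
          using Suc.prems by (rule degree_diff_le[rotated])
        moreover have "degree ?p = Suc (degree p')"
          using False unfolding p' by (simp add: degree_mult_eq del: mult_pCons_left)
        ultimately show ?thesis using x(2) by simp
      qed simp
      ultimately show ?thesis by blast
    next
      case None
      have "ord_poly None (lf j) = -1"
        using P None by (auto simp: ord_poly_linear_form[OF lf ij(2)])
      then have dj: "degree (lf j) = 1" by (simp add: ord_poly_def)
      have degp: "degree (lf j ^ Suc N) = Suc N" using dj by (metis degree_power_eq lfj(1) mult.right_neutral)
      \<comment> \<open>Vanishing at infinity means a drop of the degree.\<close>
      define e where "e = coeff q (Suc N) / lead_coeff (lf j ^ Suc N)"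
      let ?p = "q - smult e (lf j ^ Suc N)"
      have "lead_coeff (lf j ^ Suc N) \<noteq> 0" using lfj(1) by simp
      then have "coeff ?p (Suc N) = 0"
        unfolding coeff_diff coeff_smult e_def degp by simp
      moreover have "degree ?p \<le> Suc N"
        using Suc.prems degp degree_smult_le[of e "lf j ^ Suc N"] by (intro degree_diff_le) auto
      ultimately have "degree ?p \<le> N"
        by (metis coeff_eq_0 le_degree leading_coeff_0_iff le_SucE degree_0 le0)
      obtain x where x: "lf i = [:x:]" "x \<noteq> 0"
        using lfi None by (auto elim: degree_eq_zeroE)
      have "?p = lf i * smult (1 / x) ?p" using x by simp
      moreover have "degree (smult (1 / x) ?p) \<le> N" using \<open>degree ?p \<le> N\<close> x by simp
      ultimately show ?thesis by blast
    qed
    then obtain e q' where e: "q - smult e (lf j ^ Suc N) = lf i * q'" "degree q' \<le> N" by blast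
    from Suc.IH[OF e(2)] obtain c where c: "q' = (\<Sum>a\<le>N. smult (c a) (lf i ^ a * lf j ^ (N - a)))" by blast
    define c' where "c' a = (case a of 0 \<Rightarrow> e | Suc a \<Rightarrow> c a)" for a
    have "q = smult e (lf j ^ Suc N) + lf i * q'" using e(1) by (simp add: algebra_simps)
    also have "lf i * q' = (\<Sum>a\<le>N. smult (c' (Suc a)) (lf i ^ Suc a * lf j ^ (Suc N - Suc a)))"
      by (simp add: c sum_distrib_left c'_def mult.assoc)
    also have "smult e (lf j ^ Suc N) + \<dots> = (\<Sum>a\<le>Suc N. smult (c' a) (lf i ^ a * lf j ^ (Suc N - a)))"
      using sum.atMost_Suc_shift[of "\<lambda>a. smult (c' a) (lf i ^ a * lf j ^ (Suc N - a))" N]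
      by (simp add: c'_def)
    finally show ?case by blast
  qed
  then show ?thesis using that by blast
qed

section \<open>Sections of the divisors of a polyhedral divisor\<close>

lemma sections_nonzero_iff:
  "f \<noteq> 0 \<Longrightarrow> f \<in> sections D u \<longleftrightarrow>
    (\<forall>i\<le>pd_m D. pd_coeff D i \<noteq> {} \<longrightarrow> 0 \<le> ord_at (pd_point D i) f + \<lfloor>min_pairing (pd_coeff D i) u\<rfloor>) \<and>
    (\<forall>Q. Q \<notin> pd_point D ` {..pd_m D} \<longrightarrow> 0 \<le> ord_at Q f)"
  by (simp add: sections_def)

lemma zmon_in_sections:
  assumes "is_linear_embedding D lf" "is_pdivisor d D" "h \<in> dual_monoid d D"
  shows "zmon (pd_m D) lf (snd h) \<in> sections D (fst h)"
proof -
  have h: "fst h \<in> dual_weights d (pd_tail D)"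
    "\<And>i x. i \<le> pd_m D \<Longrightarrow> x \<in> pd_coeff D i \<Longrightarrow> 0 \<le> pairing x (fst h) + of_int (e_coeff (pd_m D) i (snd h))"
    using assms(3) by (auto simp: dual_monoid_iff[OF assms(2)])
  have "0 \<le> e_coeff (pd_m D) i (snd h) + \<lfloor>min_pairing (pd_coeff D i) (fst h)\<rfloor>"
    if i: "i \<le> pd_m D" "pd_coeff D i \<noteq> {}" for i
  proof -
    obtain x where x: "x \<in> pd_coeff D i" "min_pairing (pd_coeff D i) (fst h) = pairing x (fst h)"
      using min_pairing_attained[OF assms(2) i h(1)] by blast
    have "of_int (- e_coeff (pd_m D) i (snd h)) \<le> pairing x (fst h)"
      using h(2)[OF i(1) x(1)] by simp
    then have "- e_coeff (pd_m D) i (snd h) \<le> \<lfloor>pairing x (fst h)\<rfloor>"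
      by (simp only: le_floor_iff)
    then show ?thesis by (simp add: x(2))
  qed
  then show ?thesis
    using zmon_nonzero[OF assms(1)]
    by (simp add: sections_nonzero_iff ord_at_zmon_point[OF assms(1,2)] ord_at_zmon_other[OF assms(1)])
qed

text \<open>Clearing the zeros and poles of a section at the points of the divisor leaves a binary form,
  whose expansion in two of the linear forms, one of them vanishing at \<open>P\<^sub>i\<close>, expresses the section
  by monomials of increasing order at \<open>P\<^sub>i\<close>.\<close>

lemma section_expansion:
  fixes f :: "'k::alg_closed_field poly fract"
  assumes lf: "is_linear_embedding D lf" and D: "is_pdivisor d D" and i: "i \<le> pd_m D"
    and u: "u \<in> dual_weights d (pd_tail D)" and f: "f \<in> sections D u" "f \<noteq> 0"
  obtains N c b where
    "\<And>a. a \<le> N \<Longrightarrow> (u, b a) \<in> dual_monoid d D"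
    "\<And>a. a \<le> N \<Longrightarrow> e_coeff (pd_m D) i (b a) = ord_at (pd_point D i) f + int a"
    "f = (\<Sum>a\<le>N. to_fract [:c a:] * zmon (pd_m D) lf (b a))"
proof -
  let ?m = "pd_m D" let ?P = "pd_point D"
  \<comment> \<open>\<open>k\<close> clears the zeros and poles at the points, and \<open>K\<close> is the number of the remaining zeros,
    hence the degree of the form that is left.\<close>
  define k where "k l = - ord_at (?P l) f" for l
  define K where "K = (\<Sum>l\<le>?m. k l)"
  define g where "g = f * form_monomial ?m lf k"
  have g: "g \<noteq> 0" using f(2) form_monomial_nonzero[OF lf] by (simp add: g_def)
  have ord_g: "ord_at Q g = ord_at Q f + ord_at Q (form_monomial ?m lf k)" for Q
    using f(2) form_monomial_nonzero[OF lf] by (simp add: g_def ord_at_mult)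
  have ord_g_ge: "- (if Q = None then K else 0) \<le> ord_at Q g" for Q
  proof (cases "Q \<in> ?P ` {..?m}")
    case True
    then obtain l where l: "l \<le> ?m" "Q = ?P l" by auto
    show ?thesis unfolding ord_g l(2) ord_at_form_monomial_point[OF lf D l(1)] by (simp add: k_def K_def)
  next
    case False
    then have "0 \<le> ord_at Q f" using f by (auto simp: sections_nonzero_iff)
    then show ?thesis unfolding ord_g ord_at_form_monomial_other[OF lf False]
      by (cases "Q = None") (auto simp: K_def)
  qed
  have "0 \<le> ord_at (Some c) g" for c
    using ord_g_ge[of "Some c"] by simp
  then obtain q where q: "q \<noteq> 0" "g = to_fract q"
    using regular_on_affine_line[OF g] by blast
  have "int (degree q) \<le> K"
    using ord_g_ge[of None] q by (simp add: ord_at_to_fract ord_poly_def)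
  define N where "N = nat K"
  have N: "int N = K" "degree q \<le> N" using \<open>int (degree q) \<le> K\<close> by (auto simp: N_def)
  have "\<exists>j\<le>?m. j \<noteq> i" using D by (intro exI[of _ "if i = 0 then 1 else 0"]) (auto simp: is_pdivisor_def)
  then obtain j where j: "j \<le> ?m" "j \<noteq> i" by blast
  obtain c where c: "q = (\<Sum>a\<le>N. smult (c a) (lf i ^ a * lf j ^ (N - a)))"
    using binary_form_expansion[OF lf D i j(1) j(2)[symmetric] N(2)] by blast
  define \<epsilon> where "\<epsilon> a l = (if l = i then int a else 0) + (if l = j then int (N - a) else 0)" for a l
  have sum_\<epsilon>: "(\<Sum>l\<le>?m. - k l + \<epsilon> a l) = 0" if "a \<le> N" for a
  proof -
    have "(\<Sum>l\<le>?m. \<epsilon> a l) = int a + int (N - a)"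
      unfolding \<epsilon>_def sum.distrib using i j(1) by simp
    then show ?thesis
      using that N(1) unfolding sum.distrib sum_negf K_def by simp
  qed
  have "\<exists>b. b \<in> coords {1..?m} \<and> (\<forall>l\<le>?m. e_coeff ?m l b = - k l + \<epsilon> a l)" if "a \<le> N" for a
    using exponent_vector[OF sum_\<epsilon>[OF that]] by metis
  then obtain b where b: "\<And>a. a \<le> N \<Longrightarrow> b a \<in> coords {1..?m}"
    "\<And>a l. a \<le> N \<Longrightarrow> l \<le> ?m \<Longrightarrow> e_coeff ?m l (b a) = - k l + \<epsilon> a l"
    by metis
  have zb: "zmon ?m lf (b a) = form_monomial ?m lf (\<lambda>l. - k l) * to_fract (lf i ^ a * lf j ^ (N - a))"
    if a: "a \<le> N" for a
  proof -
    have "zmon ?m lf (b a) = form_monomial ?m lf (\<lambda>l. - k l + \<epsilon> a l)"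
      unfolding zmon_eq_form_monomial[OF lf] form_monomial_def
      by (rule prod.cong) (use b(2)[OF a] in auto)
    also have "\<dots> = form_monomial ?m lf (\<lambda>l. - k l) * form_monomial ?m lf (\<epsilon> a)"
      by (rule form_monomial_add[OF lf])
    also have "form_monomial ?m lf (\<epsilon> a) = (\<Prod>l\<le>?m. (if l = i then to_fract (lf i) ^ a else 1) * (if l = j then to_fract (lf j) ^ (N - a) else 1))"
      unfolding form_monomial_def by (rule prod.cong) (use j in \<open>auto simp: \<epsilon>_def\<close>)
    also have "\<dots> = to_fract (lf i) ^ a * to_fract (lf j) ^ (N - a)"
      using i j by (simp add: prod.distrib)
    also have "\<dots> = to_fract (lf i ^ a * lf j ^ (N - a))"
    proof -
      have "to_fract (p ^ n) = to_fract p ^ n" for p :: "'k poly" and n by (induction n) auto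
      then show ?thesis by simp
    qed
    finally show ?thesis .
  qed
  have inv: "form_monomial ?m lf k * form_monomial ?m lf (\<lambda>l. - k l) = 1"
    unfolding form_monomial_add[OF lf, symmetric] by (simp add: form_monomial_def)
  show ?thesis
  proof (rule that[of N b c])
    fix a assume a: "a \<le> N"
    show "e_coeff ?m i (b a) = ord_at (?P i) f + int a"
      using b(2)[OF a i] j by (simp add: k_def \<epsilon>_def)
    have "0 \<le> pairing x u + of_int (e_coeff ?m l (b a))" if l: "l \<le> ?m" "x \<in> pd_coeff D l" for l x
    proof -
      have ne: "pd_coeff D l \<noteq> {}" using l by blast
      have "min_pairing (pd_coeff D l) u \<le> pairing x u"
        using min_pairing_attained[OF D l(1) ne u] l(2) by blast
      moreover have "0 \<le> ord_at (?P l) f + \<lfloor>min_pairing (pd_coeff D l) u\<rfloor>"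
        using f l(1) ne by (simp add: sections_nonzero_iff)
      then have "0 \<le> e_coeff ?m l (b a) + \<lfloor>min_pairing (pd_coeff D l) u\<rfloor>"
        using b(2)[OF a l(1)] by (simp add: k_def \<epsilon>_def split: if_splits)
      then have "0 \<le> of_int (e_coeff ?m l (b a)) + (of_int \<lfloor>min_pairing (pd_coeff D l) u\<rfloor> :: rat)"
        by (metis of_int_0_le_iff of_int_add)
      ultimately show ?thesis using of_int_floor_le[of "min_pairing (pd_coeff D l) u"] by linarith
    qed
    then show "(u, b a) \<in> dual_monoid d D"
      using u b(1)[OF a] by (simp add: dual_monoid_iff[OF D])
  next
    have ts: "to_fract (\<Sum>a\<in>A. t a) = (\<Sum>a\<in>A. to_fract (t a))" for A and t :: "nat \<Rightarrow> 'k poly"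
      by (induction A rule: infinite_finite_induct) auto
    have "f = g * form_monomial ?m lf (\<lambda>l. - k l)"
      unfolding g_def using inv by (simp add: mult.assoc)
    also have "\<dots> = (\<Sum>a\<le>N. to_fract (smult (c a) (lf i ^ a * lf j ^ (N - a))) * form_monomial ?m lf (\<lambda>l. - k l))"
      unfolding q(2) by (subst c) (simp add: ts sum_distrib_right)
    also have "\<dots> = (\<Sum>a\<le>N. to_fract [:c a:] * zmon ?m lf (b a))"
    proof (rule sum.cong)
      fix a assume "a \<in> {..N}"
      then have a: "a \<le> N" by simp
      have "smult (c a) (lf i ^ a * lf j ^ (N - a)) = [:c a:] * (lf i ^ a * lf j ^ (N - a))" by simp
      then show "to_fract (smult (c a) (lf i ^ a * lf j ^ (N - a))) * form_monomial ?m lf (\<lambda>l. - k l) =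
          to_fract [:c a:] * zmon ?m lf (b a)"
        unfolding zb[OF a] by (simp only: to_fract_mult mult_ac)
    qed simp
    finally show "f = (\<Sum>a\<le>N. to_fract [:c a:] * zmon ?m lf (b a))" .
  qed
qed

text \<open>A coefficient that is empty admits arbitrary poles already in weight \<open>0\<close>. Otherwise the degree
  grows linearly along the multiples of a weight of positive degree, while rounding down loses less
  than \<open>m + 1\<close>.\<close>

lemma divisor_of_large_degree:
  assumes D: "is_pdivisor d D"
  obtains u k where "u \<in> dual_weights d (pd_tail D)" "(\<Sum>i\<le>pd_m D. k i) = int N"
    "\<And>i. i \<le> pd_m D \<Longrightarrow> pd_coeff D i \<noteq> {} \<Longrightarrow> k i \<le> \<lfloor>min_pairing (pd_coeff D i) u\<rfloor>"
proof (cases "\<exists>j\<le>pd_m D. pd_coeff D j = {}")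
  case True
  then obtain j where j: "j \<le> pd_m D" "pd_coeff D j = {}" by blast
  have u: "0 \<in> dual_weights d (pd_tail D)" by (simp add: dual_weights_def)
  have "min_pairing (pd_coeff D i) 0 = 0" if "i \<le> pd_m D" "pd_coeff D i \<noteq> {}" for i
    using min_pairing_attained[OF D that u] by (metis pairing_0_right)
  then show ?thesis
    using j by (intro that[of 0 "\<lambda>i. if i = j then int N else 0"] u) auto
next
  case False
  let ?m = "pd_m D"
  have ne: "pd_coeff D i \<noteq> {}" if "i \<le> ?m" for i using False that by blast
  obtain u s where us: "u \<in> dual_weights d (pd_tail D)"
    "\<forall>i\<le>pd_m D. \<forall>x\<in>pd_coeff D i. s i \<le> pairing x u" "0 < (\<Sum>i\<le>pd_m D. s i)"
    using pdivisor_positive_weight[OF D ne] by blast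
  \<comment> \<open>Each of the \<open>m + 1\<close> roundings loses less than \<open>1\<close>.\<close>
  obtain n :: nat where n: "of_nat (N + ?m + 1) < of_nat n * (\<Sum>i\<le>?m. s i)"
    using reals_Archimedean3[OF us(3)] by blast
  define u' where "u' = pm_scale (int n) u"
  have u': "u' \<in> dual_weights d (pd_tail D)"
    using us(1) by (auto simp: u'_def dual_weights_def pairing_pm_scale_right intro: coords_pm_scale)
  define fl where "fl i = \<lfloor>min_pairing (pd_coeff D i) u'\<rfloor>" for i
  have fl: "of_nat n * s i - 1 \<le> of_int (fl i)" if i: "i \<le> ?m" for i
  proof -
    obtain x where x: "x \<in> pd_coeff D i" "min_pairing (pd_coeff D i) u' = pairing x u'"
      using min_pairing_attained[OF D i ne[OF i] u'] by blast
    have "of_nat n * s i \<le> of_nat n * pairing x u"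
      using us(2) i x(1) by (intro mult_left_mono) auto
    then show ?thesis
      unfolding fl_def x(2) unfolding u'_def pairing_pm_scale_right by simp linarith
  qed
  have "of_nat (N + ?m + 1) - of_nat (?m + 1) \<le> of_nat n * (\<Sum>i\<le>?m. s i) - of_nat (?m + 1)"
    using n by simp
  also have "\<dots> = (\<Sum>i\<le>?m. of_nat n * s i - 1)"
    by (simp add: sum_subtractf sum_distrib_left)
  also have "\<dots> \<le> (\<Sum>i\<le>?m. of_int (fl i))"
    by (rule sum_mono) (use fl in auto)
  finally have "(of_int (int N) :: rat) \<le> of_int (\<Sum>i\<le>?m. fl i)" by simp
  then have "int N \<le> (\<Sum>i\<le>?m. fl i)" by (simp only: of_int_le_iff)
  then show ?thesis
    using u' by (intro that[of u' "\<lambda>i. fl i + (if i = 0 then int N - (\<Sum>i\<le>?m. fl i) else 0)"])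
      (auto simp: fl_def sum.distrib)
qed

text \<open>The function field of the line is obtained from quotients of sections of the same weight.\<close>

lemma sections_of_bounded_degree:
  assumes D: "is_pdivisor d D"
  obtains u s where "u \<in> dual_weights d (pd_tail D)" "s \<noteq> 0"
    "\<And>p. degree p \<le> N \<Longrightarrow> to_fract p * s \<in> sections D u"
proof -
  let ?m = "pd_m D"
  obtain lf :: "nat \<Rightarrow> 'a poly" where lf: "is_linear_embedding D lf"
    using linear_embedding_exists by blast
  obtain u k where uk: "u \<in> dual_weights d (pd_tail D)" "(\<Sum>i\<le>?m. k i) = int N"
    "\<And>i. i \<le> ?m \<Longrightarrow> pd_coeff D i \<noteq> {} \<Longrightarrow> k i \<le> \<lfloor>min_pairing (pd_coeff D i) u\<rfloor>"
    using divisor_of_large_degree[OF D] by blast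
  define s where "s = form_monomial ?m lf (\<lambda>i. - k i)"
  have s: "s \<noteq> 0" unfolding s_def by (rule form_monomial_nonzero[OF lf])
  show ?thesis
  proof (rule that[OF uk(1) s])
    fix p :: "'a poly" assume deg: "degree p \<le> N"
    show "to_fract p * s \<in> sections D u"
    proof (cases "p = 0")
      case False
      have ge: "- (if Q = None then int N else 0) \<le> ord_poly Q p" for Q
        by (rule ord_poly_ge[OF False deg])
      have ord: "ord_at Q (to_fract p * s) = ord_poly Q p + ord_at Q s" for Q
        using False s by (simp add: ord_at_mult ord_at_to_fract)
      have "0 \<le> ord_at (pd_point D i) (to_fract p * s) + \<lfloor>min_pairing (pd_coeff D i) u\<rfloor>"
        if "i \<le> ?m" "pd_coeff D i \<noteq> {}" for i
        using uk(3)[OF that] ge[of "pd_point D i"] unfolding ord unfolding s_def ord_at_form_monomial_point[OF lf D that(1)]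
        by (auto simp: sum_negf uk(2) split: if_splits)
      moreover have "0 \<le> ord_at Q (to_fract p * s)" if "Q \<notin> pd_point D ` {..?m}" for Q
        using ge[of Q] unfolding ord unfolding s_def ord_at_form_monomial_other[OF lf that]
        by (auto simp: sum_negf uk(2) split: if_splits)
      ultimately show ?thesis
        using False s by (simp add: sections_nonzero_iff)
    qed (simp add: sections_def)
  qed
qed

section \<open>The value of a homogeneous rational function\<close>

interpretation qvs: vector_space "pm_scale :: rat \<Rightarrow> ('i \<Rightarrow>\<^sub>0 rat) \<Rightarrow> ('i \<Rightarrow>\<^sub>0 rat)"
  by (rule vector_space_pm_scale)

lemma rat_vec_group_hull_subset_span:
  assumes "rat_vec ` S \<subseteq> qvs.span T"
  shows "rat_vec ` group_hull S \<subseteq> qvs.span T"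
proof (rule image_subsetI)
  fix x assume "x \<in> group_hull S"
  then have "x \<in> {y. rat_vec y \<in> qvs.span T}"
    unfolding group_hull_def
  proof (rule monoid_hull_least)
    show "0 \<in> {y. rat_vec y \<in> qvs.span T}" by (simp add: qvs.span_zero)
    fix s x assume "s \<in> S \<union> uminus ` S" "x \<in> {y. rat_vec y \<in> qvs.span T}"
    then show "s + x \<in> {y. rat_vec y \<in> qvs.span T}"
      using assms by (auto simp: rat_vec_add rat_vec_uminus intro!: qvs.span_add qvs.span_neg)
  qed
  then show "rat_vec x \<in> qvs.span T" by simp
qed

lemma expand_single:
  fixes a :: "'i \<Rightarrow>\<^sub>0 int"
  assumes "finite I" "a \<in> coords I"
  shows "a = (\<Sum>i\<in>I. pm_scale (lookup a i) (single i 1))"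
  by (rule poly_mapping_eqI)
    (use assms in \<open>auto simp: lookup_sum lookup_pm_scale lookup_single when_def coords_iff
        if_distrib[of "(*) _"] cong: if_cong\<close>)

lemma additive_int_scale:
  fixes f :: "('i \<Rightarrow>\<^sub>0 int) \<Rightarrow> ('j \<Rightarrow>\<^sub>0 int)"
  assumes add: "\<And>a b. a \<in> coords I \<Longrightarrow> b \<in> coords I \<Longrightarrow> f (a + b) = f a + f b" and a: "a \<in> coords I"
  shows "f (pm_scale n a) = pm_scale n (f a)"
proof -
  have f0: "f 0 = 0" using add[of 0 0] by simp
  have nat: "f (pm_scale (int k) a) = pm_scale (int k) (f a)" for k
  proof (induction k)
    case (Suc k)
    have "f (a + pm_scale (int k) a) = f a + f (pm_scale (int k) a)"
      by (intro add a coords_pm_scale)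
    then show ?case using Suc by (simp add: pm_scale_add_left)
  qed (simp add: f0)
  have "f (- b) = - f b" if "b \<in> coords I" for b
    using add[OF that coords_uminus[OF that]] f0 by (simp add: eq_neg_iff_add_eq_0 add.commute)
  then show ?thesis
    using nat a coords_pm_scale[OF a] by (cases n rule: int_cases2) (simp_all add: pm_scale_uminus_left)
qed

lemma single_eq_0_iff [simp]: "single u x = 0 \<longleftrightarrow> x = 0"
  by (metis lookup_single_eq lookup_zero single_zero)

locale presented_valuation =
  fixes \<kappa> :: "'k::alg_closed_field \<Rightarrow> 'r::idom"
    and G :: "(nat \<Rightarrow>\<^sub>0 int) \<Rightarrow> 'r set"
    and v :: "'r \<Rightarrow> (nat \<Rightarrow>\<^sub>0 int)"
    and d r :: nat
    and D :: "'k pdivisor"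
    and \<psi> :: "'r \<Rightarrow> 'k chi_alg"
  assumes D: "is_pdivisor d D"
    and iso: "is_graded_iso d \<kappa> G D \<psi>"
    and grading: "is_grading d \<kappa> G"
    and effective: "is_effective d G"
    and val: "is_valuation r \<kappa> v"
begin

lemma psi_add: "\<psi> (f + g) = \<psi> f + \<psi> g"
  and psi_mult: "\<psi> (f * g) = \<psi> f * \<psi> g"
  and psi_1: "\<psi> 1 = 1"
  and psi_const: "\<psi> (\<kappa> c) = const_chi c"
  using iso by (auto simp: is_graded_iso_def is_algebra_map_def)

lemma psi_0 [simp]: "\<psi> 0 = 0"
  using psi_add[of 0 0] by (simp only: add_0_left add_cancel_right_right)

lemma psi_sum: "\<psi> (sum f A) = (\<Sum>x\<in>A. \<psi> (f x))"
  by (induction A rule: infinite_finite_induct) (auto simp: psi_add)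

lemma psi_eq_iff [simp]: "\<psi> f = \<psi> g \<longleftrightarrow> f = g"
  using iso by (auto simp: is_graded_iso_def bij_betw_def dest: injD)

lemma psi_eq_0_iff [simp]: "\<psi> f = 0 \<longleftrightarrow> f = 0"
  using psi_eq_iff[of f 0] by (simp del: psi_eq_iff)

lemma psi_mem: "\<psi> f \<in> section_algebra d D"
  using iso by (auto simp: is_graded_iso_def bij_betw_def)

lemma psi_surj: "F \<in> section_algebra d D \<Longrightarrow> \<exists>f. \<psi> f = F"
  using iso unfolding is_graded_iso_def bij_betw_def by (metis rangeE)

lemma psi_component:
  "u \<in> keys (\<psi> f) \<Longrightarrow> u \<in> dual_weights d (pd_tail D) \<and> lookup (\<psi> f) u \<in> sections D u"
  using psi_mem[of f] by (auto simp: section_algebra_def)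

lemma psi_section: "u \<in> dual_weights d (pd_tail D) \<Longrightarrow> g \<in> sections D u \<Longrightarrow> \<exists>f. \<psi> f = single u g"
  by (intro psi_surj) (auto simp: section_algebra_def lookup_single when_def)

lemma v_coords: "f \<noteq> 0 \<Longrightarrow> v f \<in> coords {..<r}"
  and v_const: "c \<noteq> 0 \<Longrightarrow> v (\<kappa> c) = 0"
  and v_mult: "f \<noteq> 0 \<Longrightarrow> g \<noteq> 0 \<Longrightarrow> v (f * g) = v f + v g"
  and v_add: "f \<noteq> 0 \<Longrightarrow> g \<noteq> 0 \<Longrightarrow> f + g \<noteq> 0 \<Longrightarrow> min (v f) (v g) \<le> v (f + g)"
  using val by (auto simp: is_valuation_def)

lemma v_1 [simp]: "v 1 = 0"
  using v_mult[of 1 1] by simp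

lemma v_uminus:
  assumes "f \<noteq> 0"
  shows "v (- f) = v f"
proof -
  have "v (- 1 * - 1) = v (- 1) + v (- 1)" by (rule v_mult) auto
  then have "v (- 1) + v (- 1) = 0" by simp
  then have "v (- 1) = 0" by (simp only: double_zero)
  moreover have "v (- 1 * f) = v (- 1) + v f" using assms by (intro v_mult) auto
  ultimately show ?thesis by simp
qed

lemma v_sum_ge:
  assumes "finite A" "sum f A \<noteq> 0" "\<And>x. x \<in> A \<Longrightarrow> f x \<noteq> 0 \<Longrightarrow> a \<le> v (f x)"
  shows "a \<le> v (sum f A)"
  using assms
proof (induction rule: finite_induct)
  case (insert x A)
  show ?case
  proof (cases "f x = 0 \<or> sum f A = 0")
    case False
    then have "a \<le> min (v (f x)) (v (sum f A))" using insert by auto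
    also have "\<dots> \<le> v (f x + sum f A)" using False insert by (intro v_add) auto
    finally show ?thesis using insert by simp
  qed (use insert in auto)
qed simp

lemma v_sum_gt:
  assumes "finite A" "sum f A \<noteq> 0" "\<And>x. x \<in> A \<Longrightarrow> f x \<noteq> 0 \<Longrightarrow> a < v (f x)"
  shows "a < v (sum f A)"
  using assms
proof (induction rule: finite_induct)
  case (insert x A)
  show ?case
  proof (cases "f x = 0 \<or> sum f A = 0")
    case False
    then have "a < min (v (f x)) (v (sum f A))" using insert by auto
    also have "\<dots> \<le> v (f x + sum f A)" using False insert by (intro v_add) auto
    finally show ?thesis using insert by simp
  qed (use insert in auto)
qed simp

text \<open>The function \<open>g \<chi>\<^sup>u\<close> is a quotient \<open>f\<^sub>1 / f\<^sub>2\<close> of elements of the coordinate ring;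
  \<open>hval u g\<close> is its value under the extension of \<open>v\<close>.\<close>

definition is_quotient :: "(nat \<Rightarrow>\<^sub>0 int) \<Rightarrow> 'k poly fract \<Rightarrow> 'r \<Rightarrow> 'r \<Rightarrow> bool" where
  "is_quotient u g f1 f2 \<longleftrightarrow> f1 \<noteq> 0 \<and> f2 \<noteq> 0 \<and> \<psi> f1 = single u g * \<psi> f2"

definition hval :: "(nat \<Rightarrow>\<^sub>0 int) \<Rightarrow> 'k poly fract \<Rightarrow> (nat \<Rightarrow>\<^sub>0 int)" where
  "hval u g = (THE a. \<exists>f1 f2. is_quotient u g f1 f2 \<and> a = v f1 - v f2)"

lemma hval_eq:
  assumes "is_quotient u g f1 f2"
  shows "hval u g = v f1 - v f2"
  unfolding hval_def
proof (rule the_equality)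
  fix a assume "\<exists>f1 f2. is_quotient u g f1 f2 \<and> a = v f1 - v f2"
  then obtain h1 h2 where h: "is_quotient u g h1 h2" "a = v h1 - v h2" by blast
  have "\<psi> (f1 * h2) = \<psi> (h1 * f2)"
    using assms h by (simp add: is_quotient_def psi_mult mult_ac)
  then have "v (f1 * h2) = v (h1 * f2)" by simp
  then have eq: "v f1 + v h2 = v h1 + v f2"
    using assms h by (simp add: is_quotient_def v_mult)
  have "a = (v h1 + v f2) - (v h2 + v f2)" using h(2) by simp
  also have "\<dots> = (v f1 + v h2) - (v f2 + v h2)" unfolding eq by (simp only: add.commute)
  also have "\<dots> = v f1 - v f2" by simp
  finally show "a = v f1 - v f2" .
qed (use assms in blast)

lemma hval_single:
  assumes "f \<noteq> 0" "\<psi> f = single u g"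
  shows "v f = hval u g"
  using hval_eq[of u g f 1] assms by (simp add: is_quotient_def psi_1)

lemma is_quotient_mult:
  "is_quotient u g f1 f2 \<Longrightarrow> is_quotient u' g' h1 h2 \<Longrightarrow> is_quotient (u + u') (g * g') (f1 * h1) (f2 * h2)"
  by (simp add: is_quotient_def psi_mult mult_ac mult_single[symmetric])

lemma is_quotient_inverse:
  assumes "is_quotient u g f1 f2" "g \<noteq> 0"
  shows "is_quotient (- u) (inverse g) f2 f1"
proof -
  have "single (- u) (inverse g) * \<psi> f1 = (single (- u) (inverse g) * single u g) * \<psi> f2"
    using assms by (simp add: is_quotient_def mult.assoc)
  also have "\<dots> = \<psi> f2" using assms(2) by (simp add: mult_single)
  finally show ?thesis using assms by (simp add: is_quotient_def)
qed

lemma is_quotient_function: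
  assumes "g \<noteq> 0"
  obtains f1 f2 where "is_quotient 0 g f1 f2"
proof -
  obtain a b where ab: "a \<noteq> 0" "b \<noteq> 0" "g = Fract a b"
    using assms by (rule fract_nonzero_cases)
  obtain u s where us: "u \<in> dual_weights d (pd_tail D)" "s \<noteq> 0"
    "\<And>p. degree p \<le> max (degree a) (degree b) \<Longrightarrow> to_fract p * s \<in> sections D u"
    using sections_of_bounded_degree[OF D] by blast
  obtain f1 f2 where f: "\<psi> f1 = single u (to_fract a * s)" "\<psi> f2 = single u (to_fract b * s)"
    using psi_section[OF us(1) us(3)] by (metis max.cobounded1 max.cobounded2)
  have "f1 \<noteq> 0" "f2 \<noteq> 0"
    using f ab us(2) by (auto simp flip: psi_eq_0_iff)
  moreover have "\<psi> f1 = single 0 g * \<psi> f2"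
    using ab unfolding f mult_single by (simp add: Fract_conv_to_fract)
  ultimately show ?thesis using that by (simp add: is_quotient_def)
qed

text \<open>Quotients are closed under products and inverses and contain all functions of weight \<open>0\<close>. As
  the action is effective, the weights of nonzero homogeneous elements generate the lattice.\<close>

lemma is_quotient_exists:
  assumes u: "u \<in> coords {..<d}" and g: "g \<noteq> 0"
  obtains f1 f2 where "is_quotient u g f1 f2"
proof -
  have "\<forall>g. g \<noteq> 0 \<longrightarrow> (\<exists>f1 f2. is_quotient u g f1 f2)"
  proof -
    let ?S = "{u \<in> coords {..<d}. G u \<noteq> {0}}"
    let ?T = "{u. \<forall>g. g \<noteq> 0 \<longrightarrow> (\<exists>f1 f2. is_quotient u g f1 f2)}"
    have "u \<in> group_hull ?S" using effective u by (simp add: is_effective_def)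
    then have "u \<in> ?T" unfolding group_hull_def
    proof (rule monoid_hull_least)
      show "0 \<in> ?T" using is_quotient_function by blast
      have S: "\<exists>g f1 f2. g \<noteq> 0 \<and> is_quotient w g f1 f2" if "w \<in> ?S" for w
      proof -
        have "0 \<in> G w" using that grading by (simp add: is_grading_def)
        moreover have "G w \<noteq> {0}" using that by simp
        ultimately obtain f where f: "f \<in> G w" "f \<noteq> 0" by blast
        then have "keys (\<psi> f) \<subseteq> {w}" using iso that by (auto simp: is_graded_iso_def)
        then have "\<psi> f = single w (lookup (\<psi> f) w)"
          by (intro poly_mapping_eqI) (auto simp: lookup_single when_def in_keys_iff)
        moreover from this f(2) have "lookup (\<psi> f) w \<noteq> 0" by (metis psi_eq_0_iff single_zero)
        ultimately have "is_quotient w (lookup (\<psi> f) w) f 1"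
          using f(2) by (simp add: is_quotient_def psi_1)
        then show ?thesis using \<open>lookup (\<psi> f) w \<noteq> 0\<close> by blast
      qed
      fix s x assume s: "s \<in> ?S \<union> uminus ` ?S" and x: "x \<in> ?T"
      have "\<exists>h f1 f2. h \<noteq> 0 \<and> is_quotient s h f1 f2"
      proof (cases "s \<in> ?S")
        case False
        then obtain w where w: "w \<in> ?S" "s = - w" using s by blast
        obtain h f1 f2 where "h \<noteq> 0" "is_quotient w h f1 f2" using S[OF w(1)] by blast
        then have "is_quotient s (inverse h) f2 f1" "inverse h \<noteq> 0" by (simp_all add: is_quotient_inverse w(2))
        then show ?thesis by blast
      qed (rule S)
      then obtain h f1 f2 where h: "h \<noteq> 0" "is_quotient s h f1 f2" by blast
      show "s + x \<in> ?T"
      proof safe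
        fix g :: "'k poly fract" assume "g \<noteq> 0"
        then have "g / h \<noteq> 0" using h(1) by simp
        then obtain k1 k2 where "is_quotient x (g / h) k1 k2" using x by blast
        from is_quotient_mult[OF h(2) this] show "\<exists>f1 f2. is_quotient (s + x) g f1 f2" using h(1) by auto
      qed
    qed
    then show ?thesis by simp
  qed
  then show ?thesis using g that by blast
qed

lemma hval_mult:
  assumes "u \<in> coords {..<d}" "u' \<in> coords {..<d}" "g \<noteq> 0" "g' \<noteq> 0"
  shows "hval (u + u') (g * g') = hval u g + hval u' g'"
proof -
  obtain f1 f2 h1 h2 where f: "is_quotient u g f1 f2" "is_quotient u' g' h1 h2"
    using is_quotient_exists assms by metis
  show ?thesis
    using f hval_eq[OF is_quotient_mult[OF f]] hval_eq[OF f(1)] hval_eq[OF f(2)]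
    by (simp add: is_quotient_def v_mult)
qed

lemma hval_coords:
  assumes "u \<in> coords {..<d}" "g \<noteq> 0"
  shows "hval u g \<in> coords {..<r}"
proof -
  obtain f1 f2 where f: "is_quotient u g f1 f2" using is_quotient_exists assms by metis
  then show ?thesis using hval_eq[OF f] by (auto simp: is_quotient_def intro!: coords_diff v_coords)
qed

lemma hval_const: "c \<noteq> 0 \<Longrightarrow> hval 0 (to_fract [:c:]) = 0"
proof -
  assume c: "c \<noteq> 0"
  then have "\<kappa> c \<noteq> 0"
    by (metis const_chi_def pCons_eq_0_iff psi_0 psi_const single_zero inj_single injD to_fract_eq_0_iff)
  then show ?thesis using hval_single[of "\<kappa> c"] v_const[OF c] by (simp add: psi_const const_chi_def)
qed

lemma hval_add:
  assumes u: "u \<in> coords {..<d}" and g: "g \<noteq> 0" "h \<noteq> 0" "g + h \<noteq> 0"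
  shows "min (hval u g) (hval u h) \<le> hval u (g + h)"
proof -
  obtain f1 f2 h1 h2 where f: "is_quotient u g f1 f2" "is_quotient u h h1 h2"
    using is_quotient_exists u g by metis
  have sum: "\<psi> (f1 * h2 + h1 * f2) = single u (g + h) * \<psi> (f2 * h2)"
    using f by (simp add: is_quotient_def psi_add psi_mult single_add algebra_simps)
  have "single u (g + h) \<noteq> 0" using g(3) by (metis lookup_single_eq lookup_zero)
  moreover have "\<psi> (f2 * h2) \<noteq> 0" using f by (simp add: is_quotient_def)
  ultimately have "\<psi> (f1 * h2 + h1 * f2) \<noteq> 0" unfolding sum by simp
  then have nz: "f1 * h2 + h1 * f2 \<noteq> 0" by simp
  then have q: "is_quotient u (g + h) (f1 * h2 + h1 * f2) (f2 * h2)"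
    using sum f by (simp add: is_quotient_def)
  have "min (v (f1 * h2)) (v (h1 * f2)) \<le> v (f1 * h2 + h1 * f2)"
    using f nz by (intro v_add) (auto simp: is_quotient_def)
  moreover have "v (f1 * h2) = hval u g + (v f2 + v h2)" "v (h1 * f2) = hval u h + (v f2 + v h2)"
    "v (f1 * h2 + h1 * f2) = hval u (g + h) + (v f2 + v h2)"
    using f hval_eq[OF q] hval_eq[OF f(1)] hval_eq[OF f(2)] by (simp_all add: is_quotient_def v_mult)
  ultimately show ?thesis by (simp only: min_add_distrib_left[symmetric] add_le_cancel_right)
qed

lemma hval_uminus:
  assumes "u \<in> coords {..<d}" "g \<noteq> 0"
  shows "hval u (- g) = hval u g"
proof -
  have "to_fract [:- 1:] = (- 1 :: 'k poly fract)"
  proof -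
    have "[:- 1:] = (- 1 :: 'k poly)" by (simp add: one_pCons)
    then show ?thesis by (simp only: to_fract_uminus to_fract_1)
  qed
  then show ?thesis
    using hval_mult[of 0 u "- 1" g] hval_const[of "- 1"] assms by simp
qed

lemma hval_add_less:
  assumes u: "u \<in> coords {..<d}" and g: "g \<noteq> 0" "h \<noteq> 0" and less: "hval u g < hval u h"
  shows "g + h \<noteq> 0" "hval u (g + h) = hval u g"
proof -
  show nz: "g + h \<noteq> 0"
    using hval_uminus[OF u g(1)] less by (metis add_eq_0_iff order_less_irrefl)
  have "hval u g \<le> hval u (g + h)"
    using hval_add[OF u g nz] less by (simp add: min_def split: if_splits)
  moreover have "min (hval u (g + h)) (hval u (- h)) \<le> hval u g"
    using hval_add[of u "g + h" "- h"] u g nz by simp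
  ultimately show "hval u (g + h) = hval u g"
    using less hval_uminus[OF u g(2)] by (auto simp: min_def split: if_splits)
qed

lemma hval_0_1 [simp]: "hval 0 1 = 0"
  using hval_mult[of 0 0 1 1] by simp

text \<open>A valuation of \<open>K(t)\<close> that is trivial on \<open>K\<close> is determined by its values on the functions
  \<open>t - c\<close>. If one of these is positive, the others vanish; if one is negative, all are equal.\<close>

lemma hval_function_field:
  obtains Q \<gamma> where "0 \<le> \<gamma>" "\<gamma> \<in> coords {..<r}"
    "\<And>g. g \<noteq> 0 \<Longrightarrow> hval 0 g = pm_scale (ord_at Q g) \<gamma>"
proof -
  let ?w = "\<lambda>p. hval 0 (to_fract p)"
  let ?lin = "\<lambda>c::'k. [:- c, 1:]"
  have w_mult: "?w (p * q) = ?w p + ?w q" if "p \<noteq> 0" "q \<noteq> 0" for p q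
    using hval_mult[of 0 0 "to_fract p" "to_fract q"] that by simp
  have extend: "hval 0 g = pm_scale (ord_at Q g) \<gamma>"
    if lin: "\<And>c. ?w (?lin c) = pm_scale (ord_poly Q (?lin c)) \<gamma>" and g: "g \<noteq> 0" for Q \<gamma> g
  proof -
    have poly: "?w p = pm_scale (ord_poly Q p) \<gamma>" if "p \<noteq> 0" for p
      using that
    proof (induction "degree p" arbitrary: p rule: less_induct)
      case less
      show ?case
      proof (cases "degree p = 0")
        case True
        then obtain c where "p = [:c:]" "c \<noteq> 0" using less.prems by (auto elim: degree_eq_zeroE)
        then show ?thesis
          by (simp add: hval_const ord_poly_def order_0I split: option.splits)
      next
        case False
        then obtain c where "poly p c = 0" using alg_closed_imp_poly_has_root by blast
        then obtain q where q: "p = ?lin c * q" by (metis poly_eq_0_iff_dvd dvdE)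
        then have nz: "q \<noteq> 0" "?lin c \<noteq> 0" using less.prems by auto
        have "degree q < degree p" using nz unfolding q by (simp add: degree_mult_eq del: mult_pCons_left)
        then have "?w q = pm_scale (ord_poly Q q) \<gamma>" using nz(1) by (rule less.hyps)
        then show ?thesis
          unfolding q w_mult[OF nz(2,1)] ord_poly_mult[OF nz(2,1)] pm_scale_add_left lin by simp
      qed
    qed
    obtain a b where ab: "a \<noteq> 0" "b \<noteq> 0" "g = Fract a b" using g by (rule fract_nonzero_cases)
    have "g * to_fract b = to_fract a" using ab by (simp add: Fract_conv_to_fract)
    then have "hval 0 g + ?w b = ?w a"
      using hval_mult[of 0 0 g "to_fract b"] g ab by simp
    then have "hval 0 g = ?w a - ?w b" by (simp add: algebra_simps)
    then show ?thesis using ab poly by (simp add: ord_at_Fract pm_scale_diff_left)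
  qed
  have shift: "to_fract (?lin x) = to_fract (?lin c) + to_fract [:c - x:]" for x c
    by (simp flip: to_fract_add)
  have ord_lin: "ord_poly (Some c) (?lin x) = (if x = c then 1 else 0)" for c x
    using order_power_n_n[of c 1] by (auto simp: ord_poly_def intro: order_0I)
  have w_coords: "?w (?lin c) \<in> coords {..<r}" for c
    by (rule hval_coords) auto
  have lin_nz: "to_fract (?lin c) \<noteq> 0" for c by simp
  consider c where "0 < ?w (?lin c)" | c where "?w (?lin c) < 0" | "\<And>c. ?w (?lin c) = 0"
    by (metis linorder_neqE)
  then show ?thesis
  proof cases
    case (1 c)
    have lin: "?w (?lin x) = pm_scale (ord_poly (Some c) (?lin x)) (?w (?lin c))" for x
    proof (cases "x = c")
      case False
      have "hval 0 (to_fract [:c - x:] + to_fract (?lin c)) = hval 0 (to_fract [:c - x:])"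
        using False 1 lin_nz[of c] by (intro hval_add_less) (auto simp: hval_const)
      then have "?w (?lin x) = 0"
        unfolding shift[of x c] using False by (simp add: hval_const add.commute)
      then show ?thesis using False ord_lin by simp
    qed (simp add: ord_lin)
    show ?thesis
    proof (rule that[of "?w (?lin c)" "Some c"])
      show "0 \<le> ?w (?lin c)" using 1 by (rule less_imp_le)
    qed (auto intro: w_coords extend[OF lin])
  next
    case (2 c)
    have eq: "?w (?lin x) = ?w (?lin c)" for x
    proof (cases "x = c")
      case False
      then have "hval 0 (to_fract (?lin c) + to_fract [:c - x:]) = hval 0 (to_fract (?lin c))"
        using 2 lin_nz[of c] by (intro hval_add_less) (auto simp: hval_const)
      then show ?thesis unfolding shift[of x c] .
    qed simp
    have lin: "?w (?lin x) = pm_scale (ord_poly None (?lin x)) (- ?w (?lin c))" for x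
      unfolding eq[of x] by (simp add: ord_poly_def pm_scale_uminus_left)
    show ?thesis
    proof (rule that[of "- ?w (?lin c)" None])
      show "0 \<le> - ?w (?lin c)" using 2 by (simp add: less_imp_le)
      show "- ?w (?lin c) \<in> coords {..<r}" by (intro coords_uminus w_coords)
    qed (auto intro: extend[OF lin])
  next
    case 3
    have lin: "?w (?lin x) = pm_scale (ord_poly None (?lin x)) 0" for x
      using 3 by simp
    show ?thesis
    proof (rule that[of 0 None])
      show "hval 0 g = pm_scale (ord_at None g) 0" if "g \<noteq> 0" for g
        using lin that by (rule extend)
    qed auto
  qed
qed

lemma hval_split:
  assumes "u \<in> coords {..<d}" "g \<noteq> 0"
  shows "hval u g = hval 0 g + hval u 1"
  using hval_mult[of 0 u g 1] assms by simp

lemma hval_1_add: "u \<in> coords {..<d} \<Longrightarrow> u' \<in> coords {..<d} \<Longrightarrow> hval (u + u') 1 = hval u 1 + hval u' 1"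
  using hval_mult[of u u' 1 1] by simp

lemma hval_1_expand:
  assumes "u \<in> coords {..<d}"
  shows "hval u 1 = (\<Sum>i<d. pm_scale (lookup u i) (hval (single i 1) 1))"
proof -
  have e: "single i 1 \<in> coords {..<d}" if "i < d" for i using that by (simp add: coords_single)
  have lin: "hval (\<Sum>i\<in>I. pm_scale (n i) (single i 1)) 1 = (\<Sum>i\<in>I. pm_scale (n i) (hval (single i 1) 1))"
    if "finite I" "I \<subseteq> {..<d}" for I and n :: "nat \<Rightarrow> int"
    using that
  proof (induction rule: finite_induct)
    case (insert i I)
    then have i: "i < d" by simp
    have "hval (pm_scale (n i) (single i 1)) 1 = pm_scale (n i) (hval (single i 1) 1)"
      by (rule additive_int_scale[of "{..<d}" "\<lambda>u. hval u 1"]) (use hval_1_add e[OF i] in auto)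
    moreover have "hval (pm_scale (n i) (single i 1) + (\<Sum>i\<in>I. pm_scale (n i) (single i 1))) 1 =
        hval (pm_scale (n i) (single i 1)) 1 + hval (\<Sum>i\<in>I. pm_scale (n i) (single i 1)) 1"
      using insert.prems by (intro hval_1_add coords_sum coords_pm_scale e) auto
    ultimately show ?case using insert by simp
  qed simp
  have "hval u 1 = hval (\<Sum>i<d. pm_scale (lookup u i) (single i 1)) 1"
    by (rule arg_cong[where f = "\<lambda>u. hval u 1"]) (rule expand_single[OF finite_lessThan assms])
  then show ?thesis using lin[of "{..<d}"] by simp
qed

text \<open>Comparing coefficients of \<open>\<psi> f\<close>, since \<open>\<psi>\<close> maps the component of weight \<open>u\<close> to a multiple
  of \<open>\<chi>\<^sup>u\<close>.\<close>

lemma is_decomp_component: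
  assumes "is_decomp d G f c"
  shows "\<psi> (lookup c u) = single u (lookup (\<psi> f) u)"
    and "keys c = keys (\<psi> f)"
proof -
  have c: "keys c \<subseteq> coords {..<d}" "\<And>u. u \<in> keys c \<Longrightarrow> lookup c u \<in> G u"
    "f = (\<Sum>u\<in>keys c. lookup c u)"
    using assms by (auto simp: is_decomp_def)
  have keys: "keys (\<psi> (lookup c u)) \<subseteq> {u}" for u
  proof (cases "u \<in> keys c")
    case True
    then show ?thesis using iso c(1) c(2)[OF True] unfolding is_graded_iso_def by blast
  qed (simp add: in_keys_iff)
  have "lookup (\<psi> f) u = lookup (\<psi> (lookup c u)) u" for u
  proof -
    have "lookup (\<psi> f) u = (\<Sum>w\<in>keys c. lookup (\<psi> (lookup c w)) u)"
      by (subst c(3)) (simp add: psi_sum lookup_sum)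
    also have "\<dots> = (\<Sum>w\<in>keys c. if w = u then lookup (\<psi> (lookup c u)) u else 0)"
      by (rule sum.cong) (use keys in \<open>auto simp: in_keys_iff subset_iff\<close>)
    also have "\<dots> = lookup (\<psi> (lookup c u)) u"
      by (simp add: in_keys_iff)
    finally show ?thesis .
  qed
  note look = this
  show *: "\<psi> (lookup c u) = single u (lookup (\<psi> f) u)" for u
    using keys[of u] by (intro poly_mapping_eqI) (auto simp: look lookup_single when_def in_keys_iff subset_iff)
  have "u \<in> keys c \<longleftrightarrow> u \<in> keys (\<psi> f)" for u
    using *[of u] psi_eq_0_iff[of "lookup c u"] by (simp add: in_keys_iff del: psi_eq_0_iff)
  then show "keys c = keys (\<psi> f)"
    by blast
qed

text \<open>The only possible value of \<open>f\<close> under a homogeneous valuation with these values on homogeneous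
  elements.\<close>

definition hmin :: "'r \<Rightarrow> (nat \<Rightarrow>\<^sub>0 int)" where
  "hmin f = Min ((\<lambda>u. hval u (lookup (\<psi> f) u)) ` keys (\<psi> f))"

lemma homogeneous_iff: "is_homogeneous_valuation d G v \<longleftrightarrow> (\<forall>f. f \<noteq> 0 \<longrightarrow> v f = hmin f)"
proof -
  have "Min ((\<lambda>u. v (lookup c u)) ` keys c) = hmin f" if "is_decomp d G f c" for f c
  proof -
    have "v (lookup c u) = hval u (lookup (\<psi> f) u)" if "u \<in> keys c" for u
      using that is_decomp_component(1)[OF \<open>is_decomp d G f c\<close>] by (intro hval_single) (auto simp: in_keys_iff)
    then show ?thesis
      unfolding hmin_def is_decomp_component(2)[OF that, symmetric] by (metis (mono_tags, lifting) image_cong)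
  qed
  moreover have "\<exists>c. is_decomp d G f c" for f
    using grading by (auto simp: is_grading_def)
  ultimately show ?thesis unfolding is_homogeneous_valuation_def by metis
qed

lemma component_exists:
  assumes "u \<in> keys (\<psi> f)"
  obtains fu where "fu \<noteq> 0" "\<psi> fu = single u (lookup (\<psi> f) u)"
    "v fu = hval u (lookup (\<psi> f) u)"
proof -
  obtain fu where fu: "\<psi> fu = single u (lookup (\<psi> f) u)"
    using psi_section psi_component[OF assms] by blast
  moreover have "fu \<noteq> 0" using fu assms by (auto simp: in_keys_iff)
  ultimately show ?thesis using that hval_single by blast
qed

lemma hmin_attained:
  assumes "f \<noteq> 0"
  obtains u where "u \<in> keys (\<psi> f)" "hmin f = hval u (lookup (\<psi> f) u)"
proof -
  have "keys (\<psi> f) \<noteq> {}" using assms by simp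
  then have "hmin f \<in> (\<lambda>u. hval u (lookup (\<psi> f) u)) ` keys (\<psi> f)"
    unfolding hmin_def by (intro Min_in) auto
  then show ?thesis using that by blast
qed

lemma hmin_le: "u \<in> keys (\<psi> f) \<Longrightarrow> hmin f \<le> hval u (lookup (\<psi> f) u)"
  unfolding hmin_def by (intro Min_le) auto

lemma psi_expand: "\<psi> f = (\<Sum>u\<in>keys (\<psi> f). single u (lookup (\<psi> f) u))"
  by (rule poly_mapping_eqI) (auto simp: lookup_sum lookup_single when_def in_keys_iff)

lemma component_sum:
  obtains c where "f = (\<Sum>u\<in>keys (\<psi> f). c u)"
    "\<forall>u\<in>keys (\<psi> f). c u \<noteq> 0 \<and> v (c u) = hval u (lookup (\<psi> f) u)"
proof -
  have "\<exists>fu. fu \<noteq> 0 \<and> \<psi> fu = single u (lookup (\<psi> f) u) \<and>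
      v fu = hval u (lookup (\<psi> f) u)" if "u \<in> keys (\<psi> f)" for u
    using component_exists[OF that] by metis
  then obtain c where c: "\<And>u. u \<in> keys (\<psi> f) \<Longrightarrow> c u \<noteq> 0 \<and>
      \<psi> (c u) = single u (lookup (\<psi> f) u) \<and>
      v (c u) = hval u (lookup (\<psi> f) u)"
    by metis
  have "\<psi> (\<Sum>u\<in>keys (\<psi> f). c u) = (\<Sum>u\<in>keys (\<psi> f). single u (lookup (\<psi> f) u))"
    unfolding psi_sum by (rule sum.cong) (use c in auto)
  also have "\<dots> = \<psi> f" by (rule psi_expand[symmetric])
  finally have "f = (\<Sum>u\<in>keys (\<psi> f). c u)" by simp
  then show ?thesis using that c by blast
qed

lemma hmin_le_v: "f \<noteq> 0 \<Longrightarrow> hmin f \<le> v f"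
proof -
  assume f: "f \<noteq> 0"
  obtain c where c: "f = (\<Sum>u\<in>keys (\<psi> f). c u)"
    "\<forall>u\<in>keys (\<psi> f). c u \<noteq> 0 \<and> v (c u) = hval u (lookup (\<psi> f) u)"
    by (rule component_sum)
  have "hmin f \<le> v (\<Sum>u\<in>keys (\<psi> f). c u)"
    by (rule v_sum_ge) (use c f hmin_le in auto)
  then show ?thesis using c(1) by simp
qed

text \<open>The component of least value is \<open>f\<close> minus the other components, which have larger values. If
  \<open>f\<close> had a larger value as well, so would that component.\<close>

lemma v_eq_hmin:
  assumes f: "f \<noteq> 0"
    and inj: "inj_on (\<lambda>u. hval u (lookup (\<psi> f) u)) (keys (\<psi> f))"
  shows "v f = hmin f"
proof (rule antisym)
  show "hmin f \<le> v f" using f by (rule hmin_le_v)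
  obtain c where c: "f = (\<Sum>u\<in>keys (\<psi> f). c u)"
    "\<forall>u\<in>keys (\<psi> f). c u \<noteq> 0 \<and> v (c u) = hval u (lookup (\<psi> f) u)"
    by (rule component_sum)
  obtain u0 where u0: "u0 \<in> keys (\<psi> f)" "hmin f = hval u0 (lookup (\<psi> f) u0)"
    using hmin_attained[OF f] by blast
  show "v f \<le> hmin f"
  proof (rule ccontr)
    assume "\<not> v f \<le> hmin f"
    then have gt: "hmin f < v f" by simp
    define K where "K = keys (\<psi> f)"
    \<comment> \<open>The index \<open>None\<close> stands for \<open>f\<close> itself.\<close>
    have rest: "c u0 = (\<Sum>u\<in>insert None (Some ` (K - {u0})). case u of None \<Rightarrow> f | Some u \<Rightarrow> - c u)"
    proof -
      have "f = c u0 + (\<Sum>u\<in>K - {u0}. c u)"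
        using c(1) u0(1) unfolding K_def by (metis finite_keys sum.remove)
      then have "c u0 = f - (\<Sum>u\<in>K - {u0}. c u)"
        by (metis add_diff_cancel_right')
      moreover have "finite K" by (simp add: K_def)
      ultimately show ?thesis
        by (subst sum.insert) (auto simp: sum.reindex sum_negf)
    qed
    have v_neg: "v (- c u) = v (c u)" if "u \<in> K" for u
      using c(2) that by (intro v_uminus) (simp add: K_def)
    have "hmin f < v (c u0)"
      unfolding rest
    proof (rule v_sum_gt)
      show "(\<Sum>u\<in>insert None (Some ` (K - {u0})). case u of None \<Rightarrow> f | Some u \<Rightarrow> - c u) \<noteq> 0"
        unfolding rest[symmetric] using c(2) u0(1) by blast
      fix x assume x: "x \<in> insert None (Some ` (K - {u0}))"
      show "hmin f < v (case x of None \<Rightarrow> f | Some u \<Rightarrow> - c u)"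
      proof (cases x)
        case (Some u)
        then have u: "u \<in> K" "u \<noteq> u0" using x by auto
        then have "hval u (lookup (\<psi> f) u) \<noteq> hmin f"
          using inj u0 by (auto simp: K_def dest: inj_onD)
        then show ?thesis using Some u hmin_le[of u f] c(2) u(1) v_neg[OF u(1)] by (auto simp: K_def)
      qed (use gt in simp)
    qed (simp add: K_def)
    then show False using c(2) u0 by simp
  qed
qed

section \<open>Full rank\<close>

text \<open>A relation involving a nonzero weight expresses the value of one coordinate character by
  \<open>\<gamma>\<close> and the values of the other ones, so that \<open>d\<close> vectors span all values.\<close>

lemma full_rank_independent:
  assumes rank: "q_dim (rat_vec ` group_hull (value_semigroup v)) = Suc d"
    and span: "\<And>f. f \<noteq> 0 \<Longrightarrow> rat_vec (v f) \<in> qvs.span (insert (rat_vec \<gamma>) ((\<lambda>i. rat_vec (hval (single i 1) 1)) ` {..<d}))"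
    and u: "u \<in> coords {..<d}" and rel: "pm_scale n \<gamma> + hval u 1 = 0"
  shows "u = 0"
proof (rule ccontr)
  assume "u \<noteq> 0"
  then obtain j where "lookup u j \<noteq> 0" by (metis lookup_zero poly_mapping_eqI)
  then have j: "j < d" "lookup u j \<noteq> 0" using u by (auto simp: coords_iff)
  let ?e = "\<lambda>i. rat_vec (hval (single i 1) 1)"
  let ?B = "insert (rat_vec \<gamma>) (?e ` ({..<d} - {j}))"
  have "rat_vec (hval u 1) = (\<Sum>i<d. pm_scale (of_int (lookup u i)) (?e i))"
    by (simp add: hval_1_expand[OF u] rat_vec_sum rat_vec_pm_scale)
  also have "\<dots> = pm_scale (of_int (lookup u j)) (?e j) + (\<Sum>i\<in>{..<d} - {j}. pm_scale (of_int (lookup u i)) (?e i))"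
    using j by (intro sum.remove) auto
  finally have eq: "pm_scale (of_int (lookup u j)) (?e j) =
      - (pm_scale (of_int n) (rat_vec \<gamma>) + (\<Sum>i\<in>{..<d} - {j}. pm_scale (of_int (lookup u i)) (?e i)))"
    using arg_cong[OF rel, of rat_vec] by (simp add: rat_vec_add rat_vec_pm_scale algebra_simps eq_neg_iff_add_eq_0)
  have "pm_scale (of_int (lookup u j)) (?e j) \<in> qvs.span ?B"
    unfolding eq by (intro qvs.span_neg qvs.span_add qvs.span_sum qvs.span_scale qvs.span_base) auto
  then have "pm_scale (1 / of_int (lookup u j)) (pm_scale (of_int (lookup u j)) (?e j)) \<in> qvs.span ?B"
    by (rule qvs.span_scale)
  then have ej: "?e j \<in> qvs.span ?B" using j(2) by (simp add: pm_scale_pm_scale)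
  have "insert (rat_vec \<gamma>) (?e ` {..<d}) \<subseteq> qvs.span ?B"
  proof
    fix x assume "x \<in> insert (rat_vec \<gamma>) (?e ` {..<d})"
    then have "x = ?e j \<or> x \<in> ?B" by auto
    then show "x \<in> qvs.span ?B" using ej qvs.span_base by metis
  qed
  then have "qvs.span (insert (rat_vec \<gamma>) (?e ` {..<d})) \<subseteq> qvs.span ?B"
    by (simp add: qvs.span_minimal)
  then have "rat_vec ` value_semigroup v \<subseteq> qvs.span ?B"
    using span by (force simp: value_semigroup_def)
  then have "rat_vec ` group_hull (value_semigroup v) \<subseteq> qvs.span ?B"
    by (rule rat_vec_group_hull_subset_span)
  then have "q_dim (rat_vec ` group_hull (value_semigroup v)) \<le> card ?B"
    unfolding q_dim_def by (intro qvs.dim_le_card) auto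
  also have "\<dots> \<le> Suc (card ({..<d} - {j}))"
    using card_image_le[of "{..<d} - {j}" ?e] by (intro order_trans[OF card_insert_le_m1]) (auto simp: card_insert_if)
  also have "\<dots> = d" using j(1) by simp
  finally show False using rank by simp
qed

end

section \<open>Polynomials in the generators and their initial forms\<close>

lemma poly_mapping_sum_singles: "p = (\<Sum>\<alpha>\<in>keys p. single \<alpha> (lookup p \<alpha>))"
  by (rule poly_mapping_eqI) (auto simp: lookup_sum lookup_single when_def in_keys_iff)

lemma poly_ring_0 [simp]: "0 \<in> poly_ring H"
  by (simp add: poly_ring_def)

lemma poly_ring_add: "p \<in> poly_ring H \<Longrightarrow> q \<in> poly_ring H \<Longrightarrow> p + q \<in> poly_ring H"
  for p :: "('x \<Rightarrow>\<^sub>0 nat) \<Rightarrow>\<^sub>0 'k::comm_ring_1"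
  using keys_add[of p q] by (auto simp: poly_ring_def)

lemma poly_ring_diff: "p \<in> poly_ring H \<Longrightarrow> q \<in> poly_ring H \<Longrightarrow> p - q \<in> poly_ring H"
  for p :: "('x \<Rightarrow>\<^sub>0 nat) \<Rightarrow>\<^sub>0 'k::comm_ring_1"
  using keys_diff[of p q] by (auto simp: poly_ring_def)

lemma poly_ring_sum: "(\<And>x. x \<in> A \<Longrightarrow> f x \<in> poly_ring H) \<Longrightarrow> sum f A \<in> poly_ring H"
  for f :: "'a \<Rightarrow> ('x \<Rightarrow>\<^sub>0 nat) \<Rightarrow>\<^sub>0 'k::comm_ring_1"
  by (induction A rule: infinite_finite_induct) (auto intro: poly_ring_add)

lemma poly_ring_mult: "p \<in> poly_ring H \<Longrightarrow> q \<in> poly_ring H \<Longrightarrow> p * q \<in> poly_ring H"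
  for p :: "('x \<Rightarrow>\<^sub>0 nat) \<Rightarrow>\<^sub>0 'k::comm_ring_1"
  using keys_mult[of p q] by (fastforce simp: poly_ring_def intro: coords_add)

lemma poly_ring_single: "\<alpha> \<in> coords H \<Longrightarrow> single \<alpha> c \<in> poly_ring H"
  by (auto simp: poly_ring_def)

lemma poly_ring_1 [simp]: "1 \<in> poly_ring H"
  by (simp add: poly_ring_def)

lemma ideal_gen_memI:
  "finite F \<Longrightarrow> F \<subseteq> S \<Longrightarrow> (\<And>g. g \<in> F \<Longrightarrow> c g \<in> poly_ring H) \<Longrightarrow> (\<Sum>g\<in>F. c g * g) \<in> ideal_gen H S"
  unfolding ideal_gen_def by blast

lemma ideal_gen_incl: "s \<in> S \<Longrightarrow> s \<in> ideal_gen H S"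
  using ideal_gen_memI[of "{s}" S "\<lambda>_. 1" H] by simp

lemma ideal_gen_0: "0 \<in> ideal_gen H S"
  using ideal_gen_memI[of "{}" S "\<lambda>_. 1" H] by simp

lemma ideal_gen_add:
  assumes "x \<in> ideal_gen H S" "y \<in> ideal_gen H S"
  shows "x + y \<in> ideal_gen H S"
proof -
  obtain F c where F: "finite F" "F \<subseteq> S" "c ` F \<subseteq> poly_ring H" "x = (\<Sum>g\<in>F. c g * g)"
    using assms(1) unfolding ideal_gen_def by blast
  obtain F' c' where F': "finite F'" "F' \<subseteq> S" "c' ` F' \<subseteq> poly_ring H" "y = (\<Sum>g\<in>F'. c' g * g)"
    using assms(2) unfolding ideal_gen_def by blast
  define e where "e g = (if g \<in> F then c g else 0) + (if g \<in> F' then c' g else 0)" for g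
  have "(\<Sum>g\<in>F \<union> F'. e g * g) =
      (\<Sum>g\<in>F \<union> F'. (if g \<in> F then c g else 0) * g) + (\<Sum>g\<in>F \<union> F'. (if g \<in> F' then c' g else 0) * g)"
    by (simp add: e_def distrib_right sum.distrib)
  also have "(\<Sum>g\<in>F \<union> F'. (if g \<in> F then c g else 0) * g) = x"
    unfolding F(4) by (rule sum.mono_neutral_cong_right) (use F F' in auto)
  also have "(\<Sum>g\<in>F \<union> F'. (if g \<in> F' then c' g else 0) * g) = y"
    unfolding F'(4) by (rule sum.mono_neutral_cong_right) (use F F' in auto)
  finally have "x + y = (\<Sum>g\<in>F \<union> F'. e g * g)" ..
  also have "\<dots> \<in> ideal_gen H S"
    by (rule ideal_gen_memI) (use F F' in \<open>auto simp: e_def image_subset_iff intro!: poly_ring_add\<close>)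
  finally show ?thesis .
qed

lemma ideal_gen_mult:
  assumes "c \<in> poly_ring H" "x \<in> ideal_gen H S"
  shows "c * x \<in> ideal_gen H S"
proof -
  obtain F e where F: "finite F" "F \<subseteq> S" "e ` F \<subseteq> poly_ring H" "x = (\<Sum>g\<in>F. e g * g)"
    using assms(2) unfolding ideal_gen_def by blast
  have "c * x = (\<Sum>g\<in>F. (c * e g) * g)" by (simp add: F(4) sum_distrib_left mult.assoc)
  also have "\<dots> \<in> ideal_gen H S"
    by (rule ideal_gen_memI) (use F assms(1) in \<open>auto simp: image_subset_iff intro!: poly_ring_mult\<close>)
  finally show ?thesis .
qed

lemma ideal_gen_sum: "(\<And>x. x \<in> A \<Longrightarrow> f x \<in> ideal_gen H S) \<Longrightarrow> sum f A \<in> ideal_gen H S"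
  by (induction A rule: infinite_finite_induct) (auto intro: ideal_gen_add ideal_gen_0)

lemma ideal_gen_least: "S \<subseteq> ideal_gen H T \<Longrightarrow> ideal_gen H S \<subseteq> ideal_gen H T"
  unfolding ideal_gen_def[of H S] by (auto intro!: ideal_gen_sum ideal_gen_mult)

definition restrict_terms :: "('a \<Rightarrow> bool) \<Rightarrow> ('a \<Rightarrow>\<^sub>0 'k::comm_ring_1) \<Rightarrow> ('a \<Rightarrow>\<^sub>0 'k)" where
  "restrict_terms P p = (\<Sum>\<alpha> | \<alpha> \<in> keys p \<and> P \<alpha>. single \<alpha> (lookup p \<alpha>))"

lemma lookup_restrict_terms:
  "lookup (restrict_terms P p) \<alpha> = (if P \<alpha> then lookup p \<alpha> else 0)"
  by (auto simp: restrict_terms_def lookup_sum lookup_single when_def in_keys_iff)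

lemma keys_restrict_terms: "keys (restrict_terms P p) = {\<alpha> \<in> keys p. P \<alpha>}"
  by (auto simp: in_keys_iff lookup_restrict_terms split: if_splits)

lemma restrict_terms_0 [simp]: "restrict_terms P 0 = 0"
  by (simp add: restrict_terms_def)

lemma restrict_terms_add: "restrict_terms P (p + q) = restrict_terms P p + restrict_terms P q"
  by (rule poly_mapping_eqI) (simp add: lookup_restrict_terms lookup_add)

lemma restrict_terms_sum: "restrict_terms P (sum f A) = (\<Sum>x\<in>A. restrict_terms P (f x))"
  by (induction A rule: infinite_finite_induct) (auto simp: restrict_terms_add)

lemma restrict_terms_poly_ring: "p \<in> poly_ring H \<Longrightarrow> restrict_terms P p \<in> poly_ring H"
  by (auto simp: poly_ring_def keys_restrict_terms)

lemma initial_form_eq: "initial_form \<omega> p = restrict_terms (\<lambda>\<alpha>. \<omega> \<alpha> = min_weight \<omega> p) p"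
  by (simp add: initial_form_def restrict_terms_def)

lemma min_weight_le: "\<alpha> \<in> keys p \<Longrightarrow> min_weight \<omega> p \<le> \<omega> \<alpha>"
  unfolding min_weight_def by (rule Min_le) auto

lemma min_weight_attained:
  assumes "p \<noteq> 0"
  obtains \<alpha> where "\<alpha> \<in> keys p" "min_weight \<omega> p = \<omega> \<alpha>"
proof -
  have "min_weight \<omega> p \<in> \<omega> ` keys p"
    unfolding min_weight_def using assms by (intro Min_in) auto
  then show ?thesis using that by blast
qed

lemma eq_min_weight_iff:
  assumes "\<alpha> \<in> keys p"
  shows "\<omega> \<alpha> = min_weight \<omega> p \<longleftrightarrow> (\<forall>\<beta>\<in>keys p. \<omega> \<alpha> \<le> \<omega> \<beta>)"
proof
  assume "\<forall>\<beta>\<in>keys p. \<omega> \<alpha> \<le> \<omega> \<beta>"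
  moreover have "p \<noteq> 0" using assms by auto
  ultimately show "\<omega> \<alpha> = min_weight \<omega> p"
    using min_weight_attained[of p \<omega>] min_weight_le[OF assms, of \<omega>] by (metis antisym)
qed (auto intro: min_weight_le)

lemma restrict_terms_cong:
  "(\<And>\<alpha>. \<alpha> \<in> keys p \<Longrightarrow> P \<alpha> \<longleftrightarrow> Q \<alpha>) \<Longrightarrow> restrict_terms P p = restrict_terms Q p"
  by (rule poly_mapping_eqI) (auto simp: lookup_restrict_terms in_keys_iff)

lemma initial_form_cong:
  assumes "\<And>\<alpha> \<beta>. \<alpha> \<in> keys p \<Longrightarrow> \<beta> \<in> keys p \<Longrightarrow> \<omega> \<alpha> \<le> \<omega> \<beta> \<longleftrightarrow> \<omega>' \<alpha> \<le> \<omega>' \<beta>"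
  shows "initial_form \<omega> p = initial_form \<omega>' p"
  unfolding initial_form_eq
  by (rule restrict_terms_cong) (use assms in \<open>simp add: eq_min_weight_iff\<close>)

text \<open>The character of a monomial: \<open>x\<^sup>\<alpha>\<close> is mapped to the character \<open>hdeg \<alpha>\<close> of the lattice
  \<open>M \<times> \<int>\<^sup>m\<close>.\<close>

definition hdeg :: "(lat \<Rightarrow>\<^sub>0 nat) \<Rightarrow> lat" where
  "hdeg \<alpha> = (\<Sum>h\<in>keys \<alpha>. iscale2 (int (lookup \<alpha> h)) h)"

lemma iscale2_add_left: "iscale2 (n + k) h = iscale2 n h + iscale2 k h"
  by (simp add: iscale2_def pm_scale_add_left)

lemma iscale2_simps [simp]: "iscale2 0 h = 0" "iscale2 1 h = h"
  by (simp_all add: iscale2_def zero_prod_def)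

text \<open>Degrees and weights of monomials are sums over the support of the exponent, which is not
  additive; the sums can be compared over the union of two supports.\<close>

lemma additive_over_exponents:
  fixes f :: "nat \<Rightarrow> 'x \<Rightarrow> 'a::comm_monoid_add"
  assumes "\<And>n k x. f (n + k) x = f n x + f k x" "\<And>x. f 0 x = 0"
  shows "(\<Sum>x\<in>keys (\<alpha> + \<beta>). f (lookup (\<alpha> + \<beta>) x) x) =
    (\<Sum>x\<in>keys \<alpha>. f (lookup \<alpha> x) x) + (\<Sum>x\<in>keys \<beta>. f (lookup \<beta> x) x)"
proof -
  let ?K = "keys \<alpha> \<union> keys \<beta>"
  have ext: "(\<Sum>x\<in>keys \<gamma>. f (lookup \<gamma> x) x) = (\<Sum>x\<in>?K. f (lookup \<gamma> x) x)"
    if "keys \<gamma> \<subseteq> ?K" for \<gamma>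
    by (rule sum.mono_neutral_left) (use that assms(2) in \<open>auto simp: in_keys_iff\<close>)
  show ?thesis
    unfolding ext[OF keys_add] ext[OF Un_upper1] ext[OF Un_upper2]
    by (simp add: lookup_add assms(1) sum.distrib)
qed

lemma hdeg_add: "hdeg (\<alpha> + \<beta>) = hdeg \<alpha> + hdeg \<beta>"
  unfolding hdeg_def
  by (rule additive_over_exponents[of "\<lambda>n. iscale2 (int n)"]) (simp_all add: iscale2_add_left)

lemma hdeg_0 [simp]: "hdeg 0 = 0"
  by (simp add: hdeg_def)

lemma hdeg_single [simp]: "hdeg (single h (Suc 0)) = h"
  by (simp add: hdeg_def)

lemma mat_weight_add: "mat_weight W (\<alpha> + \<beta>) = mat_weight W \<alpha> + mat_weight W \<beta>"
  unfolding mat_weight_def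
  by (rule additive_over_exponents[of "\<lambda>n x. pm_scale (of_nat n) (W x)"]) (simp_all add: pm_scale_add_left)

lemma mat_weight_0 [simp]: "mat_weight W 0 = 0"
  by (simp add: mat_weight_def)

lemma mat_weight_single [simp]: "mat_weight W (single h (Suc 0)) = W h"
  by (simp add: mat_weight_def)

lemma exponent_induct [consumes 1, case_names zero add]:
  assumes "\<alpha> \<in> coords H" "P 0"
    and "\<And>h \<alpha>. h \<in> H \<Longrightarrow> \<alpha> \<in> coords H \<Longrightarrow> P \<alpha> \<Longrightarrow> P (single h 1 + \<alpha>)"
  shows "P (\<alpha> :: 'x \<Rightarrow>\<^sub>0 nat)"
  using assms(1)
proof (induction "\<Sum>h\<in>keys \<alpha>. lookup \<alpha> h" arbitrary: \<alpha> rule: less_induct)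
  case less
  show ?case
  proof (cases "\<alpha> = 0")
    case False
    then obtain h where h: "h \<in> keys \<alpha>" by (metis keys_eq_empty ex_in_conv)
    define \<beta> where "\<beta> = \<alpha> - single h 1"
    have l\<beta>: "lookup \<beta> x = (if x = h then lookup \<alpha> x - 1 else lookup \<alpha> x)" for x
      by (simp add: \<beta>_def lookup_minus lookup_single when_def)
    have \<alpha>: "\<alpha> = single h 1 + \<beta>"
      by (rule poly_mapping_eqI) (use h in \<open>auto simp: l\<beta> lookup_add lookup_single when_def in_keys_iff\<close>)
    have "\<beta> \<in> coords H" using less.prems by (auto simp: coords_iff l\<beta>)
    moreover have "(\<Sum>h\<in>keys \<beta>. lookup \<beta> h) < (\<Sum>h\<in>keys \<alpha>. lookup \<alpha> h)"
      using additive_over_exponents[of "\<lambda>n _. n" "single h 1" \<beta>] unfolding \<alpha>[symmetric] by simp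
    ultimately have "P \<beta>" using less.hyps by blast
    moreover have "h \<in> H" using h less.prems by (auto simp: coords_def)
    ultimately show ?thesis using assms(3) \<open>\<beta> \<in> coords H\<close> \<alpha> by metis
  qed (use assms(2) in simp)
qed

lemma hdeg_in_monoid_hull: "\<alpha> \<in> coords H \<Longrightarrow> hdeg \<alpha> \<in> monoid_hull H"
  by (induction rule: exponent_induct) (auto simp: hdeg_add monoid_hull.zero intro: monoid_hull.add)

lemma monoid_hull_hdeg: "h \<in> monoid_hull H \<Longrightarrow> \<exists>\<alpha>\<in>coords H. hdeg \<alpha> = h"
proof (induction rule: monoid_hull.induct)
  case zero
  show ?case by (rule bexI[of _ 0]) auto
next
  case (add s x)
  then obtain \<alpha> where "\<alpha> \<in> coords H" "hdeg \<alpha> = x" by blast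
  then show ?case
    using add by (intro bexI[of _ "single s 1 + \<alpha>"]) (auto simp: hdeg_add intro!: coords_add coords_single)
qed

lemma mat_weight_in_monoid_hull: "\<alpha> \<in> coords H \<Longrightarrow> mat_weight W \<alpha> \<in> monoid_hull (W ` H)"
  by (induction rule: exponent_induct) (auto simp: mat_weight_add monoid_hull.zero intro: monoid_hull.add)

lemma const_chi_simps [simp]: "const_chi 0 = 0" "const_chi 1 = 1"
  by (simp_all add: const_chi_def pCons_one)

lemma const_chi_add: "const_chi (a + b) = const_chi a + const_chi b"
  and const_chi_mult: "const_chi (a * b) = const_chi a * const_chi b"
  by (simp_all add: const_chi_def mult_single mult.commute flip: single_add to_fract_add to_fract_mult)

lemma chi_image_0 [simp]: "chi_image m lf 0 = 1"
  by (simp add: chi_image_def)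

lemma chi_image_add:
  "is_linear_embedding D lf \<Longrightarrow> chi_image (pd_m D) lf (h + k) = chi_image (pd_m D) lf h * chi_image (pd_m D) lf k"
  by (simp add: chi_image_def zmon_add mult_single)

lemma prod_chi_image:
  assumes "is_linear_embedding D lf"
  shows "(\<Prod>h\<in>keys \<alpha>. chi_image (pd_m D) lf h ^ lookup \<alpha> h) = chi_image (pd_m D) lf (hdeg \<alpha>)"
proof -
  have sum: "chi_image (pd_m D) lf (sum f A) = (\<Prod>x\<in>A. chi_image (pd_m D) lf (f x))" for f and A :: "lat set"
    by (induction A rule: infinite_finite_induct) (auto simp: chi_image_add[OF assms])
  have pow: "chi_image (pd_m D) lf (iscale2 (int n) h) = chi_image (pd_m D) lf h ^ n" for n h
    by (induction n) (auto simp: iscale2_add_left chi_image_add[OF assms])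
  show ?thesis unfolding hdeg_def sum by (simp add: pow)
qed

lemma presentation_eq:
  assumes "is_linear_embedding D lf"
  shows "presentation D lf p =
    (\<Sum>\<alpha>\<in>keys p. const_chi (lookup p \<alpha>) * chi_image (pd_m D) lf (hdeg \<alpha>))"
  by (simp add: presentation_def mp_eval_def prod_chi_image[OF assms])

lemma presentation_eq_superset:
  assumes "is_linear_embedding D lf" "finite K" "keys p \<subseteq> K"
  shows "presentation D lf p =
    (\<Sum>\<alpha>\<in>K. const_chi (lookup p \<alpha>) * chi_image (pd_m D) lf (hdeg \<alpha>))"
  unfolding presentation_eq[OF assms(1)]
  by (rule sum.mono_neutral_left) (use assms in \<open>auto simp: in_keys_iff\<close>)

lemma presentation_0 [simp]: "presentation D lf 0 = 0"
  by (simp add: presentation_def mp_eval_def)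

lemma presentation_add:
  assumes "is_linear_embedding D lf"
  shows "presentation D lf (p + q) = presentation D lf p + presentation D lf q"
  using keys_add[of p q]
  by (simp add: presentation_eq_superset[OF assms, of "keys p \<union> keys q"]
      lookup_add const_chi_add distrib_right sum.distrib)

lemma presentation_sum:
  assumes "is_linear_embedding D lf"
  shows "presentation D lf (sum f A) = (\<Sum>x\<in>A. presentation D lf (f x))"
  by (induction A rule: infinite_finite_induct) (auto simp: presentation_add[OF assms])

lemma presentation_diff:
  assumes "is_linear_embedding D lf"
  shows "presentation D lf (p - q) = presentation D lf p - presentation D lf q"
  using presentation_add[OF assms, of "p - q" q] by simp

lemma presentation_single:
  assumes "is_linear_embedding D lf"
  shows "presentation D lf (single \<alpha> c) = const_chi c * chi_image (pd_m D) lf (hdeg \<alpha>)"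
  using presentation_eq_superset[OF assms, of "{\<alpha>}" "single \<alpha> c"] by simp

lemma presentation_mult:
  assumes "is_linear_embedding D lf"
  shows "presentation D lf (p * q) = presentation D lf p * presentation D lf q"
proof -
  have "p * q = (\<Sum>\<alpha>\<in>keys p. \<Sum>\<beta>\<in>keys q.
      single (\<alpha> + \<beta>) (lookup p \<alpha> * lookup q \<beta>))"
    by (subst (1) poly_mapping_sum_singles[of p], subst (1) poly_mapping_sum_singles[of q])
      (simp add: sum_product mult_single)
  then have "presentation D lf (p * q) = (\<Sum>\<alpha>\<in>keys p. \<Sum>\<beta>\<in>keys q.
      (const_chi (lookup p \<alpha>) * chi_image (pd_m D) lf (hdeg \<alpha>)) *
      (const_chi (lookup q \<beta>) * chi_image (pd_m D) lf (hdeg \<beta>)))"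
    by (simp add: presentation_sum[OF assms] presentation_single[OF assms] const_chi_mult hdeg_add
        chi_image_add[OF assms] mult_ac)
  then show ?thesis
    by (simp add: sum_product presentation_eq[OF assms])
qed

lemma const_mult_chi_image:
  "const_chi c * chi_image m lf h = single (fst h) (to_fract [:c:] * zmon m lf (snd h))"
  by (simp add: const_chi_def chi_image_def mult_single)

text \<open>The presentation is graded by the weight lattice, so its kernel is a homogeneous ideal.\<close>

lemma presentation_weight_component:
  assumes "is_linear_embedding D lf"
  shows "presentation D lf (restrict_terms (\<lambda>\<alpha>. fst (hdeg \<alpha>) = u) p) =
    single u (lookup (presentation D lf p) u)"
proof -
  let ?t = "\<lambda>\<alpha>. to_fract [:lookup p \<alpha>:] * zmon (pd_m D) lf (snd (hdeg \<alpha>))"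
  let ?K = "{\<alpha> \<in> keys p. fst (hdeg \<alpha>) = u}"
  have "presentation D lf (restrict_terms (\<lambda>\<alpha>. fst (hdeg \<alpha>) = u) p) = (\<Sum>\<alpha>\<in>?K. single u (?t \<alpha>))"
    unfolding presentation_eq[OF assms] keys_restrict_terms
    by (rule sum.cong) (auto simp: lookup_restrict_terms const_mult_chi_image)
  also have "\<dots> = single u (\<Sum>\<alpha>\<in>?K. ?t \<alpha>)"
  proof -
    have "(\<Sum>\<alpha>\<in>A. single u (t \<alpha>)) = single u (\<Sum>\<alpha>\<in>A. t \<alpha>)"
      for A and t :: "(lat \<Rightarrow>\<^sub>0 nat) \<Rightarrow> 'a poly fract"
      by (induction A rule: infinite_finite_induct) (auto simp: single_add)
    then show ?thesis .
  qed
  also have "(\<Sum>\<alpha>\<in>?K. ?t \<alpha>) = lookup (presentation D lf p) u"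
    unfolding presentation_eq[OF assms] lookup_sum const_mult_chi_image lookup_single when_def
    by (simp add: sum.inter_filter)
  finally show ?thesis .
qed

lemma J_ideal_mult: "is_linear_embedding D lf \<Longrightarrow> c \<in> poly_ring H \<Longrightarrow> q \<in> J_ideal D lf H \<Longrightarrow> c * q \<in> J_ideal D lf H"
  by (simp add: J_ideal_def presentation_mult poly_ring_mult)

lemma J_ideal_sum: "is_linear_embedding D lf \<Longrightarrow> (\<And>x. x \<in> A \<Longrightarrow> f x \<in> J_ideal D lf H) \<Longrightarrow> sum f A \<in> J_ideal D lf H"
  by (simp add: J_ideal_def presentation_sum poly_ring_sum)

lemma J_ideal_component:
  "is_linear_embedding D lf \<Longrightarrow> p \<in> J_ideal D lf H \<Longrightarrow> restrict_terms (\<lambda>\<alpha>. fst (hdeg \<alpha>) = u) p \<in> J_ideal D lf H"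
  by (simp add: J_ideal_def presentation_weight_component restrict_terms_poly_ring)

text \<open>As \<open>J\<close> is homogeneous for the weight lattice, its initial ideal only depends on how the
  weight orders the exponents of a common weight.\<close>

lemma initial_ideal_subset:
  assumes lf: "is_linear_embedding D lf"
    and le: "\<And>\<alpha> \<beta>. \<alpha> \<in> coords H \<Longrightarrow> \<beta> \<in> coords H \<Longrightarrow> fst (hdeg \<alpha>) = fst (hdeg \<beta>) \<Longrightarrow>
      \<omega> \<alpha> \<le> \<omega> \<beta> \<longleftrightarrow> \<omega>' \<alpha> \<le> \<omega>' \<beta>"
  shows "initial_ideal H \<omega> (J_ideal D lf H) \<subseteq> initial_ideal H \<omega>' (J_ideal D lf H)"
  unfolding initial_ideal_def
proof (rule ideal_gen_least, rule image_subsetI)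
  let ?I = "ideal_gen H (initial_form \<omega>' ` J_ideal D lf H)"
  fix p assume p: "p \<in> J_ideal D lf H"
  define \<mu> where "\<mu> = min_weight \<omega> p"
  define pu where "pu u = restrict_terms (\<lambda>\<alpha>. fst (hdeg \<alpha>) = u) p" for u
  let ?U = "(\<lambda>\<alpha>. fst (hdeg \<alpha>)) ` keys p"
  have "p = (\<Sum>u\<in>?U. pu u)"
    by (rule poly_mapping_eqI) (auto simp: pu_def lookup_sum lookup_restrict_terms in_keys_iff)
  then have "initial_form \<omega> p = (\<Sum>u\<in>?U. restrict_terms (\<lambda>\<alpha>. \<omega> \<alpha> = \<mu>) (pu u))"
    unfolding initial_form_eq \<mu>_def[symmetric] restrict_terms_sum[symmetric] by simp
  also have "\<dots> \<in> ?I"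
  proof (rule ideal_gen_sum)
    fix u assume "u \<in> ?U"
    have puJ: "pu u \<in> J_ideal D lf H" unfolding pu_def by (rule J_ideal_component[OF lf p])
    have keys: "\<alpha> \<in> keys p" "\<alpha> \<in> coords H" "fst (hdeg \<alpha>) = u" if "\<alpha> \<in> keys (pu u)" for \<alpha>
      using that p by (auto simp: pu_def keys_restrict_terms J_ideal_def poly_ring_def)
    show "restrict_terms (\<lambda>\<alpha>. \<omega> \<alpha> = \<mu>) (pu u) \<in> ?I"
    proof (cases "\<exists>\<alpha>\<in>keys (pu u). \<omega> \<alpha> = \<mu>")
      case True
      then obtain \<alpha> where \<alpha>: "\<alpha> \<in> keys (pu u)" "\<omega> \<alpha> = \<mu>" by blast
      have "\<mu> \<le> \<omega> \<beta>" if "\<beta> \<in> keys (pu u)" for \<beta>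
        unfolding \<mu>_def by (rule min_weight_le) (rule keys(1)[OF that])
      then have "\<forall>\<beta>\<in>keys (pu u). \<omega> \<alpha> \<le> \<omega> \<beta>" using \<alpha>(2) by simp
      then have "\<omega> \<alpha> = min_weight \<omega> (pu u)" using eq_min_weight_iff[OF \<alpha>(1)] by blast
      then have "restrict_terms (\<lambda>\<alpha>. \<omega> \<alpha> = \<mu>) (pu u) = initial_form \<omega> (pu u)"
        using \<alpha>(2) by (simp add: initial_form_eq)
      also have "\<dots> = initial_form \<omega>' (pu u)"
        by (rule initial_form_cong, rule le) (use keys in auto)
      finally show ?thesis using puJ by (auto intro: ideal_gen_incl)
    next
      case False
      then have "restrict_terms (\<lambda>\<alpha>. \<omega> \<alpha> = \<mu>) (pu u) = 0"
        by (intro poly_mapping_eqI) (auto simp: lookup_restrict_terms in_keys_iff)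
      then show ?thesis by (simp add: ideal_gen_0)
    qed
  qed
  finally show "initial_form \<omega> p \<in> ?I" .
qed

lemma initial_ideal_eq:
  assumes "is_linear_embedding D lf"
    and "\<And>\<alpha> \<beta>. \<alpha> \<in> coords H \<Longrightarrow> \<beta> \<in> coords H \<Longrightarrow> fst (hdeg \<alpha>) = fst (hdeg \<beta>) \<Longrightarrow>
      \<omega> \<alpha> \<le> \<omega> \<beta> \<longleftrightarrow> \<omega>' \<alpha> \<le> \<omega>' \<beta>"
  shows "initial_ideal H \<omega> (J_ideal D lf H) = initial_ideal H \<omega>' (J_ideal D lf H)"
  using assms by (intro equalityI initial_ideal_subset) auto

text \<open>Multiplication by a homogeneous element shifts all weights by the same amount.\<close>

lemma restrict_terms_mult_homogeneous:
  fixes \<omega> :: "('x \<Rightarrow>\<^sub>0 nat) \<Rightarrow> 'w::linordered_ab_group_add"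
  assumes add: "\<And>\<alpha> \<beta>. \<omega> (\<alpha> + \<beta>) = \<omega> \<alpha> + \<omega> \<beta>"
    and g: "\<And>\<alpha>. \<alpha> \<in> keys g \<Longrightarrow> \<omega> \<alpha> = \<mu>"
  shows "restrict_terms (\<lambda>\<alpha>. \<omega> \<alpha> = \<omega>0) (c * g) = restrict_terms (\<lambda>\<alpha>. \<omega> \<alpha> + \<mu> = \<omega>0) c * g"
proof -
  have hom: "restrict_terms (\<lambda>\<alpha>. \<omega> \<alpha> = \<omega>0) (c * g) = (if \<nu> + \<mu> = \<omega>0 then c * g else 0)"
    if c: "\<And>\<alpha>. \<alpha> \<in> keys c \<Longrightarrow> \<omega> \<alpha> = \<nu>" for c \<nu>
  proof (rule poly_mapping_eqI)
    fix \<alpha>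
    have "\<omega> \<alpha> = \<nu> + \<mu>" if "lookup (c * g) \<alpha> \<noteq> 0"
    proof -
      have "\<alpha> \<in> keys (c * g)" using that by (simp add: in_keys_iff)
      then obtain \<beta>1 \<beta>2 where "\<alpha> = \<beta>1 + \<beta>2" "\<beta>1 \<in> keys c" "\<beta>2 \<in> keys g"
        using keys_mult[of c g] by blast
      then show ?thesis using add c g by metis
    qed
    then show "lookup (restrict_terms (\<lambda>\<alpha>. \<omega> \<alpha> = \<omega>0) (c * g)) \<alpha> =
        lookup (if \<nu> + \<mu> = \<omega>0 then c * g else 0) \<alpha>"
      by (cases "lookup (c * g) \<alpha> = 0") (auto simp: lookup_restrict_terms)
  qed
  let ?s = "\<lambda>\<alpha>. single \<alpha> (lookup c \<alpha>)"
  have "restrict_terms (\<lambda>\<alpha>. \<omega> \<alpha> = \<omega>0) (c * g) = (\<Sum>\<alpha>\<in>keys c. restrict_terms (\<lambda>\<alpha>. \<omega> \<alpha> = \<omega>0) (?s \<alpha> * g))"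
    by (subst poly_mapping_sum_singles[of c]) (simp add: sum_distrib_right restrict_terms_sum)
  also have "\<dots> = (\<Sum>\<alpha>\<in>keys c. if \<omega> \<alpha> + \<mu> = \<omega>0 then ?s \<alpha> * g else 0)"
    by (rule sum.cong[OF refl], rule hom) (auto split: if_splits)
  also have "\<dots> = (\<Sum>\<alpha> | \<alpha> \<in> keys c \<and> \<omega> \<alpha> + \<mu> = \<omega>0. ?s \<alpha> * g)"
    by (simp add: sum.inter_filter)
  finally show ?thesis by (simp add: restrict_terms_def sum_distrib_right)
qed

text \<open>In an expression \<open>\<Sum> c\<^sub>g in(p\<^sub>g)\<close> of the monomial keep only the terms of its own weight and
  replace \<open>in(p\<^sub>g)\<close> by \<open>p\<^sub>g\<close>. The result lies in \<open>J\<close>, and the replacement only adds terms of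
  larger weight.\<close>

lemma monomial_in_initial_ideal:
  fixes \<omega> :: "(lat \<Rightarrow>\<^sub>0 nat) \<Rightarrow> 'w::linordered_ab_group_add"
  assumes lf: "is_linear_embedding D lf"
    and add: "\<And>\<alpha> \<beta>. \<omega> (\<alpha> + \<beta>) = \<omega> \<alpha> + \<omega> \<beta>"
    and mon: "single \<alpha> c \<in> initial_ideal H \<omega> (J_ideal D lf H)"
  obtains q where "single \<alpha> c + q \<in> J_ideal D lf H"
    "\<And>\<beta>. \<beta> \<in> keys q \<Longrightarrow> \<omega> \<alpha> < \<omega> \<beta>"
proof -
  obtain F e where F: "finite F" "F \<subseteq> initial_form \<omega> ` J_ideal D lf H" "e ` F \<subseteq> poly_ring H"
    "single \<alpha> c = (\<Sum>g\<in>F. e g * g)"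
    using mon unfolding initial_ideal_def ideal_gen_def by blast
  define p where "p g = (SOME p. p \<in> J_ideal D lf H \<and> g = initial_form \<omega> p)" for g
  have p: "p g \<in> J_ideal D lf H" "g = initial_form \<omega> (p g)" if "g \<in> F" for g
  proof -
    have "\<exists>p. p \<in> J_ideal D lf H \<and> g = initial_form \<omega> p" using F(2) that by blast
    then have "p g \<in> J_ideal D lf H \<and> g = initial_form \<omega> (p g)" unfolding p_def by (rule someI_ex)
    then show "p g \<in> J_ideal D lf H" "g = initial_form \<omega> (p g)" by auto
  qed
  define \<mu> where "\<mu> g = min_weight \<omega> (p g)" for g
  define e' where "e' g = restrict_terms (\<lambda>\<beta>. \<omega> \<beta> + \<mu> g = \<omega> \<alpha>) (e g)" for g
  define q where "q = (\<Sum>g\<in>F. e' g * (p g - g))"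
  have g_keys: "\<omega> \<beta> = \<mu> g" if "g \<in> F" "\<beta> \<in> keys g" for g \<beta>
    using that(2) by (subst (asm) p(2)[OF that(1)]) (simp add: initial_form_eq keys_restrict_terms \<mu>_def)
  have "single \<alpha> c = restrict_terms (\<lambda>\<beta>. \<omega> \<beta> = \<omega> \<alpha>) (single \<alpha> c)"
    by (rule poly_mapping_eqI) (auto simp: lookup_restrict_terms lookup_single when_def)
  also have "\<dots> = (\<Sum>g\<in>F. e' g * g)"
    unfolding F(4) restrict_terms_sum e'_def
    by (rule sum.cong[OF refl], rule restrict_terms_mult_homogeneous) (use add g_keys in auto)
  finally have "single \<alpha> c + q = (\<Sum>g\<in>F. e' g * p g)"
    by (simp add: q_def right_diff_distrib sum_subtractf)
  also have "\<dots> \<in> J_ideal D lf H"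
    by (intro J_ideal_sum[OF lf] J_ideal_mult[OF lf] p(1)) (use F(3) in \<open>auto simp: e'_def intro: restrict_terms_poly_ring\<close>)
  finally have J: "single \<alpha> c + q \<in> J_ideal D lf H" .
  have "\<omega> \<alpha> < \<omega> \<beta>" if \<beta>q: "\<beta> \<in> keys q" for \<beta>
  proof -
    obtain g where g: "g \<in> F" "\<beta> \<in> keys (e' g * (p g - g))"
      using \<beta>q keys_sum[of "\<lambda>g. e' g * (p g - g)" F] unfolding q_def by blast
    then obtain \<beta>1 \<beta>2 where \<beta>: "\<beta> = \<beta>1 + \<beta>2" "\<beta>1 \<in> keys (e' g)" "\<beta>2 \<in> keys (p g - g)"
      using keys_mult[of "e' g" "p g - g"] by blast
    have "\<omega> \<beta>1 + \<mu> g = \<omega> \<alpha>" using \<beta>(2) by (simp add: e'_def keys_restrict_terms)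
    moreover have "lookup (p g - g) \<beta>2 = (if \<omega> \<beta>2 = \<mu> g then 0 else lookup (p g) \<beta>2)"
      by (subst (2) p(2)[OF g(1)]) (simp add: lookup_minus initial_form_eq lookup_restrict_terms \<mu>_def)
    then have "\<beta>2 \<in> keys (p g)" "\<omega> \<beta>2 \<noteq> \<mu> g"
      using \<beta>(3) by (auto simp: in_keys_iff split: if_splits)
    then have "\<mu> g < \<omega> \<beta>2" using min_weight_le[of \<beta>2 "p g" \<omega>] by (simp add: \<mu>_def)
    ultimately show ?thesis by (metis \<beta>(1) add add_less_cancel_left)
  qed
  then show ?thesis using that J by blast
qed

section \<open>Valuations on a semi-canonical presentation\<close>

lemma pm_scale_mono_iff:
  fixes \<gamma> :: "nat \<Rightarrow>\<^sub>0 int"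
  assumes "0 < \<gamma>"
  shows "pm_scale n \<gamma> \<le> pm_scale k \<gamma> \<longleftrightarrow> n \<le> k"
proof -
  have pos: "0 < pm_scale (int (Suc j)) \<gamma>" for j
  proof (induction j)
    case (Suc j)
    have "pm_scale (int (Suc (Suc j))) \<gamma> = \<gamma> + pm_scale (int (Suc j)) \<gamma>"
      using pm_scale_add_left[of 1 "int (Suc j)" \<gamma>] by simp
    then show ?case using Suc assms by (simp add: add_pos_pos)
  qed (simp add: assms)
  have less: "pm_scale n \<gamma> < pm_scale k \<gamma>" if "n < k" for n k
  proof -
    have "0 < pm_scale (k - n) \<gamma>" using pos[of "nat (k - n - 1)"] that by simp
    then show ?thesis by (simp add: pm_scale_diff_left)
  qed
  show ?thesis
    using less[of n k] less[of k n] by (cases n k rule: linorder_cases) auto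
qed

lemma pm_scale_mono:
  fixes \<gamma> :: "nat \<Rightarrow>\<^sub>0 int"
  assumes "0 \<le> \<gamma>" "n \<le> k"
  shows "pm_scale n \<gamma> \<le> pm_scale k \<gamma>"
  using pm_scale_mono_iff[of \<gamma> n k] assms by (cases "\<gamma> = 0") auto

context presented_valuation
begin

lemma extend_valuation_line_field:
  assumes "g \<noteq> 0"
  shows "extend_valuation v (line_field_embed \<psi> g) = hval 0 g"
proof -
  obtain f1 f2 where f: "is_quotient 0 g f1 f2" using is_quotient_function[OF assms] by blast
  then have nz: "f1 \<noteq> 0" "f2 \<noteq> 0" and \<psi>f: "\<psi> f1 = single 0 g * \<psi> f2"
    by (auto simp: is_quotient_def)
  have "line_field_embed \<psi> g = Fract f1 f2"
    unfolding line_field_embed_def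
  proof (rule the_equality)
    fix q assume "\<exists>h1 h2. h2 \<noteq> 0 \<and> q = Fract h1 h2 \<and> \<psi> h1 = single 0 g * \<psi> h2"
    then obtain h1 h2 where h: "h2 \<noteq> 0" "q = Fract h1 h2" "\<psi> h1 = single 0 g * \<psi> h2" by blast
    have "\<psi> (h1 * f2) = \<psi> (f1 * h2)" by (simp add: psi_mult \<psi>f h(3) mult_ac)
    then show "q = Fract f1 f2" using h nz by (simp add: eq_fract)
  qed (use nz \<psi>f in blast)
  moreover have "extend_valuation v (Fract f1 f2) = v f1 - v f2"
    unfolding extend_valuation_def
  proof (rule the_equality)
    fix a assume "\<exists>h1 h2. h1 \<noteq> 0 \<and> h2 \<noteq> 0 \<and> Fract f1 f2 = Fract h1 h2 \<and> a = v h1 - v h2"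
    then obtain h1 h2 where h: "h1 \<noteq> 0" "h2 \<noteq> 0" "Fract f1 f2 = Fract h1 h2" "a = v h1 - v h2" by blast
    then have "f1 * h2 = h1 * f2" using nz by (simp add: eq_fract)
    then have "\<psi> h1 * \<psi> f2 = single 0 g * \<psi> h2 * \<psi> f2"
      by (metis (no_types, lifting) \<psi>f mult.assoc mult.commute psi_mult)
    then have "\<psi> h1 = single 0 g * \<psi> h2" using nz by simp
    then have "is_quotient 0 g h1 h2" using h by (simp add: is_quotient_def)
    then show "a = v f1 - v f2" using h(4) hval_eq[OF f] hval_eq[of 0 g h1 h2] by simp
  qed (use nz in blast)
  ultimately show ?thesis using hval_eq[OF f] by simp
qed

end

locale semi_canonical_presentation = presented_valuation \<kappa> G v d r D \<psi>
  for \<kappa> :: "'k::alg_closed_field \<Rightarrow> 'r::idom" and G v d r and D :: "'k pdivisor" and \<psi> +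
  fixes lf :: "nat \<Rightarrow> 'k poly" and H :: "lat set"
  assumes lf: "is_linear_embedding D lf"
    and finite_H: "finite H"
    and hull_H: "monoid_hull H = dual_monoid d D"
begin

abbreviation (input) "m \<equiv> pd_m D"

definition hv :: "lat \<Rightarrow> (nat \<Rightarrow>\<^sub>0 int)" where
  "hv h = hval (fst h) (zmon m lf (snd h))"

lemma H_subset: "H \<subseteq> dual_monoid d D"
  using monoid_hull_incl[of _ H] by (auto simp: hull_H)

lemma dual_monoid_weight:
  "h \<in> dual_monoid d D \<Longrightarrow> fst h \<in> coords {..<d} \<and> fst h \<in> dual_weights d (pd_tail D)"
  by (simp add: dual_monoid_iff[OF D] dual_weights_def)

lemma generator_weight: "h \<in> H \<Longrightarrow> fst h \<in> coords {..<d}"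
  using H_subset dual_monoid_weight by blast

lemma hv_add: "fst h \<in> coords {..<d} \<Longrightarrow> fst k \<in> coords {..<d} \<Longrightarrow> hv (h + k) = hv h + hv k"
  by (simp add: hv_def zmon_add[OF lf] hval_mult zmon_nonzero[OF lf])

lemma hv_0 [simp]: "hv 0 = 0"
  by (simp add: hv_def)

lemma hdeg_dual: "\<alpha> \<in> coords H \<Longrightarrow> hdeg \<alpha> \<in> dual_monoid d D"
  using hdeg_in_monoid_hull[of \<alpha> H] by (simp add: hull_H)

lemma mat_weight_eq:
  assumes "\<And>h. h \<in> H \<Longrightarrow> W h = rat_vec (hv h)" "\<alpha> \<in> coords H"
  shows "mat_weight W \<alpha> = rat_vec (hv (hdeg \<alpha>))"
  using assms(2)
proof (induction rule: exponent_induct)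
  case (add h \<alpha>)
  have "hv (h + hdeg \<alpha>) = hv h + hv (hdeg \<alpha>)"
    using add generator_weight hdeg_dual dual_monoid_weight by (intro hv_add) blast+
  then show ?case using add assms(1) by (simp add: mat_weight_add hdeg_add rat_vec_add)
qed simp

lemma hv_in_monoid_hull: "h \<in> dual_monoid d D \<Longrightarrow> hv h \<in> monoid_hull (hv ` H)"
  unfolding hull_H[symmetric]
proof (induction rule: monoid_hull.induct)
  case (add s x)
  have "hv (s + x) = hv s + hv x"
    using add generator_weight hull_H dual_monoid_weight by (intro hv_add) blast+
  then show ?case using add by (simp add: monoid_hull.add)
qed (simp add: monoid_hull.zero)

lemma term_element:
  assumes "h \<in> dual_monoid d D" "c \<noteq> 0"
  obtains f where "f \<noteq> 0" "\<psi> f = const_chi c * chi_image m lf h" "v f = hv h"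
proof -
  obtain f where f: "\<psi> f = single (fst h) (zmon m lf (snd h))"
    using psi_section dual_monoid_weight[OF assms(1)] zmon_in_sections[OF lf D assms(1)] by blast
  have nz: "f \<noteq> 0" using f zmon_nonzero[OF lf] by (metis psi_0 single_eq_0_iff)
  have \<kappa>nz: "\<kappa> c \<noteq> 0"
    using assms(2) by (metis const_chi_def pCons_eq_0_iff psi_0 psi_const single_eq_0_iff to_fract_eq_0_iff)
  have "v f = hv h" using hval_single[OF nz f] by (simp add: hv_def)
  then have "v (\<kappa> c * f) = hv h" using v_mult[OF \<kappa>nz nz] v_const[OF assms(2)] by simp
  moreover have "\<psi> (\<kappa> c * f) = const_chi c * chi_image m lf h"
    by (simp add: psi_mult psi_const f chi_image_def)
  ultimately show ?thesis using that[of "\<kappa> c * f"] nz \<kappa>nz by simp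
qed

lemma generator_element:
  assumes "h \<in> dual_monoid d D"
  obtains f where "f \<noteq> 0" "\<psi> f = chi_image m lf h" "v f = hv h"
  using term_element[OF assms, of 1] by auto

lemma polynomial_terms:
  assumes "p \<in> poly_ring H"
  obtains t where "\<forall>\<alpha>\<in>keys p. t \<alpha> \<noteq> 0 \<and> v (t \<alpha>) = hv (hdeg \<alpha>)"
    "\<psi> (\<Sum>\<alpha>\<in>keys p. t \<alpha>) = presentation D lf p"
proof -
  have "\<exists>f. f \<noteq> 0 \<and> v f = hv (hdeg \<alpha>) \<and> \<psi> f = const_chi (lookup p \<alpha>) * chi_image m lf (hdeg \<alpha>)"
    if "\<alpha> \<in> keys p" for \<alpha>
    using term_element[OF hdeg_dual, of \<alpha> "lookup p \<alpha>"] that assms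
    unfolding poly_ring_def by (metis (mono_tags, lifting) in_keys_iff mem_Collect_eq)
  then obtain t where t: "\<And>\<alpha>. \<alpha> \<in> keys p \<Longrightarrow> t \<alpha> \<noteq> 0 \<and> v (t \<alpha>) = hv (hdeg \<alpha>) \<and>
      \<psi> (t \<alpha>) = const_chi (lookup p \<alpha>) * chi_image m lf (hdeg \<alpha>)"
    by metis
  have "\<psi> (\<Sum>\<alpha>\<in>keys p. t \<alpha>) = presentation D lf p"
    unfolding psi_sum presentation_eq[OF lf] by (rule sum.cong) (use t in auto)
  then show ?thesis using that t by blast
qed

text \<open>The terms of a polynomial representing \<open>f\<close> are elements of known value.\<close>

lemma value_ge:
  assumes "p \<in> poly_ring H" "presentation D lf p = \<psi> f" "f \<noteq> 0"
    "\<And>\<alpha>. \<alpha> \<in> keys p \<Longrightarrow> a \<le> hv (hdeg \<alpha>)"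
  shows "a \<le> v f"
proof -
  obtain t where t: "\<forall>\<alpha>\<in>keys p. t \<alpha> \<noteq> 0 \<and> v (t \<alpha>) = hv (hdeg \<alpha>)"
    "\<psi> (\<Sum>\<alpha>\<in>keys p. t \<alpha>) = presentation D lf p"
    using polynomial_terms[OF assms(1)] by blast
  then have f: "f = (\<Sum>\<alpha>\<in>keys p. t \<alpha>)" using assms(2) by simp
  show ?thesis unfolding f
    by (rule v_sum_ge) (use f t assms(3,4) in auto)
qed

text \<open>Here the weight of a term is its value, so a monomial cannot be cancelled in the coordinate ring
  by terms of larger weight.\<close>

lemma no_monomial_in_initial_ideal:
  assumes W: "\<And>h. h \<in> H \<Longrightarrow> W h = rat_vec (hv h)"
  shows "\<not> contains_monomial H (initial_ideal H (mat_weight W) (J_ideal D lf H))"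
proof
  assume "contains_monomial H (initial_ideal H (mat_weight W) (J_ideal D lf H))"
  then obtain \<alpha> c where \<alpha>: "\<alpha> \<in> coords H" "c \<noteq> 0"
    "single \<alpha> c \<in> initial_ideal H (mat_weight W) (J_ideal D lf H)"
    by (auto simp: contains_monomial_def)
  obtain q where q: "single \<alpha> c + q \<in> J_ideal D lf H"
    "\<And>\<beta>. \<beta> \<in> keys q \<Longrightarrow> mat_weight W \<alpha> < mat_weight W \<beta>"
    using monomial_in_initial_ideal[OF lf mat_weight_add \<alpha>(3)] by blast
  have qH: "q \<in> poly_ring H"
    using poly_ring_diff[of "single \<alpha> c + q" H "single \<alpha> c"] q(1) poly_ring_single[OF \<alpha>(1), of c]
    by (simp add: J_ideal_def)
  have gt: "hv (hdeg \<alpha>) < hv (hdeg \<beta>)" if "\<beta> \<in> keys q" for \<beta>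
    using q(2)[OF that] qH that \<alpha>(1) mat_weight_eq[OF W] by (simp add: poly_ring_def)
  obtain f where f: "f \<noteq> 0" "\<psi> f = const_chi c * chi_image m lf (hdeg \<alpha>)" "v f = hv (hdeg \<alpha>)"
    using term_element[OF hdeg_dual[OF \<alpha>(1)] \<alpha>(2)] by blast
  obtain t where t: "\<forall>\<alpha>\<in>keys q. t \<alpha> \<noteq> 0 \<and> v (t \<alpha>) = hv (hdeg \<alpha>)"
    "\<psi> (\<Sum>\<alpha>\<in>keys q. t \<alpha>) = presentation D lf q"
    using polynomial_terms[OF qH] by blast
  have "\<psi> (f + (\<Sum>\<alpha>\<in>keys q. t \<alpha>)) = 0"
    using q(1) by (simp add: psi_add t(2) f(2) J_ideal_def presentation_add[OF lf] presentation_single[OF lf])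
  then have sum: "(\<Sum>\<alpha>\<in>keys q. t \<alpha>) = - f"
    by (simp add: eq_neg_iff_add_eq_0 add.commute)
  have "hv (hdeg \<alpha>) < v (\<Sum>\<alpha>\<in>keys q. t \<alpha>)"
    by (rule v_sum_gt) (use sum f(1) t(1) gt in auto)
  then show False using sum f v_uminus by simp
qed

lemma generating_set_values: "v ` (generating_set D \<psi> lf H - {0}) = hv ` H"
proof (intro equalityI subsetI)
  fix a assume "a \<in> v ` (generating_set D \<psi> lf H - {0})"
  then obtain f h where f: "f \<noteq> 0" "h \<in> H" "\<psi> f = chi_image m lf h" "a = v f"
    by (auto simp: generating_set_def)
  then have "v f = hv h" using hval_single[OF f(1)] by (simp add: chi_image_def hv_def)
  then show "a \<in> hv ` H" using f by blast
next
  fix a assume "a \<in> hv ` H"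
  then obtain h where h: "h \<in> H" "a = hv h" by blast
  obtain f where "f \<noteq> 0" "\<psi> f = chi_image m lf h" "v f = hv h"
    using generator_element h H_subset by blast
  then show "a \<in> v ` (generating_set D \<psi> lf H - {0})"
    using h by (auto simp: generating_set_def intro!: rev_image_eqI)
qed

lemma value_semigroup_add: "a \<in> value_semigroup v \<Longrightarrow> b \<in> value_semigroup v \<Longrightarrow> a + b \<in> value_semigroup v"
  unfolding value_semigroup_def by (auto simp flip: v_mult intro!: imageI)

lemma monoid_hull_values_subset: "monoid_hull (hv ` H) \<subseteq> value_semigroup v"
proof
  have "hv ` H \<subseteq> value_semigroup v"
    unfolding generating_set_values[symmetric] value_semigroup_def by auto
  moreover have "0 \<in> value_semigroup v"
    unfolding value_semigroup_def by (rule rev_image_eqI[of 1]) auto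
  moreover fix a assume "a \<in> monoid_hull (hv ` H)"
  ultimately show "a \<in> value_semigroup v"
    by (elim monoid_hull_least) (auto intro: value_semigroup_add)
qed

lemma khovanskii_iff:
  "is_khovanskii_basis v (generating_set D \<psi> lf H) \<longleftrightarrow> monoid_hull (hv ` H) = value_semigroup v"
  by (simp add: is_khovanskii_basis_def generating_set_values)

lemma hv_split:
  assumes "\<And>g. g \<noteq> 0 \<Longrightarrow> hval 0 g = pm_scale (ord_at Q g) \<gamma>" "fst h \<in> coords {..<d}"
  shows "hv h = pm_scale (ord_at Q (zmon m lf (snd h))) \<gamma> + hval (fst h) 1"
  unfolding hv_def using hval_split[OF assms(2) zmon_nonzero[OF lf]] assms(1)[OF zmon_nonzero[OF lf]] by simp

lemma hv_point:
  assumes "\<And>g. g \<noteq> 0 \<Longrightarrow> hval 0 g = pm_scale (ord_at (pd_point D i) g) \<gamma>" "i \<le> m" "fst h \<in> coords {..<d}"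
  shows "hv h = pm_scale (e_coeff m i (snd h)) \<gamma> + hval (fst h) 1"
  using hv_split[OF assms(1,3)] by (simp add: ord_at_zmon_point[OF lf D assms(2)])

text \<open>The expansion of a section at \<open>P\<^sub>i\<close> lifts to a polynomial in the generators. As \<open>\<gamma>\<close> is
  nonnegative, its terms have at least the value of the section, and the leading one has exactly
  this value.\<close>

lemma homogeneous_element_expansion:
  assumes Q: "\<And>g. g \<noteq> 0 \<Longrightarrow> hval 0 g = pm_scale (ord_at (pd_point D i) g) \<gamma>" "i \<le> m" "0 \<le> \<gamma>"
    and u: "u \<in> keys (\<psi> f)"
  obtains p h where "p \<in> poly_ring H" "presentation D lf p = single u (lookup (\<psi> f) u)"
    "\<forall>\<alpha>\<in>keys p. hval u (lookup (\<psi> f) u) \<le> hv (hdeg \<alpha>)"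
    "h \<in> dual_monoid d D" "hv h = hval u (lookup (\<psi> f) u)"
proof -
  define g where "g = lookup (\<psi> f) u"
  have g: "u \<in> dual_weights d (pd_tail D)" "g \<in> sections D u" "g \<noteq> 0"
    using psi_component[OF u] u by (auto simp: g_def in_keys_iff)
  have uc: "u \<in> coords {..<d}" using g(1) by (simp add: dual_weights_def)
  obtain N c b where b: "\<And>a. a \<le> N \<Longrightarrow> (u, b a) \<in> dual_monoid d D"
    "\<And>a. a \<le> N \<Longrightarrow> e_coeff m i (b a) = ord_at (pd_point D i) g + int a"
    "g = (\<Sum>a\<le>N. to_fract [:c a:] * zmon m lf (b a))"
    by (rule section_expansion[OF lf D Q(2) g], rule that)
  have val: "hval u g = pm_scale (ord_at (pd_point D i) g) \<gamma> + hval u 1"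
    using hval_split[OF uc g(3)] Q(1)[OF g(3)] by simp
  have hvb: "hv (u, b a) = pm_scale (ord_at (pd_point D i) g + int a) \<gamma> + hval u 1" if "a \<le> N" for a
    using hv_point[OF Q(1,2), of "(u, b a)"] uc b(2)[OF that] by simp
  have "\<exists>\<alpha>\<in>coords H. hdeg \<alpha> = (u, b a)" if "a \<le> N" for a
    using monoid_hull_hdeg[of "(u, b a)" H] b(1)[OF that] by (simp add: hull_H)
  then obtain \<alpha> where \<alpha>: "\<And>a. a \<le> N \<Longrightarrow> \<alpha> a \<in> coords H" "\<And>a. a \<le> N \<Longrightarrow> hdeg (\<alpha> a) = (u, b a)" by metis
  define p where "p = (\<Sum>a\<le>N. single (\<alpha> a) (c a))"
  have "p \<in> poly_ring H" unfolding p_def by (intro poly_ring_sum poly_ring_single) (use \<alpha> in auto)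
  moreover have "presentation D lf p = single u g"
  proof -
    have "presentation D lf p = (\<Sum>a\<le>N. single u (to_fract [:c a:] * zmon m lf (b a)))"
      unfolding p_def presentation_sum[OF lf] presentation_single[OF lf] const_mult_chi_image
      by (rule sum.cong) (use \<alpha>(2) in auto)
    also have "\<dots> = single u (\<Sum>a\<le>N. to_fract [:c a:] * zmon m lf (b a))"
    proof -
      have "(\<Sum>a\<in>A. single u (t a)) = single u (\<Sum>a\<in>A. t a)"
        for A and t :: "nat \<Rightarrow> 'k poly fract"
        by (induction A rule: infinite_finite_induct) (auto simp: single_add)
      then show ?thesis .
    qed
    finally show ?thesis using b(3) by simp
  qed
  moreover have "hval u g \<le> hv (hdeg \<beta>)" if \<beta>: "\<beta> \<in> keys p" for \<beta>
  proof -
    obtain a where "a \<le> N" "\<beta> = \<alpha> a"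
      using \<beta> keys_sum[of "\<lambda>a. single (\<alpha> a) (c a)" "{..N}"]
      unfolding p_def by (auto split: if_splits)
    then show ?thesis
      using pm_scale_mono[OF Q(3)] by (simp add: val hvb \<alpha>(2))
  qed
  moreover have "hv (u, b 0) = hval u g" using hvb[of 0] val by simp
  ultimately show ?thesis using that[of p "(u, b 0)"] b(1)[of 0] by (simp add: g_def)
qed

lemma homogeneous_value_semigroup:
  assumes hom: "\<And>f. f \<noteq> 0 \<Longrightarrow> v f = hmin f"
    and Q: "\<And>g. g \<noteq> 0 \<Longrightarrow> hval 0 g = pm_scale (ord_at (pd_point D i) g) \<gamma>" "i \<le> m" "0 \<le> \<gamma>"
  shows "monoid_hull (hv ` H) = value_semigroup v"
proof (rule equalityI[OF monoid_hull_values_subset], rule subsetI)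
  fix a assume "a \<in> value_semigroup v"
  then obtain f where f: "f \<noteq> 0" "a = v f" by (auto simp: value_semigroup_def)
  obtain u where u: "u \<in> keys (\<psi> f)" "hmin f = hval u (lookup (\<psi> f) u)"
    using hmin_attained[OF f(1)] by blast
  obtain h where "h \<in> dual_monoid d D" "hv h = hval u (lookup (\<psi> f) u)"
    using homogeneous_element_expansion[OF Q u(1)] by metis
  then show "a \<in> monoid_hull (hv ` H)"
    using hv_in_monoid_hull[of h] f hom u(2) by simp
qed

text \<open>Adding up the expansions of the homogeneous components of \<open>f\<close> gives a representing polynomial
  whose weight is as large as the values of its terms allow.\<close>

lemma homogeneous_weight_valuation:
  assumes hom: "\<And>f. f \<noteq> 0 \<Longrightarrow> v f = hmin f"
    and Q: "\<And>g. g \<noteq> 0 \<Longrightarrow> hval 0 g = pm_scale (ord_at (pd_point D i) g) \<gamma>" "i \<le> m" "0 \<le> \<gamma>"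
    and W: "\<And>h. h \<in> H \<Longrightarrow> W h = rat_vec (hv h)"
  shows "is_weight_valuation D \<psi> lf H W v"
  unfolding is_weight_valuation_def Let_def
proof (intro allI impI conjI)
  fix f :: 'r assume f: "f \<noteq> 0"
  let ?S = "min_weight (mat_weight W) ` {p \<in> poly_ring H. presentation D lf p = \<psi> f}"
  have weight: "mat_weight W \<alpha> = rat_vec (hv (hdeg \<alpha>))" if "p \<in> poly_ring H" "\<alpha> \<in> keys p"
    for p :: "(lat \<Rightarrow>\<^sub>0 nat) \<Rightarrow>\<^sub>0 'k" and \<alpha>
    using mat_weight_eq[OF W, of \<alpha>] that by (simp add: poly_ring_def)
  have upper: "min_weight (mat_weight W) p \<le> rat_vec (v f)"
    if p: "p \<in> poly_ring H" "presentation D lf p = \<psi> f" for p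
  proof -
    have "p \<noteq> 0" using p f by auto
    then obtain \<alpha> where \<alpha>: "\<alpha> \<in> keys p" "min_weight (mat_weight W) p = mat_weight W \<alpha>"
      using min_weight_attained by blast
    have "hv (hdeg \<alpha>) \<le> v f"
    proof (rule value_ge[OF p f])
      fix \<beta> assume "\<beta> \<in> keys p"
      then show "hv (hdeg \<alpha>) \<le> hv (hdeg \<beta>)"
        using min_weight_le[of \<beta> p "mat_weight W"] \<alpha> weight[OF p(1)] by simp
    qed
    then show ?thesis using \<alpha> weight[OF p(1)] by simp
  qed
  then show "\<forall>a\<in>?S. a \<le> rat_vec (v f)" by blast
  have "\<exists>p. p \<in> poly_ring H \<and> presentation D lf p = single u (lookup (\<psi> f) u) \<and>
      (\<forall>\<alpha>\<in>keys p. hval u (lookup (\<psi> f) u) \<le> hv (hdeg \<alpha>))"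
    if "u \<in> keys (\<psi> f)" for u
    using homogeneous_element_expansion[OF Q that] by metis
  then obtain pu where pu: "\<And>u. u \<in> keys (\<psi> f) \<Longrightarrow> pu u \<in> poly_ring H \<and>
      presentation D lf (pu u) = single u (lookup (\<psi> f) u) \<and>
      (\<forall>\<alpha>\<in>keys (pu u). hval u (lookup (\<psi> f) u) \<le> hv (hdeg \<alpha>))"
    by metis
  define p where "p = (\<Sum>u\<in>keys (\<psi> f). pu u)"
  have pH: "p \<in> poly_ring H" unfolding p_def by (rule poly_ring_sum) (use pu in blast)
  have pres: "presentation D lf p = \<psi> f"
    unfolding p_def presentation_sum[OF lf] by (subst (2) psi_expand, rule sum.cong) (use pu in auto)
  have "p \<noteq> 0" using pres f by auto
  then obtain \<alpha> where \<alpha>: "\<alpha> \<in> keys p" "min_weight (mat_weight W) p = mat_weight W \<alpha>"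
    using min_weight_attained by blast
  obtain u where u: "u \<in> keys (\<psi> f)" "\<alpha> \<in> keys (pu u)"
    using \<alpha>(1) keys_sum[of pu "keys (\<psi> f)"] unfolding p_def by blast
  have "v f \<le> hval u (lookup (\<psi> f) u)" using hom[OF f] hmin_le[OF u(1)] by simp
  also have "\<dots> \<le> hv (hdeg \<alpha>)" using pu[OF u(1)] u(2) by blast
  finally have "rat_vec (v f) \<le> min_weight (mat_weight W) p"
    using \<alpha> weight[OF pH \<alpha>(1)] by simp
  with upper[OF pH pres] have "rat_vec (v f) = min_weight (mat_weight W) p" by simp
  then show "rat_vec (v f) \<in> ?S" using pH pres by blast
qed

lemma mat_rank_values:
  assumes "monoid_hull (hv ` H) = value_semigroup v" "\<And>h. h \<in> H \<Longrightarrow> W h = rat_vec (hv h)"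
  shows "mat_rank H W = q_dim (rat_vec ` group_hull (value_semigroup v))"
  unfolding mat_rank_def q_dim_def
proof (rule qvs.span_eq_dim, rule antisym)
  have W: "W ` H = rat_vec ` hv ` H" using assms(2) by (simp add: image_image)
  have "hv ` H \<subseteq> value_semigroup v"
    unfolding assms(1)[symmetric] by (auto intro: monoid_hull_incl)
  also have "\<dots> \<subseteq> group_hull (value_semigroup v)"
    unfolding group_hull_def by (auto intro: monoid_hull_incl)
  finally show "qvs.span (W ` H) \<subseteq> qvs.span (rat_vec ` group_hull (value_semigroup v))"
    unfolding W by (intro qvs.span_mono image_mono)
  have "rat_vec ` value_semigroup v \<subseteq> qvs.span (W ` H)"
  proof (rule image_subsetI)
    fix a assume "a \<in> value_semigroup v"
    then have "a \<in> monoid_hull (hv ` H)" by (simp add: assms(1))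
    then have "a \<in> {a. rat_vec a \<in> qvs.span (W ` H)}"
    proof (rule monoid_hull_least)
      fix s x assume "s \<in> hv ` H" "x \<in> {a. rat_vec a \<in> qvs.span (W ` H)}"
      then show "s + x \<in> {a. rat_vec a \<in> qvs.span (W ` H)}"
        unfolding W by (auto simp: rat_vec_add intro!: qvs.span_add intro: qvs.span_base)
    qed (simp add: qvs.span_zero)
    then show "rat_vec a \<in> qvs.span (W ` H)" by simp
  qed
  then show "qvs.span (rat_vec ` group_hull (value_semigroup v)) \<subseteq> qvs.span (W ` H)"
    by (intro qvs.span_minimal rat_vec_group_hull_subset_span qvs.subspace_span)
qed

text \<open>The generators are homogeneous, so all values are combinations of \<open>\<gamma>\<close> and the values of
  characters. By full rank, homogeneous elements of different weight then have different values.\<close>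

lemma khovanskii_homogeneous:
  assumes rank: "q_dim (rat_vec ` group_hull (value_semigroup v)) = Suc d"
    and K: "monoid_hull (hv ` H) = value_semigroup v"
    and f: "f \<noteq> 0"
  shows "v f = hmin f"
proof (rule v_eq_hmin[OF f], rule inj_onI)
  obtain Q \<gamma> where Q: "\<And>g. g \<noteq> 0 \<Longrightarrow> hval 0 g = pm_scale (ord_at Q g) \<gamma>"
    using hval_function_field by metis
  let ?B = "insert (rat_vec \<gamma>) ((\<lambda>i. rat_vec (hval (single i 1) 1)) ` {..<d})"
  have hv_span: "rat_vec (hv h) \<in> qvs.span ?B" if "h \<in> H" for h
  proof -
    have u: "fst h \<in> coords {..<d}" using that by (rule generator_weight)
    have char: "rat_vec (hval (fst h) 1) \<in> qvs.span ?B"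
      unfolding hval_1_expand[OF u] rat_vec_sum rat_vec_pm_scale
      by (intro qvs.span_sum qvs.span_scale qvs.span_base) auto
    have eq: "hv h = pm_scale (ord_at Q (zmon m lf (snd h))) \<gamma> + hval (fst h) 1"
      using Q u by (rule hv_split)
    show ?thesis
      unfolding eq rat_vec_add rat_vec_pm_scale
      by (rule qvs.span_add[OF qvs.span_scale[OF qvs.span_base[OF insertI1]] char])
  qed
  have span: "rat_vec (v f) \<in> qvs.span ?B" if "f \<noteq> 0" for f
  proof -
    have "v f \<in> monoid_hull (hv ` H)" unfolding K value_semigroup_def using that by auto
    then have "v f \<in> {a. rat_vec a \<in> qvs.span ?B}"
      by (rule monoid_hull_least) (use hv_span in \<open>auto simp: rat_vec_add qvs.span_zero intro: qvs.span_add\<close>)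
    then show ?thesis by simp
  qed
  fix u w assume uw: "u \<in> keys (\<psi> f)" "w \<in> keys (\<psi> f)"
    and eq: "hval u (lookup (\<psi> f) u) = hval w (lookup (\<psi> f) w)"
  have c: "u \<in> coords {..<d}" "w \<in> coords {..<d}"
    using psi_component uw by (auto simp: dual_weights_def)
  have nz: "lookup (\<psi> f) u \<noteq> 0" "lookup (\<psi> f) w \<noteq> 0"
    using uw by (auto simp: in_keys_iff)
  have "hval u 1 = hval (u - w) 1 + hval w 1"
    using hval_1_add[of "u - w" w] c by (simp add: coords_diff)
  then have rel: "pm_scale (ord_at Q (lookup (\<psi> f) u) - ord_at Q (lookup (\<psi> f) w)) \<gamma> + hval (u - w) 1 = 0"
    using eq hval_split[OF c(1) nz(1)] hval_split[OF c(2) nz(2)] Q[OF nz(1)] Q[OF nz(2)]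
    by (simp add: pm_scale_diff_left) (metis add.commute add_diff_cancel_right' add_diff_eq diff_self)
  have "u - w = 0"
  proof (rule full_rank_independent[OF rank _ coords_diff[OF c] rel])
    show "rat_vec (v f) \<in> qvs.span ?B" if "f \<noteq> 0" for f using that by (rule span)
  qed
  then show "u = w" by simp
qed

text \<open>A generator whose value exceeds its column would be represented by a polynomial of larger weight,
  and the difference of the two would have the variable as its initial form.\<close>

lemma tropical_weights_are_values:
  assumes W: "W \<in> trop_r r H (J_ideal D lf H)" "is_weight_valuation D \<psi> lf H W v" and h: "h \<in> H"
  shows "W h = rat_vec (hv h)"
proof (rule ccontr)
  assume neq: "W h \<noteq> rat_vec (hv h)"
  obtain f where f: "f \<noteq> 0" "\<psi> f = chi_image m lf h" "v f = hv h"
    using generator_element h H_subset by blast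
  let ?x = "single (single h (Suc 0)) (1::'k)"
  have xH: "single h (Suc 0) \<in> coords H" using h by (rule coords_single)
  have x: "?x \<in> poly_ring H" "presentation D lf ?x = \<psi> f" "min_weight (mat_weight W) ?x = W h"
    using xH f(2) by (auto simp: poly_ring_single presentation_single[OF lf] min_weight_def)
  have S: "rat_vec (hv h) \<in> min_weight (mat_weight W) ` {p \<in> poly_ring H. presentation D lf p = \<psi> f}"
    "\<And>a. a \<in> min_weight (mat_weight W) ` {p \<in> poly_ring H. presentation D lf p = \<psi> f} \<Longrightarrow> a \<le> rat_vec (hv h)"
    using W(2) f(1,3) unfolding is_weight_valuation_def Let_def by auto
  have "W h \<le> rat_vec (hv h)" by (rule S(2)) (use x in force)
  with neq have less: "W h < rat_vec (hv h)" by simp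
  obtain p where p: "p \<in> poly_ring H" "presentation D lf p = \<psi> f" "rat_vec (hv h) = min_weight (mat_weight W) p"
    using S(1) by blast
  have gt: "W h < mat_weight W \<beta>" if "\<beta> \<in> keys p" for \<beta>
    using less min_weight_le[OF that, of "mat_weight W"] p(3) by simp
  have xp: "lookup p (single h (Suc 0)) = 0"
    using gt[of "single h (Suc 0)"] by (auto simp: in_keys_iff)
  have J: "?x - p \<in> J_ideal D lf H"
    using x p by (simp add: J_ideal_def poly_ring_diff presentation_diff[OF lf])
  have ge: "W h \<le> mat_weight W \<beta> \<and> (mat_weight W \<beta> = W h \<longrightarrow> \<beta> = single h (Suc 0))"
    if "\<beta> \<in> keys (?x - p)" for \<beta>
  proof -
    have "\<beta> \<in> keys ?x \<union> keys p"
      using keys_diff[of ?x p] that by (rule subsetD)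
    then show ?thesis using gt[of \<beta>] by auto
  qed
  have mem: "single h (Suc 0) \<in> keys (?x - p)"
    using xp by (simp add: in_keys_iff lookup_minus)
  then have mw: "min_weight (mat_weight W) (?x - p) = W h"
    using eq_min_weight_iff[OF mem, of "mat_weight W"] ge by simp
  have "initial_form (mat_weight W) (?x - p) = ?x"
  proof (rule poly_mapping_eqI)
    fix \<beta>
    show "lookup (initial_form (mat_weight W) (?x - p)) \<beta> = lookup ?x \<beta>"
    proof (cases "\<beta> = single h (Suc 0)")
      case True
      then show ?thesis using xp by (simp add: initial_form_eq lookup_restrict_terms mw lookup_minus)
    next
      case False
      then show ?thesis using ge[of \<beta>]
        by (auto simp: initial_form_eq lookup_restrict_terms mw lookup_single in_keys_iff)
    qed
  qed
  then have "?x \<in> initial_ideal H (mat_weight W) (J_ideal D lf H)"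
    unfolding initial_ideal_def using J by (metis ideal_gen_incl imageI)
  then have "contains_monomial H (initial_ideal H (mat_weight W) (J_ideal D lf H))"
    unfolding contains_monomial_def using xH by (metis one_neq_zero)
  then show False using W(1) by (simp add: trop_r_def)
qed

text \<open>The terms of weight \<open>u\<close> of a polynomial that attains the value of \<open>f\<close> represent the component of
  weight \<open>u\<close>, whose value is therefore at least that of \<open>f\<close>.\<close>

lemma weight_valuation_homogeneous:
  assumes W: "\<And>h. h \<in> H \<Longrightarrow> W h = rat_vec (hv h)" "is_weight_valuation D \<psi> lf H W v" and f: "f \<noteq> 0"
  shows "v f = hmin f"
proof (rule antisym)
  show "hmin f \<le> v f" using f by (rule hmin_le_v)
  obtain p where p: "p \<in> poly_ring H" "presentation D lf p = \<psi> f" "rat_vec (v f) = min_weight (mat_weight W) p"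
    using W(2) f unfolding is_weight_valuation_def Let_def by blast
  obtain u where u: "u \<in> keys (\<psi> f)" "hmin f = hval u (lookup (\<psi> f) u)"
    using hmin_attained[OF f] by blast
  obtain fu where fu: "fu \<noteq> 0" "\<psi> fu = single u (lookup (\<psi> f) u)"
    "v fu = hval u (lookup (\<psi> f) u)"
    using component_exists[OF u(1)] by blast
  have "v f \<le> v fu"
  proof (rule value_ge[OF restrict_terms_poly_ring[OF p(1)] _ fu(1)])
    show "presentation D lf (restrict_terms (\<lambda>\<alpha>. fst (hdeg \<alpha>) = u) p) = \<psi> fu"
      by (simp add: presentation_weight_component[OF lf] fu(2) p(2))
    fix \<alpha> assume "\<alpha> \<in> keys (restrict_terms (\<lambda>\<alpha>. fst (hdeg \<alpha>) = u) p)"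
    then have \<alpha>: "\<alpha> \<in> keys p" by (simp add: keys_restrict_terms)
    then have "\<alpha> \<in> coords H" using p(1) by (simp add: poly_ring_def)
    then show "v f \<le> hv (hdeg \<alpha>)"
      using min_weight_le[OF \<alpha>, of "mat_weight W"] mat_weight_eq[OF W(1)] p(3) by (simp flip: rat_vec_le)
  qed
  then show "v f \<le> hmin f" using fu(3) u(2) by simp
qed

lemma weight_valuation_semigroup:
  assumes W: "\<And>h. h \<in> H \<Longrightarrow> W h = rat_vec (hv h)" "is_weight_valuation D \<psi> lf H W v"
  shows "rat_vec ` value_semigroup v = monoid_hull (W ` H)"
proof (intro equalityI subsetI)
  fix a assume "a \<in> rat_vec ` value_semigroup v"
  then obtain f where f: "f \<noteq> 0" "a = rat_vec (v f)" by (auto simp: value_semigroup_def)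
  obtain p where p: "p \<in> poly_ring H" "presentation D lf p = \<psi> f" "rat_vec (v f) = min_weight (mat_weight W) p"
    using W(2) f(1) unfolding is_weight_valuation_def Let_def by blast
  have "p \<noteq> 0" using p f by auto
  then obtain \<alpha> where "\<alpha> \<in> keys p" "min_weight (mat_weight W) p = mat_weight W \<alpha>"
    using min_weight_attained by blast
  then show "a \<in> monoid_hull (W ` H)"
    using p f(2) mat_weight_in_monoid_hull[of \<alpha> H W] by (simp add: poly_ring_def)
next
  fix a assume "a \<in> monoid_hull (W ` H)"
  then have "a \<in> rat_vec ` monoid_hull (hv ` H)"
  proof (rule monoid_hull_least)
    show "0 \<in> rat_vec ` monoid_hull (hv ` H)"
      by (rule rev_image_eqI[of 0]) (auto intro: monoid_hull.zero)
    fix s x assume "s \<in> W ` H" "x \<in> rat_vec ` monoid_hull (hv ` H)"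
    then obtain h y where "h \<in> H" "s = rat_vec (hv h)" "y \<in> monoid_hull (hv ` H)" "x = rat_vec y"
      using W(1) by blast
    then show "s + x \<in> rat_vec ` monoid_hull (hv ` H)"
      by (intro rev_image_eqI[of "hv h + y"]) (auto simp: rat_vec_add intro: monoid_hull.add)
  qed
  then show "a \<in> rat_vec ` value_semigroup v"
    using monoid_hull_values_subset by blast
qed

text \<open>If \<open>v\<close> were trivial on the function field of the line or supported at a point where all
  \<open>y\<^sub>i / y\<^sub>0\<close> are units, the columns of \<open>W\<close> would only involve the values of \<open>d\<close> characters.\<close>

lemma full_rank_at_boundary_point:
  assumes W: "\<And>h. h \<in> H \<Longrightarrow> W h = rat_vec (hv h)" and rank: "mat_rank H W = Suc d"
  obtains i \<gamma> where "i \<le> m" "0 < \<gamma>" "\<gamma> \<in> coords {..<r}"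
    "\<And>g. g \<noteq> 0 \<Longrightarrow> hval 0 g = pm_scale (ord_at (pd_point D i) g) \<gamma>"
proof -
  obtain Q \<gamma> where Q: "0 \<le> \<gamma>" "\<gamma> \<in> coords {..<r}" "\<And>g. g \<noteq> 0 \<Longrightarrow> hval 0 g = pm_scale (ord_at Q g) \<gamma>"
    using hval_function_field by metis
  have "Q \<in> pd_point D ` {..m} \<and> \<gamma> \<noteq> 0"
  proof (rule ccontr)
    assume neg: "\<not> (Q \<in> pd_point D ` {..m} \<and> \<gamma> \<noteq> 0)"
    let ?B = "(\<lambda>i. rat_vec (hval (single i 1) 1)) ` {..<d}"
    have "W ` H \<subseteq> qvs.span ?B"
    proof (rule image_subsetI)
      fix h assume h: "h \<in> H"
      have u: "fst h \<in> coords {..<d}" using h by (rule generator_weight)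
      have "pm_scale (ord_at Q (zmon m lf (snd h))) \<gamma> = 0"
        using neg ord_at_zmon_other[OF lf, of Q] by auto
      then have "hv h = hval (fst h) 1" using hv_split[OF Q(3) u] by simp
      then show "W h \<in> qvs.span ?B"
        unfolding W[OF h] by (simp only: hval_1_expand[OF u] rat_vec_sum rat_vec_pm_scale)
          (intro qvs.span_sum qvs.span_scale qvs.span_base, auto)
    qed
    then have "mat_rank H W \<le> card ?B"
      unfolding mat_rank_def q_dim_def by (intro qvs.dim_le_card) auto
    also have "\<dots> \<le> d" using card_image_le[of "{..<d}"] by fastforce
    finally show False using rank by simp
  qed
  then obtain i where "i \<le> m" "Q = pd_point D i" "\<gamma> \<noteq> 0" by auto
  then show ?thesis using that[of i \<gamma>] Q by auto
qed

end

section \<open>Adding a point with trivial coefficient\<close>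

text \<open>Makes an arbitrary point of the line one of the \<open>P\<^sub>i\<close> without changing the algebra.\<close>

definition add_trivial_point :: "'k pdivisor \<Rightarrow> 'k option \<Rightarrow> 'k pdivisor" where
  "add_trivial_point D Q = D\<lparr>pd_m := Suc (pd_m D), pd_coeff := (pd_coeff D)(Suc (pd_m D) := pd_tail D),
    pd_point := (pd_point D)(Suc (pd_m D) := Q)\<rparr>"

lemma polyhedral_cone_polyhedron:
  assumes "is_polyhedral_cone d \<sigma>"
  shows "is_polyhedron d \<sigma>" "tailcone d \<sigma> = \<sigma>"
proof -
  obtain F where F: "finite F" "F \<subseteq> coords {..<d}" "\<sigma> = {a \<in> coords {..<d}. \<forall>u\<in>F. 0 \<le> pairing a u}"
    using assms by (auto simp: is_polyhedral_cone_def)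
  show "is_polyhedron d \<sigma>"
    unfolding is_polyhedron_def by (rule exI[of _ "F \<times> {0}"]) (use F in auto)
  have "0 \<in> \<sigma>" by (simp add: F(3))
  show "tailcone d \<sigma> = \<sigma>"
  proof (intro equalityI subsetI)
    fix a assume a: "a \<in> tailcone d \<sigma>"
    then have "0 + a \<in> \<sigma>" using \<open>0 \<in> \<sigma>\<close> unfolding tailcone_def by blast
    then show "a \<in> \<sigma>" by simp
  next
    fix a assume "a \<in> \<sigma>"
    then show "a \<in> tailcone d \<sigma>"
      by (auto simp: tailcone_def F(3) pairing_add_left intro: coords_add)
  qed
qed

text \<open>The tail cone is absorbed by the other coefficients, so the sum of all coefficients does not
  grow.\<close>

lemma is_pdivisor_add_trivial_point:
  assumes D: "is_pdivisor d D" and Q: "Q \<notin> pd_point D ` {..pd_m D}"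
  shows "is_pdivisor d (add_trivial_point D Q)"
proof -
  let ?m = "pd_m D" let ?D = "add_trivial_point D Q"
  have D': "1 \<le> ?m" "inj_on (pd_point D) {..?m}" "is_polyhedral_cone d (pd_tail D)"
    "pd_tail D \<inter> uminus ` pd_tail D = {0}"
    "\<And>i. i \<le> ?m \<Longrightarrow> pd_coeff D i = {} \<or> is_polyhedron d (pd_coeff D i) \<and> tailcone d (pd_coeff D i) = pd_tail D"
    "{\<Sum>i\<le>?m. a i | a. \<forall>i\<le>?m. a i \<in> pd_coeff D i} \<subset> pd_tail D"
    using D unfolding is_pdivisor_def by simp_all
  have [simp]: "pd_m ?D = Suc ?m" "pd_tail ?D = pd_tail D"
    "pd_coeff ?D = (pd_coeff D)(Suc ?m := pd_tail D)" "pd_point ?D = (pd_point D)(Suc ?m := Q)"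
    by (simp_all add: add_trivial_point_def)
  have "inj_on (pd_point ?D) {..Suc ?m}"
    unfolding atMost_Suc using D'(2) Q by (auto simp: inj_on_def)
  moreover have "pd_coeff ?D i = {} \<or> is_polyhedron d (pd_coeff ?D i) \<and> tailcone d (pd_coeff ?D i) = pd_tail D"
    if "i \<le> Suc ?m" for i
    using that D'(5)[of i] polyhedral_cone_polyhedron[OF D'(3)] by (auto simp: le_Suc_eq)
  moreover have "{\<Sum>i\<le>Suc ?m. a i | a. \<forall>i\<le>Suc ?m. a i \<in> pd_coeff ?D i} \<subseteq>
      {\<Sum>i\<le>?m. a i | a. \<forall>i\<le>?m. a i \<in> pd_coeff D i}"
  proof safe
    fix a assume a: "\<forall>i\<le>Suc ?m. a i \<in> pd_coeff ?D i"
    define b where "b i = a i + (if i = 0 then a (Suc ?m) else 0)" for i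
    have "(\<Sum>i\<le>Suc ?m. a i) = (\<Sum>i\<le>?m. b i)" by (simp add: b_def sum.distrib)
    moreover have "b i \<in> pd_coeff D i" if "i \<le> ?m" for i
    proof -
      have ai: "a i \<in> pd_coeff D i" using a[rule_format, of i] that by auto
      moreover have "a (Suc ?m) \<in> pd_tail D" using a[rule_format, of "Suc ?m"] by simp
      ultimately show ?thesis using pdivisor_coeff_add_tail[OF D that] by (auto simp: b_def)
    qed
    ultimately show "\<exists>b. (\<Sum>i\<le>Suc ?m. a i) = (\<Sum>i\<le>?m. b i) \<and> (\<forall>i\<le>?m. b i \<in> pd_coeff D i)" by blast
  qed
  then have "{\<Sum>i\<le>Suc ?m. a i | a. \<forall>i\<le>Suc ?m. a i \<in> pd_coeff ?D i} \<subset> pd_tail D"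
    using D'(6) by (rule subset_psubset_trans)
  ultimately show ?thesis using D'(3,4) unfolding is_pdivisor_def by simp
qed

lemma min_pairing_tail:
  assumes "is_pdivisor d D" "u \<in> dual_weights d (pd_tail D)"
  shows "min_pairing (pd_tail D) u = 0"
  unfolding min_pairing_def
  by (rule Least_equality)
    (use assms pdivisor_tail_0[OF assms(1)] in \<open>auto simp: dual_weights_def intro!: rev_image_eqI[of 0]\<close>)

text \<open>On weights in the dual cone the minimum over the tail cone is \<open>0\<close>, so the condition at the new
  point is regularity, which was required there before.\<close>

lemma section_algebra_add_trivial_point:
  assumes D: "is_pdivisor d D" and Q: "Q \<notin> pd_point D ` {..pd_m D}"
  shows "section_algebra d (add_trivial_point D Q) = section_algebra d D"
proof -
  let ?m = "pd_m D" let ?D = "add_trivial_point D Q"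
  have m': "pd_m ?D = Suc ?m" and [simp]: "pd_tail ?D = pd_tail D"
    "pd_coeff ?D = (pd_coeff D)(Suc ?m := pd_tail D)" "pd_point ?D = (pd_point D)(Suc ?m := Q)"
    by (simp_all add: add_trivial_point_def)
  have pts: "pd_point ?D ` {..Suc ?m} = insert Q (pd_point D ` {..?m})"
    unfolding atMost_Suc by auto
  have "f \<in> sections ?D u \<longleftrightarrow> f \<in> sections D u" if u: "u \<in> dual_weights d (pd_tail D)" for f u
  proof -
    have tail: "pd_tail D \<noteq> {}" using pdivisor_tail_0[OF D] by blast
    have "(\<forall>i\<le>Suc ?m. pd_coeff ?D i \<noteq> {} \<longrightarrow> 0 \<le> ord_at (pd_point ?D i) f + \<lfloor>min_pairing (pd_coeff ?D i) u\<rfloor>) \<longleftrightarrow>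
        (\<forall>i\<le>?m. pd_coeff D i \<noteq> {} \<longrightarrow> 0 \<le> ord_at (pd_point D i) f + \<lfloor>min_pairing (pd_coeff D i) u\<rfloor>) \<and> 0 \<le> ord_at Q f"
      using tail by (auto simp: le_Suc_eq min_pairing_tail[OF D u])
    moreover have "(\<forall>R. R \<notin> insert Q (pd_point D ` {..?m}) \<longrightarrow> 0 \<le> ord_at R f) \<and> 0 \<le> ord_at Q f \<longleftrightarrow>
        (\<forall>R. R \<notin> pd_point D ` {..?m} \<longrightarrow> 0 \<le> ord_at R f)"
      using Q by (metis insert_iff)
    ultimately show ?thesis
      unfolding sections_def mem_Collect_eq m' pts by argo
  qed
  then show ?thesis unfolding section_algebra_def by fastforce
qed

lemma presentation_with_point:
  assumes D: "is_pdivisor d D" and iso: "is_graded_iso d \<kappa> G D \<psi>"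
  obtains D' i where "is_pdivisor d D'" "is_graded_iso d \<kappa> G D' \<psi>" "i \<le> pd_m D'" "pd_point D' i = Q"
proof (cases "Q \<in> pd_point D ` {..pd_m D}")
  case True
  then show ?thesis using that D iso by auto
next
  case False
  have "is_graded_iso d \<kappa> G (add_trivial_point D Q) \<psi>"
    using iso unfolding is_graded_iso_def section_algebra_add_trivial_point[OF D False] .
  then show ?thesis
    using that[OF is_pdivisor_add_trivial_point[OF D False], of "Suc (pd_m D)"]
    by (simp add: add_trivial_point_def)
qed

lemma semi_canonical_exists:
  assumes D: "is_pdivisor d D" and iso: "is_graded_iso d \<kappa> G D \<psi>"
  obtains lf H where "is_semi_canonical d \<kappa> G D \<psi> lf H"
proof -
  obtain lf where "is_linear_embedding D lf" using linear_embedding_exists by blast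
  moreover obtain H where "finite H" "monoid_hull H = dual_monoid d D"
    by (rule dual_monoid_finitely_generated[OF D])
  ultimately show ?thesis using that D iso unfolding is_semi_canonical_def by blast
qed

section \<open>The facets of the tropical variety\<close>

lemma scaleR_poly_mapping: "scaleR c x = pm_scale c x" for x :: "'i \<Rightarrow>\<^sub>0 real"
proof (rule poly_mapping_eqI)
  fix i
  have "finite {i. c *\<^sub>R lookup x i \<noteq> 0}"
    by (rule finite_subset[of _ "keys x"]) (auto simp: in_keys_iff)
  then show "lookup (c *\<^sub>R x) i = lookup (pm_scale c x) i"
    by (simp add: scaleR_poly_mapping_def lookup_pm_scale)
qed

lemma lookup_trop_map: "finite H \<Longrightarrow> h \<in> H \<Longrightarrow> lookup (trop_map H a) h = pairing2 a h"
  by (simp add: trop_map_def lookup_sum lookup_single when_def)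

lemma trop_map_shift:
  "trop_map H (a, b) + pm_scale s (trop_map H (0, c)) = trop_map H (a, b + pm_scale s c)"
proof (rule poly_mapping_eqI)
  fix h
  have "pm_scale s (trop_map H (0, c)) = (\<Sum>h\<in>H. single h (s * pairing2 (0, c) h))"
    unfolding trop_map_def pm_scale_sum
    by (rule sum.cong[OF refl], rule poly_mapping_eqI) (simp add: lookup_pm_scale lookup_single when_def)
  then show "lookup (trop_map H (a, b) + pm_scale s (trop_map H (0, c))) h =
      lookup (trop_map H (a, b + pm_scale s c)) h"
    by (simp add: trop_map_def lookup_add lookup_sum pairing2_def pairing_add_left pairing_pm_scale_left
        distrib_left single_add add.assoc flip: sum.distrib)
qed

text \<open>A relative interior point stays in the facet when moved a little against the direction of the
  ray \<open>\<rho>\<^sub>i\<close>, so its own coordinate on the ray is positive.\<close>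

lemma rel_interior_trop_facet:
  assumes "w \<in> rel_interior (trop_facet d m H i)"
  obtains a t where "0 < t" "w = trop_map H (a, pm_scale t (e_vec m i))"
proof -
  let ?S = "trop_facet d m H i" let ?y = "trop_map H (0, e_vec m i)"
  obtain T where T: "openin (top_of_set (affine hull ?S)) T" "w \<in> T" "T \<subseteq> ?S"
    using assms unfolding rel_interior_def by blast
  then obtain U where U: "open U" "T = affine hull ?S \<inter> U" by (auto simp: openin_open)
  have S: "x \<in> ?S \<longleftrightarrow> (\<exists>a t. a \<in> coords {..<d} \<and> 0 \<le> t \<and> x = trop_map H (a, pm_scale t (e_vec m i)))" for x
    unfolding trop_facet_def by blast
  obtain a t where at: "a \<in> coords {..<d}" "0 \<le> t" "w = trop_map H (a, pm_scale t (e_vec m i))"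
    using T S by blast
  have "w + ?y = trop_map H (a, pm_scale (t + 1) (e_vec m i))"
    using trop_map_shift[of H a "pm_scale t (e_vec m i)" 1 "e_vec m i"] by (simp add: at(3) pm_scale_add_left)
  then have "w + ?y \<in> ?S" unfolding S using at(1,2) by (metis add_increasing2 zero_le_one)
  then have hull: "w + s *\<^sub>R ?y \<in> affine hull ?S" for s
  proof -
    have "(1 - s) *\<^sub>R w + s *\<^sub>R (w + ?y) \<in> affine hull ?S"
      using \<open>w + ?y \<in> ?S\<close> T(2,3)
      by (intro mem_affine[OF affine_affine_hull] hull_inc) auto
    then show ?thesis by (simp add: algebra_simps)
  qed
  obtain e where e: "0 < e" "ball w e \<subseteq> U"
    using U T(2) open_contains_ball by (metis Int_iff)
  \<comment> \<open>A step of length \<open>s\<close> stays within the distance \<open>e\<close>; the summand \<open>1\<close> avoids a zero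
    denominator.\<close>
  define s where "s = e / (2 * (norm ?y + 1))"
  have s: "0 < s" using e(1) by (simp add: s_def add_nonneg_pos)
  have "s * norm ?y \<le> s * (norm ?y + 1)" using s by simp
  also have "\<dots> = e / 2" unfolding s_def by (simp add: add_nonneg_eq_0_iff field_simps)
  finally have "s * norm ?y < e" using e(1) by simp
  then have "w + (- s) *\<^sub>R ?y \<in> ball w e" using s by (simp add: dist_norm)
  then have "w + (- s) *\<^sub>R ?y \<in> ?S" using e U T hull by blast
  then obtain a' t' where at': "0 \<le> t'" "w + (- s) *\<^sub>R ?y = trop_map H (a', pm_scale t' (e_vec m i))"
    using S by blast
  have "w = w + (- s) *\<^sub>R ?y + s *\<^sub>R ?y" by simp
  also have "\<dots> = trop_map H (a', pm_scale (t' + s) (e_vec m i))"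
    unfolding at'(2) by (simp add: scaleR_poly_mapping trop_map_shift pm_scale_add_left)
  finally show ?thesis using that[of "t' + s" a'] s at'(1) by simp
qed

lemma vec_weight_add: "vec_weight w (\<alpha> + \<beta>) = vec_weight w \<alpha> + vec_weight w \<beta>"
  unfolding vec_weight_def
  by (rule additive_over_exponents[of "\<lambda>n h. of_nat n * lookup w h"]) (simp_all add: distrib_right)

lemma vec_weight_trop_map:
  assumes "finite H" "\<alpha> \<in> coords H"
  shows "vec_weight (trop_map H a) \<alpha> = pairing2 a (hdeg \<alpha>)"
  using assms(2)
proof (induction rule: exponent_induct)
  case (add h \<alpha>)
  have "vec_weight (trop_map H a) (single h (Suc 0)) = pairing2 a h"
    using assms(1) add by (simp add: vec_weight_def lookup_trop_map)
  then show ?case using add by (simp add: vec_weight_add hdeg_add pairing2_add_right)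
qed (simp add: vec_weight_def)

context semi_canonical_presentation
begin

text \<open>In a fixed weight \<open>u\<close> the two weights of \<open>x\<^sup>\<alpha>\<close> are, up to constants, the positive multiples
  by \<open>\<gamma>\<close> and by \<open>t\<close> of the coefficient of its character along \<open>\<rho>\<^sub>i\<close>.\<close>

lemma initial_ideal_of_facet:
  assumes W: "\<And>h. h \<in> H \<Longrightarrow> W h = rat_vec (hv h)"
    and i: "i \<le> m" "0 < \<gamma>" "\<And>g. g \<noteq> 0 \<Longrightarrow> hval 0 g = pm_scale (ord_at (pd_point D i) g) \<gamma>"
    and w: "w \<in> rel_interior (trop_facet d m H i)"
  shows "initial_ideal H (mat_weight W) (J_ideal D lf H) = initial_ideal H (vec_weight w) (J_ideal D lf H)"
proof (rule initial_ideal_eq[OF lf])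
  obtain a t where t: "0 < t" "w = trop_map H (a, pm_scale t (e_vec m i))"
    using rel_interior_trop_facet[OF w] by blast
  fix \<alpha> \<beta> assume \<alpha>: "\<alpha> \<in> coords H" and \<beta>: "\<beta> \<in> coords H" and eq: "fst (hdeg \<alpha>) = fst (hdeg \<beta>)"
  have W': "mat_weight W \<delta> = rat_vec (pm_scale (e_coeff m i (snd (hdeg \<delta>))) \<gamma> + hval (fst (hdeg \<delta>)) 1)"
    if \<delta>: "\<delta> \<in> coords H" for \<delta>
    using mat_weight_eq[OF W \<delta>] hv_point[OF i(3,1)] dual_monoid_weight[OF hdeg_dual[OF \<delta>]] by simp
  have w': "vec_weight w \<delta> = pairing a (fst (hdeg \<delta>)) + t * of_int (e_coeff m i (snd (hdeg \<delta>)))"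
    if \<delta>: "\<delta> \<in> coords H" for \<delta>
    unfolding t(2) vec_weight_trop_map[OF finite_H \<delta>]
    by (simp add: pairing2_def pairing_pm_scale_left pairing_e_vec)
  show "mat_weight W \<alpha> \<le> mat_weight W \<beta> \<longleftrightarrow> vec_weight w \<alpha> \<le> vec_weight w \<beta>"
    unfolding W'[OF \<alpha>] W'[OF \<beta>] w'[OF \<alpha>] w'[OF \<beta>] eq
    using t(1) by (simp add: pm_scale_mono_iff[OF i(2)])
qed

end

section \<open>The equivalence\<close>

theorem theorem5p8:
  fixes \<kappa> :: "'k::alg_closed_field \<Rightarrow> 'r::idom"
    and G :: "(nat \<Rightarrow>\<^sub>0 int) \<Rightarrow> 'r set"
    and v :: "'r \<Rightarrow> (nat \<Rightarrow>\<^sub>0 int)"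
    and d r :: nat
  assumes X: "rational_complexity_one d \<kappa> G"
    and X_presented: "\<exists>D \<psi>. is_pdivisor d D \<and> is_graded_iso d \<kappa> G D \<psi>"
    and r: "krull_dim TYPE('r) = enat r"
    and v: "is_valuation r \<kappa> v" "full_rank v"
  shows
    "(is_homogeneous_valuation d G v \<longleftrightarrow>
        (\<exists>D \<psi> lf H. is_semi_canonical d \<kappa> G D \<psi> lf H \<and>
          is_khovanskii_basis v (generating_set D \<psi> lf H))) \<and>
     (is_homogeneous_valuation d G v \<longleftrightarrow>
        (\<exists>D \<psi> lf H W. is_semi_canonical d \<kappa> G D \<psi> lf H \<and>
          W \<in> trop_r r H (J_ideal D lf H) \<and> mat_rank H W = r \<and>
          is_weight_valuation D \<psi> lf H W v)) \<and>
     (\<forall>D \<psi> lf H W. is_semi_canonical d \<kappa> G D \<psi> lf H \<longrightarrow>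
        W \<in> trop_r r H (J_ideal D lf H) \<longrightarrow> mat_rank H W = r \<longrightarrow>
        is_weight_valuation D \<psi> lf H W v \<longrightarrow>
          (\<exists>i\<le>pd_m D. \<exists>\<gamma>\<in>coords {..<r}.
            (\<forall>g. g \<noteq> 0 \<longrightarrow> extend_valuation v (line_field_embed \<psi> g) =
                pm_scale (ord_at (pd_point D i) g) \<gamma>) \<and>
            (\<forall>w\<in>rel_interior (trop_facet d (pd_m D) H i).
              initial_ideal H (mat_weight W) (J_ideal D lf H) =
              initial_ideal H (vec_weight w) (J_ideal D lf H))) \<and>
          rat_vec ` value_semigroup v = monoid_hull (W ` H))"
proof -
  have rd: "r = Suc d" using X r by (simp add: rational_complexity_one_def)
  have rank: "q_dim (rat_vec ` group_hull (value_semigroup v)) = Suc d"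
    using v(2) r rd by (simp add: full_rank_def)
  have pv: "presented_valuation \<kappa> G v d r D \<psi>" if "is_pdivisor d D" "is_graded_iso d \<kappa> G D \<psi>" for D \<psi>
    using that X v(1) by unfold_locales (simp_all add: rational_complexity_one_def)
  have scp: "semi_canonical_presentation \<kappa> G v d r D \<psi> lf H" if "is_semi_canonical d \<kappa> G D \<psi> lf H" for D \<psi> lf H
    using that pv[of D \<psi>]
    by (simp add: is_semi_canonical_def semi_canonical_presentation_def semi_canonical_presentation_axioms_def)
  have khovanskii: "is_homogeneous_valuation d G v"
    if sc: "is_semi_canonical d \<kappa> G D \<psi> lf H" and K: "is_khovanskii_basis v (generating_set D \<psi> lf H)" for D \<psi> lf H
  proof -
    interpret semi_canonical_presentation \<kappa> G v d r D \<psi> lf H by (rule scp[OF sc])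
    show ?thesis using khovanskii_homogeneous[OF rank] K by (simp add: homogeneous_iff khovanskii_iff)
  qed
  have weight: "is_homogeneous_valuation d G v"
    if sc: "is_semi_canonical d \<kappa> G D \<psi> lf H" and W: "W \<in> trop_r r H (J_ideal D lf H)" "is_weight_valuation D \<psi> lf H W v"
    for D \<psi> lf H W
  proof -
    interpret semi_canonical_presentation \<kappa> G v d r D \<psi> lf H by (rule scp[OF sc])
    show ?thesis
      using weight_valuation_homogeneous[OF tropical_weights_are_values[OF W] W(2)] by (simp add: homogeneous_iff)
  qed
  have homogeneous: "\<exists>D \<psi> lf H W. is_semi_canonical d \<kappa> G D \<psi> lf H \<and>
      is_khovanskii_basis v (generating_set D \<psi> lf H) \<and>
      W \<in> trop_r r H (J_ideal D lf H) \<and> mat_rank H W = r \<and> is_weight_valuation D \<psi> lf H W v"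
    if hom: "is_homogeneous_valuation d G v"
  proof -
    obtain D0 \<psi> where D0: "is_pdivisor d D0" "is_graded_iso d \<kappa> G D0 \<psi>" using X_presented by blast
    interpret P0: presented_valuation \<kappa> G v d r D0 \<psi> by (rule pv[OF D0])
    obtain Q \<gamma> where Q: "0 \<le> \<gamma>" "\<And>g. g \<noteq> 0 \<Longrightarrow> P0.hval 0 g = pm_scale (ord_at Q g) \<gamma>"
      using P0.hval_function_field by metis
    obtain D i where Di: "is_pdivisor d D" "is_graded_iso d \<kappa> G D \<psi>" "i \<le> pd_m D" "pd_point D i = Q"
      by (rule presentation_with_point[OF D0])
    obtain lf H where sc: "is_semi_canonical d \<kappa> G D \<psi> lf H"
      by (rule semi_canonical_exists[OF Di(1,2)])
    interpret semi_canonical_presentation \<kappa> G v d r D \<psi> lf H by (rule scp[OF sc])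
    have Q': "hval 0 g = pm_scale (ord_at (pd_point D i) g) \<gamma>" if "g \<noteq> 0" for g
      using Q(2)[OF that] by (simp add: Di(4))
    have min: "v f = hmin f" if "f \<noteq> 0" for f
      using hom that by (simp add: homogeneous_iff)
    define W where "W h = rat_vec (hv h)" for h
    have K: "monoid_hull (hv ` H) = value_semigroup v"
      by (rule homogeneous_value_semigroup[OF min Q' Di(3) Q(1)])
    have "mat_rank H W = r"
      using mat_rank_values[OF K, of W] rank rd by (simp add: W_def)
    moreover have "W \<in> trop_r r H (J_ideal D lf H)"
    proof -
      have "hv h \<in> coords {..<r}" if "h \<in> H" for h
        unfolding hv_def by (rule hval_coords[OF generator_weight[OF that] zmon_nonzero[OF lf]])
      then have "W ` H \<subseteq> coords {..<r}" by (auto simp: W_def)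
      then show ?thesis using no_monomial_in_initial_ideal[of W] by (simp add: trop_r_def W_def)
    qed
    moreover have "is_weight_valuation D \<psi> lf H W v"
      by (rule homogeneous_weight_valuation[OF min Q' Di(3) Q(1)]) (simp_all add: W_def)
    moreover have "is_khovanskii_basis v (generating_set D \<psi> lf H)"
      using K by (simp add: khovanskii_iff)
    ultimately show ?thesis using sc by blast
  qed
  have facet: "(\<exists>i\<le>pd_m D. \<exists>\<gamma>\<in>coords {..<r}.
            (\<forall>g. g \<noteq> 0 \<longrightarrow> extend_valuation v (line_field_embed \<psi> g) =
                pm_scale (ord_at (pd_point D i) g) \<gamma>) \<and>
            (\<forall>w\<in>rel_interior (trop_facet d (pd_m D) H i).
              initial_ideal H (mat_weight W) (J_ideal D lf H) =
              initial_ideal H (vec_weight w) (J_ideal D lf H))) \<and>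
          rat_vec ` value_semigroup v = monoid_hull (W ` H)"
    if sc: "is_semi_canonical d \<kappa> G D \<psi> lf H" and W: "W \<in> trop_r r H (J_ideal D lf H)"
      "mat_rank H W = r" "is_weight_valuation D \<psi> lf H W v" for D \<psi> lf H W
  proof -
    interpret semi_canonical_presentation \<kappa> G v d r D \<psi> lf H by (rule scp[OF sc])
    have Wv: "W h = rat_vec (hv h)" if "h \<in> H" for h
      by (rule tropical_weights_are_values[OF W(1,3) that])
    obtain i \<gamma> where i: "i \<le> pd_m D" "0 < \<gamma>" "\<gamma> \<in> coords {..<r}"
      "\<And>g. g \<noteq> 0 \<Longrightarrow> hval 0 g = pm_scale (ord_at (pd_point D i) g) \<gamma>"
      using full_rank_at_boundary_point[of W] Wv W(2) rd by metis
    have "extend_valuation v (line_field_embed \<psi> g) = pm_scale (ord_at (pd_point D i) g) \<gamma>" if "g \<noteq> 0" for g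
      using extend_valuation_line_field[OF that] i(4)[OF that] by simp
    moreover have "initial_ideal H (mat_weight W) (J_ideal D lf H) = initial_ideal H (vec_weight w) (J_ideal D lf H)"
      if "w \<in> rel_interior (trop_facet d (pd_m D) H i)" for w
      by (rule initial_ideal_of_facet[OF Wv i(1,2,4) that])
    moreover have "rat_vec ` value_semigroup v = monoid_hull (W ` H)"
      by (rule weight_valuation_semigroup[OF Wv W(3)])
    ultimately show ?thesis
      using i(1,3) by (intro conjI exI[of _ i] bexI[of _ \<gamma>]) simp_all
  qed
  show ?thesis
  proof (intro conjI iffI)
    assume "is_homogeneous_valuation d G v"
    from homogeneous[OF this]
    show "\<exists>D \<psi> lf H. is_semi_canonical d \<kappa> G D \<psi> lf H \<and> is_khovanskii_basis v (generating_set D \<psi> lf H)"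
      by (elim exE conjE) (intro exI conjI)
  next
    assume "is_homogeneous_valuation d G v"
    from homogeneous[OF this]
    show "\<exists>D \<psi> lf H W. is_semi_canonical d \<kappa> G D \<psi> lf H \<and>
        W \<in> trop_r r H (J_ideal D lf H) \<and> mat_rank H W = r \<and> is_weight_valuation D \<psi> lf H W v"
      by (elim exE conjE) (intro exI conjI)
  next
    assume "\<exists>D \<psi> lf H. is_semi_canonical d \<kappa> G D \<psi> lf H \<and> is_khovanskii_basis v (generating_set D \<psi> lf H)"
    then show "is_homogeneous_valuation d G v"
      by (elim exE conjE) (rule khovanskii)
  next
    assume "\<exists>D \<psi> lf H W. is_semi_canonical d \<kappa> G D \<psi> lf H \<and>
        W \<in> trop_r r H (J_ideal D lf H) \<and> mat_rank H W = r \<and> is_weight_valuation D \<psi> lf H W v"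
    then show "is_homogeneous_valuation d G v"
      by (elim exE conjE) (rule weight)
  qed (intro allI impI facet)
qed

end
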